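(* Let $Q$ be an infinite finitely generated group such that (a) every action of $Q$ on any $X\in\mathcal{X}_{ac}$ has a global fixed point, and (b) for every prime $p$ and every $X\in\mathcal{X}_{ac}$ that is mod-$p$ acyclic, the fixed point set of any action of $Q$ on $X$ is mod-$p$ acyclic. Then $Q$ admits no non-trivial simplicial action on any locally finite simplicial complex $X\in\mathcal{X}_{ac}$.
   Context: For a prime $p$, a space is mod-$p$ acyclic if it has the same mod-$p$ Čech cohomology as a point. $\mathcal{X}_{ac}$ is the class of all Hausdorff spaces $X$ of finite covering dimension such that $X$ is mod-$p$ acyclic for at least one prime $p$. Actions on topological spaces are by homeomorphisms (the group is discrete); an action is non-trivial if some group element acts as a non-identity map. *)

theory Defs
  imports
    "HOL-Analysis.Function_Topology"
    "HOL-Analysis.T1_Spaces"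
    "HOL-Algebra.FiniteProduct"
    "HOL-Algebra.Product_Groups"
    "HOL-Algebra.Elementary_Groups"
    "HOL-Algebra.Generated_Groups"
    "HOL-Algebra.Group_Action"
    "HOL-Computational_Algebra.Primes"
begin

section \<open>Simplicial complexes and their cohomology\<close>

definition abstract_complex :: "'v set set \<Rightarrow> bool" where
  "abstract_complex K \<longleftrightarrow>
     (\<forall>s\<in>K. finite s \<and> s \<noteq> {} \<and> (\<forall>t. t \<subseteq> s \<and> t \<noteq> {} \<longrightarrow> t \<in> K))"

definition locally_finite_complex :: "'v set set \<Rightarrow> bool" where
  "locally_finite_complex K \<longleftrightarrow> (\<forall>v. finite {s \<in> K. v \<in> s})"

text \<open>
  Cohomology is computed from ordered cochains: an ordered \<open>n\<close>-simplex is any list of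
  \<open>n + 1\<close> vertices, repetitions allowed, that spans a simplex of \<open>K\<close>.
  The coefficient group \<open>A\<close> is an abelian group in multiplicative notation.
\<close>

definition ordered_simplices :: "'v set set \<Rightarrow> nat \<Rightarrow> 'v list set" where
  "ordered_simplices K n = {\<sigma>. length \<sigma> = Suc n \<and> set \<sigma> \<in> K}"

definition cochain_group ::
    "'v set set \<Rightarrow> ('a, 'b) monoid_scheme \<Rightarrow> nat \<Rightarrow> ('v list \<Rightarrow> 'a) monoid" where
  "cochain_group K A n = product_group (ordered_simplices K n) (\<lambda>_. A)"

definition list_face :: "nat \<Rightarrow> 'v list \<Rightarrow> 'v list" where
  "list_face i \<sigma> = take i \<sigma> @ drop (Suc i) \<sigma>"

definition coboundary ::
    "'v set set \<Rightarrow> ('a, 'b) monoid_scheme \<Rightarrow> nat \<Rightarrow> ('v list \<Rightarrow> 'a) \<Rightarrow> ('v list \<Rightarrow> 'a)" where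
  "coboundary K A n f =
     (\<lambda>\<sigma>\<in>ordered_simplices K (Suc n).
        finprod A (\<lambda>i. if even i then f (list_face i \<sigma>) else inv\<^bsub>A\<^esub> (f (list_face i \<sigma>))) {..Suc n})"

definition cocycles ::
    "'v set set \<Rightarrow> ('a, 'b) monoid_scheme \<Rightarrow> nat \<Rightarrow> ('v list \<Rightarrow> 'a) set" where
  "cocycles K A n = kernel (cochain_group K A n) (cochain_group K A (Suc n)) (coboundary K A n)"

definition coboundaries ::
    "'v set set \<Rightarrow> ('a, 'b) monoid_scheme \<Rightarrow> nat \<Rightarrow> ('v list \<Rightarrow> 'a) set" where
  "coboundaries K A n =
     (case n of
        0 \<Rightarrow> {\<one>\<^bsub>cochain_group K A 0\<^esub>}
      | Suc m \<Rightarrow> coboundary K A m ` carrier (cochain_group K A m))"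

definition cohomology_group ::
    "'v set set \<Rightarrow> ('a, 'b) monoid_scheme \<Rightarrow> nat \<Rightarrow> ('v list \<Rightarrow> 'a) set monoid" where
  "cohomology_group K A n =
     (cochain_group K A n)\<lparr>carrier := cocycles K A n\<rparr> Mod coboundaries K A n"

definition pullback_cochain ::
    "'w set set \<Rightarrow> nat \<Rightarrow> ('w \<Rightarrow> 'v) \<Rightarrow> ('v list \<Rightarrow> 'a) \<Rightarrow> ('w list \<Rightarrow> 'a)" where
  "pullback_cochain L n \<pi> f = (\<lambda>\<sigma>\<in>ordered_simplices L n. f (map \<pi> \<sigma>))"

text \<open>
  The map into the cohomology of \<open>L\<close> induced by a simplicial vertex map \<open>\<pi>\<close> from \<open>L\<close>. A class
  \<open>c\<close> is a coset; all members of the union below are the same coset.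
\<close>

definition cohomology_map ::
    "'w set set \<Rightarrow> ('a, 'b) monoid_scheme \<Rightarrow> nat \<Rightarrow> ('w \<Rightarrow> 'v) \<Rightarrow>
      ('v list \<Rightarrow> 'a) set \<Rightarrow> ('w list \<Rightarrow> 'a) set" where
  "cohomology_map L A n \<pi> c =
     (\<Union>f\<in>c. coboundaries L A n #>\<^bsub>cochain_group L A n\<^esub> pullback_cochain L n \<pi> f)"

section \<open>Cech cohomology\<close>

definition sum_inclusion ::
    "'i set \<Rightarrow> ('i \<Rightarrow> ('a, 'b) monoid_scheme) \<Rightarrow> 'i \<Rightarrow> 'a \<Rightarrow> ('i \<Rightarrow> 'a)" where
  "sum_inclusion I G i x = (\<lambda>j\<in>I. if j = i then x else \<one>\<^bsub>G j\<^esub>)"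

text \<open>
  Direct limit of abelian groups, as the direct sum modulo the identifications of \<open>x\<close> with
  \<open>h x\<close>. Here \<open>F i j\<close> is the set of transition maps from \<open>G i\<close> to \<open>G j\<close>.
\<close>

definition direct_limit_group ::
    "'i set \<Rightarrow> ('i \<Rightarrow> ('a, 'b) monoid_scheme) \<Rightarrow> ('i \<Rightarrow> 'i \<Rightarrow> ('a \<Rightarrow> 'a) set) \<Rightarrow>
      ('i \<Rightarrow> 'a) set monoid" where
  "direct_limit_group I G F =
     sum_group I G Mod
       generate (sum_group I G)
         {sum_inclusion I G i x \<otimes>\<^bsub>sum_group I G\<^esub>
            inv\<^bsub>sum_group I G\<^esub> (sum_inclusion I G j (h x))
          | i j h x. i \<in> I \<and> j \<in> I \<and> h \<in> F i j \<and> x \<in> carrier (G i)}"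

definition open_covers :: "'x topology \<Rightarrow> 'x set set set" where
  "open_covers X = {\<U>. (\<forall>U\<in>\<U>. openin X U) \<and> \<Union>\<U> = topspace X}"

definition nerve :: "'x set set \<Rightarrow> 'x set set set" where
  "nerve \<U> = {S. finite S \<and> S \<noteq> {} \<and> S \<subseteq> \<U> \<and> \<Inter>S \<noteq> {}}"

definition refinement_projection ::
    "'x set set \<Rightarrow> 'x set set \<Rightarrow> ('x set \<Rightarrow> 'x set) \<Rightarrow> bool" where
  "refinement_projection \<V> \<U> \<pi> \<longleftrightarrow> (\<forall>V\<in>\<V>. \<pi> V \<in> \<U> \<and> V \<subseteq> \<pi> V)"

text \<open>
  The direct limit runs over all open covers, ordered by refinement. Any two refinement
  projections from \<open>\<V>\<close> to \<open>\<U>\<close> are contiguous, so the transition set from \<open>\<U>\<close> to \<open>\<V>\<close> contains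
  at most one map on cohomology classes.
\<close>

definition cech_cohomology_group ::
    "'x topology \<Rightarrow> ('a, 'b) monoid_scheme \<Rightarrow> nat \<Rightarrow>
      ('x set set \<Rightarrow> ('x set list \<Rightarrow> 'a) set) set monoid" where
  "cech_cohomology_group X A n =
     direct_limit_group (open_covers X)
       (\<lambda>\<U>. cohomology_group (nerve \<U>) A n)
       (\<lambda>\<U> \<V>. {cohomology_map (nerve \<V>) A n \<pi> | \<pi>. refinement_projection \<V> \<U> \<pi>})"

definition mod_acyclic :: "nat \<Rightarrow> 'x topology \<Rightarrow> bool" where
  "mod_acyclic p X \<longleftrightarrow>
     (\<forall>n. cech_cohomology_group X (integer_mod_group p) n \<cong>
          cech_cohomology_group (discrete_topology {()}) (integer_mod_group p) n)"

section \<open>Covering dimension and the class of spaces\<close>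

text \<open>
  Every open cover, not only every finite one, is required to have an open refinement whose
  nerve has dimension at most \<open>n\<close>. This is not the small inductive dimension \<open>dim_le\<close> of the
  library.
\<close>

definition covering_dim_le :: "'x topology \<Rightarrow> nat \<Rightarrow> bool" where
  "covering_dim_le X n \<longleftrightarrow>
     (\<forall>\<U>\<in>open_covers X. \<exists>\<V>\<in>open_covers X.
        (\<forall>V\<in>\<V>. \<exists>U\<in>\<U>. V \<subseteq> U) \<and> (\<forall>S\<in>nerve \<V>. card S \<le> Suc n))"

definition acyclic_spaces :: "'x topology set" where
  "acyclic_spaces =
     {X. Hausdorff_space X \<and> (\<exists>n. covering_dim_le X n) \<and> (\<exists>p. prime p \<and> mod_acyclic p X)}"

section \<open>Group actions on spaces\<close>

definition finitely_generated_group :: "('g, 'm) monoid_scheme \<Rightarrow> bool" where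
  "finitely_generated_group G \<longleftrightarrow>
     (\<exists>S. finite S \<and> S \<subseteq> carrier G \<and> generate G S = carrier G)"

definition topological_action ::
    "('g, 'm) monoid_scheme \<Rightarrow> 'x topology \<Rightarrow> ('g \<Rightarrow> 'x \<Rightarrow> 'x) \<Rightarrow> bool" where
  "topological_action G X \<phi> \<longleftrightarrow>
     group_action G (topspace X) \<phi> \<and> (\<forall>g\<in>carrier G. homeomorphic_map X X (\<phi> g))"

definition fixed_points ::
    "('g, 'm) monoid_scheme \<Rightarrow> 'x topology \<Rightarrow> ('g \<Rightarrow> 'x \<Rightarrow> 'x) \<Rightarrow> 'x set" where
  "fixed_points G X \<phi> = {x \<in> topspace X. \<forall>g\<in>carrier G. \<phi> g x = x}"

definition nontrivial_action ::
    "('g, 'm) monoid_scheme \<Rightarrow> 'x topology \<Rightarrow> ('g \<Rightarrow> 'x \<Rightarrow> 'x) \<Rightarrow> bool" where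
  "nontrivial_action G X \<phi> \<longleftrightarrow> (\<exists>g\<in>carrier G. \<exists>x\<in>topspace X. \<phi> g x \<noteq> x)"

section \<open>Geometric realization and simplicial actions\<close>

text \<open>Points of the realization are given by their barycentric coordinates.\<close>

definition realization_points :: "'v set set \<Rightarrow> ('v \<Rightarrow> real) set" where
  "realization_points K =
     {t. (\<forall>v. 0 \<le> t v) \<and> {v. t v \<noteq> 0} \<in> K \<and> (\<Sum>v | t v \<noteq> 0. t v) = 1}"

definition closed_simplex :: "'v set set \<Rightarrow> 'v set \<Rightarrow> ('v \<Rightarrow> real) set" where
  "closed_simplex K s = {t \<in> realization_points K. {v. t v \<noteq> 0} \<subseteq> s}"

text \<open>
  The weak topology: a set is open iff it meets each closed simplex in an open set. On a closed
  simplex, the product topology on functions is the Euclidean one.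
\<close>

definition realization :: "'v set set \<Rightarrow> ('v \<Rightarrow> real) topology" where
  "realization K =
     topology (\<lambda>U. U \<subseteq> realization_points K \<and>
       (\<forall>s\<in>K. openin (top_of_set (closed_simplex K s)) (U \<inter> closed_simplex K s)))"

lemma openin_realization:
  "openin (realization K) U \<longleftrightarrow>
     U \<subseteq> realization_points K \<and>
     (\<forall>s\<in>K. openin (top_of_set (closed_simplex K s)) (U \<inter> closed_simplex K s))"
proof -
  let ?P = "\<lambda>U. U \<subseteq> realization_points K \<and>
     (\<forall>s\<in>K. openin (top_of_set (closed_simplex K s)) (U \<inter> closed_simplex K s))"
  have "istopology ?P"
    unfolding istopology_def
  proof (intro conjI allI impI)
    fix S T assume "?P S" "?P T"
    moreover have "S \<inter> T \<inter> C = (S \<inter> C) \<inter> (T \<inter> C)" for C by blast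
    ultimately show "S \<inter> T \<subseteq> realization_points K"
      "\<forall>s\<in>K. openin (top_of_set (closed_simplex K s)) (S \<inter> T \<inter> closed_simplex K s)"
      by (auto simp only: openin_Int)
  next
    fix \<K> assume "\<forall>U\<in>\<K>. ?P U"
    moreover have "\<Union>\<K> \<inter> C = (\<Union>U\<in>\<K>. U \<inter> C)" for C by blast
    ultimately show "\<Union>\<K> \<subseteq> realization_points K"
      "\<forall>s\<in>K. openin (top_of_set (closed_simplex K s)) (\<Union>\<K> \<inter> closed_simplex K s)"
      by (auto simp only: intro!: openin_Union)
  qed
  then show ?thesis
    by (simp add: realization_def topology_inverse')
qed

lemma topspace_realization: "topspace (realization K) = realization_points K"
proof -
  have "realization_points K \<inter> closed_simplex K s = closed_simplex K s" for s
    by (auto simp: closed_simplex_def)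
  then have "openin (realization K) (realization_points K)"
    by (simp add: openin_realization)
  then show ?thesis
    by (metis openin_realization openin_subset openin_topspace subset_antisym)
qed

definition simplicial_vertex_map :: "'v set set \<Rightarrow> 'w set set \<Rightarrow> ('v \<Rightarrow> 'w) \<Rightarrow> bool" where
  "simplicial_vertex_map K L f \<longleftrightarrow> (\<forall>s\<in>K. f ` s \<in> L)"

text \<open>Affine extension of a vertex map to barycentric coordinates.\<close>

definition realization_map :: "('v \<Rightarrow> 'w) \<Rightarrow> ('v \<Rightarrow> real) \<Rightarrow> ('w \<Rightarrow> real)" where
  "realization_map f t = (\<lambda>w. \<Sum>v | t v \<noteq> 0 \<and> f v = w. t v)"

definition simplicial_action ::
    "('g, 'm) monoid_scheme \<Rightarrow> 'v set set \<Rightarrow> ('g \<Rightarrow> ('v \<Rightarrow> real) \<Rightarrow> ('v \<Rightarrow> real)) \<Rightarrow> bool" where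
  "simplicial_action G K \<phi> \<longleftrightarrow>
     topological_action G (realization K) \<phi> \<and>
     (\<forall>g\<in>carrier G. \<exists>f. simplicial_vertex_map K K f \<and>
        (\<forall>t\<in>topspace (realization K). \<phi> g t = realization_map f t))"

end

theory Submission
  imports
    Defs
    "HOL-Analysis.Path_Connected"
    "HOL-Analysis.Function_Metric"
    "HOL-Number_Theory.Cong"
begin

text \<open>
  Suppose \<open>Q\<close> acts non-trivially and simplicially on a locally finite complex \<open>K\<close> whose
  realization is an acyclic space. The realization is connected, because \<open>H\<^sup>0\<close> counts clopen pieces
  (\<open>mod_acyclic_imp_connected_space\<close>), and hypothesis (a) gives a fixed point. The simplex that carries
  the fixed point is invariant, so the balls around it in the vertex set are invariant too; they are
  finite by local finiteness, and by connectedness they exhaust the vertices. Hence \<open>Q\<close> moves a point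
  of a finite invariant set (\<open>simplicial_action_finite_orbit\<close>): it has a non-trivial finite quotient
  \<open>P\<close>. The rest of the proof is that hypothesis (b) excludes this.

  Let \<open>P\<close> have \<open>m \<ge> 2\<close> elements, and let \<open>X\<close> be the suspension of the finite set \<open>P\<close>: two
  poles joined by \<open>m\<close> arcs, which \<open>P\<close> permutes by left translation. Consider the self-map of \<open>X\<close> that
  fixes the poles and sends the arc \<open>s\<close> along the path which runs up one arc, down \<open>s\<close>, up another
  arc, down \<open>s\<close>, and so on; the \<open>2 m\<close> upward laps follow the arcs \<open>r j s\<close>, where \<open>r j\<close> is the right
  translation by the \<open>j\<close>-th element and each element is used twice. Right translations commute with
  left ones, so the map is \<open>P\<close>-equivariant. On cellular chains it sends \<open>s\<close> to twice the sum of all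
  arcs minus \<open>(2 m - 1) s\<close>. Modulo a prime \<open>p\<close> that divides \<open>2 m - 1\<close> this does not depend on \<open>s\<close>, so
  the map annihilates \<open>H\<^sup>1(X; \<int>/p)\<close>. The inverse limit of copies of \<open>X\<close> along this map is therefore
  a one-dimensional compact mod-\<open>p\<close> acyclic space (\<open>mod_acyclic_limit\<close>), on which \<open>Q\<close> acts with only
  the two poles fixed (\<open>limit_action\<close>). Two points are not connected, hence not mod-\<open>p\<close> acyclic,
  against (b). The prime \<open>p\<close> is unrelated to the one for which \<open>K\<close> is acyclic.

  The cohomology of the limit is computed on explicit covers. Every open cover is refined by the cover
  by open stars of a fine grid at a late stage (\<open>star_covers_cofinal\<close>); its nerve is a graph, which
  settles degrees at least 2 (\<open>graph_cocycle_is_coboundary\<close>), and in degree 1 a cocycle becomes a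
  coboundary one stage later (\<open>first_cocycles_vanish\<close>).

  Hypotheses (a) and (b) speak of spaces on one type \<open>'u\<close>. Both spaces to which they are applied have
  at most continuum many points, so they have homeomorphic copies on \<open>'u\<close>, and Cech cohomology is
  invariant under homeomorphisms between spaces on different types (\<open>cech_homeomorphic_iso\<close>).
\<close>

section \<open>Ordered cochains\<close>

text \<open>
  The coboundary operator on functions of all lists, without reference to a complex. The restriction
  to the simplices of a complex is \<open>coboundary\<close>; on all lists the operator satisfies a recursion in the
  list, which replaces the usual computations with face indices.
\<close>

definition cobd :: "('a, 'b) monoid_scheme \<Rightarrow> ('v list \<Rightarrow> 'a) \<Rightarrow> 'v list \<Rightarrow> 'a" where
  "cobd A f \<sigma> =
     finprod A (\<lambda>i. if even i then f (list_face i \<sigma>) else inv\<^bsub>A\<^esub> (f (list_face i \<sigma>))) {..<length \<sigma>}"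

lemma list_face_Cons [simp]:
  "list_face 0 (x # \<sigma>) = \<sigma>" "list_face (Suc i) (x # \<sigma>) = x # list_face i \<sigma>"
  by (simp_all add: list_face_def)

lemma length_list_face: "i < length \<sigma> \<Longrightarrow> length (list_face i \<sigma>) = length \<sigma> - 1"
  by (simp add: list_face_def)

lemma set_list_face: "set (list_face i \<sigma>) \<subseteq> set \<sigma>"
  by (auto simp: list_face_def dest: in_set_takeD in_set_dropD)

lemma map_list_face: "list_face i (map f \<sigma>) = map f (list_face i \<sigma>)"
  by (simp add: list_face_def take_map drop_map)

lemma list_face_ordered_simplices:
  assumes "abstract_complex K" "\<sigma> \<in> ordered_simplices K (Suc n)" "i < length \<sigma>"
  shows "list_face i \<sigma> \<in> ordered_simplices K n"
proof -
  have "length (list_face i \<sigma>) = Suc n"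
    using assms by (simp add: ordered_simplices_def length_list_face)
  then have "set (list_face i \<sigma>) \<noteq> {}"
    by auto
  with assms set_list_face[of i \<sigma>] \<open>length (list_face i \<sigma>) = Suc n\<close> show ?thesis
    by (auto simp: ordered_simplices_def abstract_complex_def)
qed

lemma (in comm_group) inv_finprod:
  assumes "f \<in> S \<rightarrow> carrier G"
  shows "inv (finprod G f S) = finprod G (\<lambda>i. inv (f i)) S"
proof (cases "finite S")
  case True
  then show ?thesis using assms
    by (induction S rule: finite_induct) (auto simp: Pi_iff inv_mult)
qed simp

context comm_group begin

lemma cobd_closed [simp]:
  assumes "\<And>i. i < length \<sigma> \<Longrightarrow> f (list_face i \<sigma>) \<in> carrier G"
  shows "cobd G f \<sigma> \<in> carrier G"
  unfolding cobd_def by (rule finprod_closed) (use assms in auto)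

lemma cobd_cong:
  assumes "\<And>i. i < length \<sigma> \<Longrightarrow> f (list_face i \<sigma>) = g (list_face i \<sigma>)"
    and "\<And>i. i < length \<sigma> \<Longrightarrow> g (list_face i \<sigma>) \<in> carrier G"
  shows "cobd G f \<sigma> = cobd G g \<sigma>"
  unfolding cobd_def by (rule finprod_cong') (use assms in auto)

lemma cobd_mult:
  assumes "\<And>i. i < length \<sigma> \<Longrightarrow> f (list_face i \<sigma>) \<in> carrier G"
    and "\<And>i. i < length \<sigma> \<Longrightarrow> g (list_face i \<sigma>) \<in> carrier G"
  shows "cobd G (\<lambda>\<tau>. f \<tau> \<otimes> g \<tau>) \<sigma> = cobd G f \<sigma> \<otimes> cobd G g \<sigma>"
proof -
  let ?s = "\<lambda>h i. if even i then h (list_face i \<sigma>) else inv (h (list_face i \<sigma>))"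
  have "cobd G f \<sigma> \<otimes> cobd G g \<sigma> = finprod G (\<lambda>i. ?s f i \<otimes> ?s g i) {..<length \<sigma>}"
    unfolding cobd_def using assms by (intro finprod_multf[symmetric]) auto
  also have "\<dots> = cobd G (\<lambda>\<tau>. f \<tau> \<otimes> g \<tau>) \<sigma>"
    unfolding cobd_def using assms by (intro finprod_cong') (auto simp: inv_mult)
  finally show ?thesis ..
qed

lemma cobd_inv:
  assumes "\<And>i. i < length \<sigma> \<Longrightarrow> f (list_face i \<sigma>) \<in> carrier G"
  shows "cobd G (\<lambda>\<tau>. inv (f \<tau>)) \<sigma> = inv (cobd G f \<sigma>)"
  unfolding cobd_def
  by (subst inv_finprod) (use assms in \<open>auto intro!: finprod_cong'\<close>)

lemma cobd_one: "(\<And>i. i < length \<sigma> \<Longrightarrow> f (list_face i \<sigma>) = \<one>) \<Longrightarrow> cobd G f \<sigma> = \<one>"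
  unfolding cobd_def by (rule finprod_one_eqI) auto

lemma cobd_Nil [simp]: "cobd G f [] = \<one>"
  by (simp add: cobd_def)

text \<open>
  Face \<open>0\<close> of \<open>x # \<sigma>\<close> is \<open>\<sigma>\<close>, and face \<open>i + 1\<close> is \<open>x\<close> in front of face \<open>i\<close> of \<open>\<sigma>\<close>, with the opposite
  sign. Read as a statement about \<open>f (x # _)\<close>, this is the cone homotopy with apex \<open>x\<close>.
\<close>

lemma cobd_Cons:
  assumes "f \<sigma> \<in> carrier G" "\<And>i. i < length \<sigma> \<Longrightarrow> f (x # list_face i \<sigma>) \<in> carrier G"
  shows "cobd G f (x # \<sigma>) = f \<sigma> \<otimes> inv (cobd G (\<lambda>\<tau>. f (x # \<tau>)) \<sigma>)"
proof -
  let ?h = "\<lambda>i. if even i then f (list_face i (x # \<sigma>)) else inv (f (list_face i (x # \<sigma>)))"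
  have "cobd G f (x # \<sigma>) = finprod G ?h (insert 0 (Suc ` {..<length \<sigma>}))"
    by (simp add: cobd_def lessThan_Suc_eq_insert_0)
  also have "\<dots> = f \<sigma> \<otimes> finprod G ?h (Suc ` {..<length \<sigma>})"
    using assms by (subst finprod_insert) auto
  also have "finprod G ?h (Suc ` {..<length \<sigma>}) = finprod G (\<lambda>i. ?h (Suc i)) {..<length \<sigma>}"
    using assms by (intro finprod_reindex) auto
  also have "\<dots> = inv (cobd G (\<lambda>\<tau>. f (x # \<tau>)) \<sigma>)"
    unfolding cobd_def
    by (subst inv_finprod) (use assms in \<open>auto intro!: finprod_cong'\<close>)
  finally show ?thesis .
qed

text \<open>
  Write \<open>f\<^sub>x\<close> for \<open>f (x # _)\<close>. Two uses of the recursion give, in additive notation,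
  \<open>d d f (x # \<sigma>) = d f \<sigma> - d (f - d f\<^sub>x) \<sigma> = d d f\<^sub>x \<sigma>\<close>, which vanishes by induction on the list.
\<close>

lemma cobd_cobd:
  assumes "\<And>\<tau>. f \<tau> \<in> carrier G"
  shows "cobd G (cobd G f) \<sigma> = \<one>"
  using assms
proof (induction \<sigma> arbitrary: f)
  case (Cons x \<sigma>)
  let ?fx = "\<lambda>\<tau>. f (x # \<tau>)"
  have "cobd G (\<lambda>\<tau>. cobd G f (x # \<tau>)) \<sigma> = cobd G (\<lambda>\<tau>. f \<tau> \<otimes> inv (cobd G ?fx \<tau>)) \<sigma>"
    using Cons.prems by (intro cobd_cong) (auto simp: cobd_Cons)
  also have "\<dots> = cobd G f \<sigma> \<otimes> inv (cobd G (cobd G ?fx) \<sigma>)"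
    using Cons.prems by (simp add: cobd_mult cobd_inv)
  also have "\<dots> = cobd G f \<sigma>"
    using Cons by simp
  finally show ?case
    using Cons.prems by (simp add: cobd_Cons r_inv)
qed simp

end

section \<open>Cohomology groups\<close>

lemma coboundary_eq_cobd:
  "coboundary K A n f = (\<lambda>\<sigma>\<in>ordered_simplices K (Suc n). cobd A f \<sigma>)"
  unfolding coboundary_def
  by (intro restrict_ext) (simp add: cobd_def ordered_simplices_def lessThan_Suc_atMost)

lemma carrier_cochain_group:
  "carrier (cochain_group K A n) = (\<Pi>\<^sub>E \<sigma>\<in>ordered_simplices K n. carrier A)"
  by (simp add: cochain_group_def)

definition cohomology_class ::
    "'v set set \<Rightarrow> ('a, 'b) monoid_scheme \<Rightarrow> nat \<Rightarrow> ('v list \<Rightarrow> 'a) \<Rightarrow> ('v list \<Rightarrow> 'a) set" where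
  "cohomology_class K A n z = coboundaries K A n #>\<^bsub>cochain_group K A n\<^esub> z"

locale simplicial_cohomology = comm_group A for A :: "('a, 'b) monoid_scheme" (structure) +
  fixes K :: "'v set set"
  assumes complex: "abstract_complex K"
begin

abbreviation "C n \<equiv> cochain_group K A n"

lemma comm_group_cochain: "comm_group (C n)"
  unfolding cochain_group_def
  by (rule group.group_comm_groupI) (auto simp: is_group PiE_iff m_comm intro!: restrict_ext)

lemma cochain_face:
  "f \<in> carrier (C n) \<Longrightarrow> \<sigma> \<in> ordered_simplices K (Suc n) \<Longrightarrow> i < length \<sigma> \<Longrightarrow>
     f (list_face i \<sigma>) \<in> carrier A"
  using list_face_ordered_simplices[OF complex] by (auto simp: carrier_cochain_group)

lemma coboundary_hom: "coboundary K A n \<in> hom (C n) (C (Suc n))"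
proof (rule homI)
  fix f g assume f: "f \<in> carrier (C n)" and g: "g \<in> carrier (C n)"
  show "coboundary K A n f \<in> carrier (C (Suc n))"
    using cochain_face[OF f] by (auto simp: carrier_cochain_group coboundary_eq_cobd)
  have "cobd A (f \<otimes>\<^bsub>C n\<^esub> g) \<sigma> = cobd A f \<sigma> \<otimes> cobd A g \<sigma>"
    if s: "\<sigma> \<in> ordered_simplices K (Suc n)" for \<sigma>
  proof -
    have "cobd A (f \<otimes>\<^bsub>C n\<^esub> g) \<sigma> = cobd A (\<lambda>\<tau>. f \<tau> \<otimes> g \<tau>) \<sigma>"
      using cochain_face[OF f s] cochain_face[OF g s] list_face_ordered_simplices[OF complex s]
      by (intro cobd_cong) (auto simp: cochain_group_def)
    then show ?thesis
      using cochain_face[OF f s] cochain_face[OF g s] by (simp add: cobd_mult)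
  qed
  then show "coboundary K A n (f \<otimes>\<^bsub>C n\<^esub> g) = coboundary K A n f \<otimes>\<^bsub>C (Suc n)\<^esub> coboundary K A n g"
    unfolding coboundary_eq_cobd by (auto simp: cochain_group_def intro!: restrict_ext)
qed

lemma mem_cocycles_iff:
  "z \<in> cocycles K A n \<longleftrightarrow>
     z \<in> carrier (C n) \<and> (\<forall>\<sigma>\<in>ordered_simplices K (Suc n). cobd A z \<sigma> = \<one>)"
proof -
  have "coboundary K A n z = \<one>\<^bsub>C (Suc n)\<^esub> \<longleftrightarrow> (\<forall>\<sigma>\<in>ordered_simplices K (Suc n). cobd A z \<sigma> = \<one>)"
    by (auto simp: coboundary_eq_cobd cochain_group_def restrict_def fun_eq_iff)
  then show ?thesis
    by (auto simp: cocycles_def kernel_def)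
qed

lemma coboundary_restrict:
  assumes "\<And>\<tau>. f \<tau> \<in> carrier A"
  shows "coboundary K A n (restrict f (ordered_simplices K n)) = restrict (cobd A f) (ordered_simplices K (Suc n))"
  unfolding coboundary_eq_cobd using assms list_face_ordered_simplices[OF complex]
  by (intro restrict_ext cobd_cong) auto

text \<open>
  Coboundaries come from cochains that are defined on all lists, so that the recursion for \<open>cobd\<close>
  applies to them.
\<close>

lemma mem_coboundaries_Suc_iff:
  "z \<in> coboundaries K A (Suc n) \<longleftrightarrow>
     (\<exists>f. (\<forall>\<tau>. f \<tau> \<in> carrier A) \<and> z = restrict (cobd A f) (ordered_simplices K (Suc n)))"
proof
  assume "z \<in> coboundaries K A (Suc n)"
  then obtain g where g: "g \<in> carrier (C n)" and z: "z = coboundary K A n g"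
    by (auto simp: coboundaries_def)
  let ?f = "\<lambda>\<tau>. if \<tau> \<in> ordered_simplices K n then g \<tau> else \<one>"
  have f: "?f \<tau> \<in> carrier A" for \<tau>
    using g by (auto simp: carrier_cochain_group)
  have g': "g = restrict ?f (ordered_simplices K n)"
    using g by (auto simp: carrier_cochain_group PiE_iff extensional_def fun_eq_iff)
  have "z = restrict (cobd A ?f) (ordered_simplices K (Suc n))"
    unfolding z by (subst g') (rule coboundary_restrict[OF f])
  with f show "\<exists>f. (\<forall>\<tau>. f \<tau> \<in> carrier A) \<and> z = restrict (cobd A f) (ordered_simplices K (Suc n))"
    by (intro exI[of _ ?f]) blast
next
  assume "\<exists>f. (\<forall>\<tau>. f \<tau> \<in> carrier A) \<and> z = restrict (cobd A f) (ordered_simplices K (Suc n))"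
  then obtain f where "\<forall>\<tau>. f \<tau> \<in> carrier A" "z = restrict (cobd A f) (ordered_simplices K (Suc n))"
    by blast
  then show "z \<in> coboundaries K A (Suc n)"
    using coboundary_restrict[of f n]
    by (auto simp: coboundaries_def carrier_cochain_group intro!: image_eqI[of _ _ "restrict f (ordered_simplices K n)"])
qed

lemma subgroup_cocycles: "subgroup (cocycles K A n) (C n)"
  unfolding cocycles_def
  by (rule group_hom.subgroup_kernel)
     (simp add: group_hom_def group_hom_axioms_def coboundary_hom comm_group.axioms(2) comm_group_cochain)

lemma coboundaries_subset: "coboundaries K A n \<subseteq> cocycles K A n"
proof (cases n)
  case 0
  then show ?thesis
    using subgroup.one_closed[OF subgroup_cocycles, of 0] by (simp add: coboundaries_def)
next
  case (Suc m)
  show ?thesis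
  proof
    fix z assume "z \<in> coboundaries K A n"
    then obtain f where f: "\<And>\<tau>. f \<tau> \<in> carrier A" and z: "z = restrict (cobd A f) (ordered_simplices K n)"
      unfolding Suc mem_coboundaries_Suc_iff by blast
    have "cobd A z \<sigma> = cobd A (cobd A f) \<sigma>" if "\<sigma> \<in> ordered_simplices K (Suc n)" for \<sigma>
      unfolding z using list_face_ordered_simplices[OF complex that] f by (intro cobd_cong) auto
    with f show "z \<in> cocycles K A n"
      by (auto simp: mem_cocycles_iff z carrier_cochain_group cobd_cobd)
  qed
qed

lemma subgroup_coboundaries: "subgroup (coboundaries K A n) (C n)"
proof (cases n)
  case 0
  then show ?thesis
    using comm_group_cochain[of 0] by (simp add: coboundaries_def group.triv_subgroup comm_group.axioms(2))
next
  case (Suc m)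
  have "group_hom (C m) (C n) (coboundary K A m)"
    by (simp add: Suc group_hom_def group_hom_axioms_def coboundary_hom comm_group.axioms(2) comm_group_cochain)
  then show ?thesis
    using group_hom.img_is_subgroup by (fastforce simp: coboundaries_def Suc)
qed

abbreviation "Z n \<equiv> (C n)\<lparr>carrier := cocycles K A n\<rparr>"

lemma comm_group_Z: "comm_group (Z n)"
proof (rule group.group_comm_groupI)
  interpret Cn: comm_group "C n" by (rule comm_group_cochain)
  show "group (Z n)"
    by (rule subgroup.subgroup_is_group[OF subgroup_cocycles Cn.is_group])
  show "x \<otimes>\<^bsub>Z n\<^esub> y = y \<otimes>\<^bsub>Z n\<^esub> x" if "x \<in> carrier (Z n)" "y \<in> carrier (Z n)" for x y
    using that Cn.m_comm[of x y] subgroup.subset[OF subgroup_cocycles, of n] by (simp add: subset_iff)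
qed

lemma subgroup_coboundaries_Z: "subgroup (coboundaries K A n) (Z n)"
  using group.subgroup_incl comm_group.axioms(2)[OF comm_group_cochain] subgroup_coboundaries
    subgroup_cocycles coboundaries_subset by metis

lemma comm_group_cohomology: "comm_group (cohomology_group K A n)"
  unfolding cohomology_group_def
  using comm_group.abelian_FactGroup[OF comm_group_Z subgroup_coboundaries_Z] .

abbreviation "cls n z \<equiv> cohomology_class K A n z"

lemma cls_Z: "r_coset (Z n) (coboundaries K A n) = cohomology_class K A n"
  by (rule ext) (simp add: cohomology_class_def r_coset_def)

lemma carrier_cohomology: "carrier (cohomology_group K A n) = cohomology_class K A n ` cocycles K A n"
  by (simp only: cohomology_group_def carrier_FactGroup cls_Z) simp

lemma cls_hom: "cohomology_class K A n \<in> hom (Z n) (cohomology_group K A n)"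
proof -
  have "coboundaries K A n \<lhd> Z n"
    using comm_group.subgroup_imp_normal[OF comm_group_Z subgroup_coboundaries_Z] .
  from normal.r_coset_hom_Mod[OF this] show ?thesis
    by (simp only: cohomology_group_def cls_Z)
qed

lemma cls_eq_iff:
  assumes "z \<in> cocycles K A n" "w \<in> cocycles K A n"
  shows "cls n z = cls n w \<longleftrightarrow> (\<exists>b\<in>coboundaries K A n. z = b \<otimes>\<^bsub>C n\<^esub> w)"
proof -
  interpret Cn: comm_group "C n" by (rule comm_group_cochain)
  have c: "z \<in> carrier (C n)" "w \<in> carrier (C n)"
    using assms subgroup.subset[OF subgroup_cocycles] by auto
  show ?thesis
  proof
    assume "cls n z = cls n w"
    then have "z \<in> cls n w"
      using Cn.rcos_self[OF c(1) subgroup_coboundaries] by (simp add: cohomology_class_def)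
    then show "\<exists>b\<in>coboundaries K A n. z = b \<otimes>\<^bsub>C n\<^esub> w"
      by (auto simp: cohomology_class_def r_coset_def)
  next
    assume "\<exists>b\<in>coboundaries K A n. z = b \<otimes>\<^bsub>C n\<^esub> w"
    then have "z \<in> coboundaries K A n #>\<^bsub>C n\<^esub> w"
      by (auto simp: r_coset_def)
    then show "cls n z = cls n w"
      using Cn.repr_independence[OF _ c(2) subgroup_coboundaries] by (simp add: cohomology_class_def)
  qed
qed

lemma cls_coboundary: "z \<in> coboundaries K A n \<Longrightarrow> cls n z = \<one>\<^bsub>cohomology_group K A n\<^esub>"
proof -
  assume z: "z \<in> coboundaries K A n"
  interpret Cn: comm_group "C n" by (rule comm_group_cochain)
  show ?thesis
    using Cn.coset_join2[OF _ subgroup_coboundaries z] z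
      subgroup.subset[OF subgroup_coboundaries] by (auto simp: cohomology_class_def cohomology_group_def)
qed

end

section \<open>Cones and graphs\<close>

context simplicial_cohomology begin

text \<open>
  Extending a cocycle by the unit keeps the cocycle condition on simplices, because all faces of a
  simplex are simplices.
\<close>

lemma cocycle_totalE:
  assumes "z \<in> cocycles K A n"
  obtains f where "\<And>\<tau>. f \<tau> \<in> carrier A" "z = restrict f (ordered_simplices K n)"
    "\<And>\<sigma>. \<sigma> \<in> ordered_simplices K (Suc n) \<Longrightarrow> cobd A f \<sigma> = \<one>"
proof
  let ?f = "\<lambda>\<tau>. if \<tau> \<in> ordered_simplices K n then z \<tau> else \<one>"
  have z: "z \<in> carrier (C n)" "\<And>\<sigma>. \<sigma> \<in> ordered_simplices K (Suc n) \<Longrightarrow> cobd A z \<sigma> = \<one>"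
    using assms by (auto simp: mem_cocycles_iff)
  show f: "?f \<tau> \<in> carrier A" for \<tau>
    using z(1) by (auto simp: carrier_cochain_group)
  show "z = restrict ?f (ordered_simplices K n)"
    using z(1) by (auto simp: carrier_cochain_group PiE_iff extensional_def fun_eq_iff)
  show "cobd A ?f \<sigma> = \<one>" if s: "\<sigma> \<in> ordered_simplices K (Suc n)" for \<sigma>
  proof -
    have "cobd A z \<sigma> = cobd A ?f \<sigma>"
      using list_face_ordered_simplices[OF complex s] z(1)
      by (intro cobd_cong) (auto simp: carrier_cochain_group)
    with z(2)[OF s] show ?thesis by simp
  qed
qed

lemma coboundaryI:
  assumes "\<And>\<tau>. f \<tau> \<in> carrier A" "\<And>\<sigma>. \<sigma> \<in> ordered_simplices K (Suc n) \<Longrightarrow> z \<sigma> = cobd A f \<sigma>"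
    "z \<in> extensional (ordered_simplices K (Suc n))"
  shows "z \<in> coboundaries K A (Suc n)"
  unfolding mem_coboundaries_Suc_iff
  using assms by (intro exI[of _ f]) (auto simp: fun_eq_iff extensional_def)

text \<open>
  The cone formula: on a cone with apex \<open>x\<close>, the cochain \<open>f (x # _)\<close> is a primitive of the cocycle \<open>f\<close>.
\<close>

lemma cocycle_Cons:
  assumes "\<And>\<tau>. f \<tau> \<in> carrier A" "cobd A f (x # \<sigma>) = \<one>"
  shows "f \<sigma> = cobd A (\<lambda>\<tau>. f (x # \<tau>)) \<sigma>"
  using assms cobd_Cons[of f \<sigma> x] inv_solve_right[of \<one> "f \<sigma>" "cobd A (\<lambda>\<tau>. f (x # \<tau>)) \<sigma>"]
  by simp

lemma cone_cocycle_is_coboundary: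
  assumes cone: "\<And>s. s \<in> K \<Longrightarrow> insert v s \<in> K" and z: "z \<in> cocycles K A (Suc n)"
  shows "z \<in> coboundaries K A (Suc n)"
proof -
  obtain f where f: "\<And>\<tau>. f \<tau> \<in> carrier A" "z = restrict f (ordered_simplices K (Suc n))"
    and cobd: "\<And>\<sigma>. \<sigma> \<in> ordered_simplices K (Suc (Suc n)) \<Longrightarrow> cobd A f \<sigma> = \<one>"
    by (rule cocycle_totalE[OF z]) blast
  have "f \<sigma> = cobd A (\<lambda>\<tau>. f (v # \<tau>)) \<sigma>" if "\<sigma> \<in> ordered_simplices K (Suc n)" for \<sigma>
  proof (rule cocycle_Cons[OF f(1)])
    show "cobd A f (v # \<sigma>) = \<one>"
      using that cone by (intro cobd) (auto simp: ordered_simplices_def)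
  qed
  then show ?thesis
    using f by (intro coboundaryI[of "\<lambda>\<tau>. f (v # \<tau>)"]) auto
qed

text \<open>
  Constant lists are degenerate simplices, and the complex of one vertex is a cone. This is the first
  of two steps that make an ordered cocycle on a graph trivial: it is changed by a coboundary so as to
  vanish on constant lists.
\<close>

lemma cocycle_vanishing_on_constants:
  assumes f: "\<And>\<tau>. f \<tau> \<in> carrier A"
    and cobd: "\<And>\<sigma>. \<sigma> \<in> ordered_simplices K (Suc (Suc n)) \<Longrightarrow> cobd A f \<sigma> = \<one>"
  obtains u where "\<And>\<tau>. u \<tau> \<in> carrier A"
    "\<And>v. {v} \<in> K \<Longrightarrow> f (replicate (Suc (Suc n)) v) = cobd A u (replicate (Suc (Suc n)) v)"
proof
  let ?u = "\<lambda>\<tau>. f (hd \<tau> # \<tau>)"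
  show "?u \<tau> \<in> carrier A" for \<tau> by (rule f)
  fix v assume v: "{v} \<in> K"
  let ?\<sigma> = "replicate (Suc (Suc n)) v"
  have "f ?\<sigma> = cobd A (\<lambda>\<tau>. f (v # \<tau>)) ?\<sigma>"
    by (rule cocycle_Cons[OF f], rule cobd) (use v in \<open>auto simp: ordered_simplices_def set_replicate_conv_if\<close>)
  also have "\<dots> = cobd A ?u ?\<sigma>"
  proof (rule cobd_cong)
    fix i assume i: "i < length ?\<sigma>"
    have "list_face i ?\<sigma> \<noteq> []"
      using length_list_face[OF i] by auto
    then have "hd (list_face i ?\<sigma>) \<in> set ?\<sigma>"
      using set_list_face[of i ?\<sigma>] hd_in_set by blast
    then show "f (v # list_face i ?\<sigma>) = ?u (list_face i ?\<sigma>)"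
      by (auto simp: set_replicate_conv_if split: if_splits)
  qed (rule f)
  finally show "f ?\<sigma> = cobd A ?u ?\<sigma>" .
qed

lemma list_eq_replicate: "length \<tau> = n \<Longrightarrow> set \<tau> \<subseteq> {v} \<Longrightarrow> \<tau> = replicate n v"
  by (metis replicate_eqI singletonD subsetD)

text \<open>
  The second step, for one edge \<open>{b, w}\<close>. The cone formula with apex \<open>b\<close> gives a primitive on the edge,
  but primitives on different edges fit together only if they agree at the common vertices. The cone
  primitive vanishes at \<open>b\<close>. Its restriction to constant lists at \<open>w\<close> is again a cocycle of positive degree
  on a point, so it is the coboundary of a cochain \<open>k\<close> that lives on constant lists at \<open>w\<close>, and subtracting that
  coboundary makes the primitive vanish at both ends.
\<close>

lemma edge_cochain:
  assumes f: "\<And>\<tau>. f \<tau> \<in> carrier A"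
    and cobd: "\<And>\<sigma>. \<sigma> \<in> ordered_simplices K (Suc (Suc (Suc n))) \<Longrightarrow> cobd A f \<sigma> = \<one>"
    and const: "\<And>v. {v} \<in> K \<Longrightarrow> f (replicate (Suc (Suc (Suc n))) v) = \<one>"
    and bw: "{b, w} \<in> K" "b \<noteq> w"
  obtains G where "\<And>\<tau>. G \<tau> \<in> carrier A"
    "\<And>v. v \<in> {b, w} \<Longrightarrow> G (replicate (Suc (Suc n)) v) = \<one>"
    "\<And>\<sigma>. \<sigma> \<in> ordered_simplices K (Suc (Suc n)) \<Longrightarrow> set \<sigma> \<subseteq> {b, w} \<Longrightarrow> cobd A G \<sigma> = f \<sigma>"
proof
  define k where "k = (\<lambda>\<tau>. if set \<tau> = {w} then f (b # w # \<tau>) else \<one>)"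
  have k: "k \<tau> \<in> carrier A" for \<tau> by (simp add: k_def f)
  define G where "G = (\<lambda>\<tau>. f (b # \<tau>) \<otimes> inv (cobd A k \<tau>))"
  show "G \<tau> \<in> carrier A" for \<tau> by (simp add: G_def f k)
  have sub: "t \<in> K" if "t \<subseteq> {b, w}" "t \<noteq> {}" for t
    using complex bw(1) that unfolding abstract_complex_def by blast
  have cone: "f \<sigma> = cobd A (\<lambda>\<tau>. f (b # \<tau>)) \<sigma>"
    if "\<sigma> \<in> ordered_simplices K (Suc (Suc n))" "set \<sigma> \<subseteq> {b, w}" for \<sigma>
  proof (rule cocycle_Cons[OF f], rule cobd)
    show "b # \<sigma> \<in> ordered_simplices K (Suc (Suc (Suc n)))"
      using that sub[of "set (b # \<sigma>)"] by (simp add: ordered_simplices_def)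
  qed
  show "cobd A G \<sigma> = f \<sigma>" if "\<sigma> \<in> ordered_simplices K (Suc (Suc n))" "set \<sigma> \<subseteq> {b, w}" for \<sigma>
    using cone[OF that] by (simp add: G_def cobd_mult cobd_inv cobd_cobd f k)
  fix v assume "v \<in> {b, w}"
  then consider "v = b" | "v = w" by blast
  then show "G (replicate (Suc (Suc n)) v) = \<one>"
  proof cases
    case 1
    have "k (list_face i (replicate (Suc (Suc n)) b)) = \<one>" if "i < Suc (Suc n)" for i
    proof -
      have "set (list_face i (replicate (Suc (Suc n)) b)) \<subseteq> {b}"
        using set_list_face[of i "replicate (Suc (Suc n)) b"] by (simp only: set_replicate_Suc)
      then show ?thesis using bw by (auto simp: k_def)
    qed
    then have "cobd A k (replicate (Suc (Suc n)) b) = \<one>"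
      by (intro cobd_one) simp
    moreover have "f (b # replicate (Suc (Suc n)) b) = \<one>"
      using const[of b] sub[of "{b}"] by simp
    ultimately show ?thesis by (simp add: G_def 1)
  next
    case 2
    let ?w = "replicate (Suc (Suc n)) w"
    have "cobd A (\<lambda>\<tau>. f (b # \<tau>)) (w # ?w) = \<one>"
      using cone[of "w # ?w"] const[of w] sub[of "{w}"]
      by (simp add: ordered_simplices_def set_replicate_conv_if)
    then have "f (b # ?w) = cobd A (\<lambda>\<tau>. f (b # w # \<tau>)) ?w"
      using cocycle_Cons[of "\<lambda>\<tau>. f (b # \<tau>)" w ?w] f by blast
    also have "\<dots> = cobd A k ?w"
    proof (rule cobd_cong)
      fix i assume i: "i < length ?w"
      have "list_face i ?w \<noteq> []"
        using length_list_face[OF i] by auto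
      then have "set (list_face i ?w) = {w}"
        using set_list_face[of i ?w] by (simp only: set_replicate_Suc subset_singleton_iff set_empty simp_thms)
      then show "f (b # w # list_face i ?w) = k (list_face i ?w)"
        by (simp add: k_def)
    qed (rule k)
    finally show ?thesis by (simp add: G_def 2 k del: replicate.simps)
  qed
qed

text \<open>
  A complex of dimension at most 1 has no cohomology in degrees at least 2. With ordered simplices there
  are non-zero cochains in every degree, so this is not a matter of counting: the primitives on the
  edges, which vanish on constant lists, are glued together.
\<close>

lemma graph_cocycle_is_coboundary:
  assumes graph: "\<And>s. s \<in> K \<Longrightarrow> card s \<le> 2" and z: "z \<in> cocycles K A (Suc (Suc n))"
  shows "z \<in> coboundaries K A (Suc (Suc n))"
proof -
  let ?N = "Suc (Suc n)"
  obtain f where f: "\<And>\<tau>. f \<tau> \<in> carrier A" "z = restrict f (ordered_simplices K ?N)"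
    and cobd: "\<And>\<sigma>. \<sigma> \<in> ordered_simplices K (Suc ?N) \<Longrightarrow> cobd A f \<sigma> = \<one>"
    by (rule cocycle_totalE[OF z]) blast
  obtain u where u: "\<And>\<tau>. u \<tau> \<in> carrier A"
    and uf: "\<And>v. {v} \<in> K \<Longrightarrow> f (replicate (Suc ?N) v) = cobd A u (replicate (Suc ?N) v)"
    by (rule cocycle_vanishing_on_constants[where f = f and n = "Suc n", OF f(1)]) (use cobd in blast)+
  define h where "h = (\<lambda>\<tau>. f \<tau> \<otimes> inv (cobd A u \<tau>))"
  have h: "h \<tau> \<in> carrier A" for \<tau> by (simp add: h_def f u)
  have cobd_h: "cobd A h \<sigma> = \<one>" if "\<sigma> \<in> ordered_simplices K (Suc ?N)" for \<sigma>
    using cobd[OF that] by (simp add: h_def cobd_mult cobd_inv cobd_cobd f u)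
  have const_h: "h (replicate (Suc ?N) v) = \<one>" if "{v} \<in> K" for v
    unfolding h_def using uf[OF that] u r_inv by (simp del: replicate.simps)
  define good where "good = (\<lambda>s G. (\<forall>\<tau>. G \<tau> \<in> carrier A) \<and>
    (\<forall>v\<in>s. G (replicate ?N v) = \<one>) \<and>
    (\<forall>\<sigma>\<in>ordered_simplices K ?N. set \<sigma> \<subseteq> s \<longrightarrow> cobd A G \<sigma> = h \<sigma>))"
  define G where "G = (\<lambda>s. SOME G. good s G)"
  have good: "good s (G s)" if s: "s \<in> K" "card s = 2" for s
  proof -
    obtain b w where bw: "s = {b, w}" "b \<noteq> w"
      using s(2) by (auto simp: card_2_iff)
    obtain G' where "\<And>\<tau>. G' \<tau> \<in> carrier A" "\<And>v. v \<in> {b, w} \<Longrightarrow> G' (replicate ?N v) = \<one>"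
      "\<And>\<sigma>. \<sigma> \<in> ordered_simplices K ?N \<Longrightarrow> set \<sigma> \<subseteq> {b, w} \<Longrightarrow> cobd A G' \<sigma> = h \<sigma>"
      by (rule edge_cochain[where f = h and n = n and b = b and w = w, OF h cobd_h const_h]) (use s bw in auto)
    then have "good s G'"
      unfolding good_def bw by blast
    then show ?thesis
      unfolding G_def by (rule someI[of "good s"])
  qed
  define g where "g = (\<lambda>\<tau>. if set \<tau> \<in> K \<and> card (set \<tau>) = 2 then G (set \<tau>) \<tau> else \<one>)"
  have g: "g \<tau> \<in> carrier A" for \<tau>
    using good by (auto simp: g_def good_def)
  have "h \<sigma> = cobd A g \<sigma>" if s: "\<sigma> \<in> ordered_simplices K ?N" for \<sigma>
  proof -
    have len: "length \<sigma> = Suc ?N" and K: "set \<sigma> \<in> K"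
      using s by (auto simp: ordered_simplices_def)
    have "card (set \<sigma>) \<noteq> 0"
      using len by auto
    then consider "card (set \<sigma>) = 1" | "card (set \<sigma>) = 2"
      using graph[OF K] by linarith
    then show ?thesis
    proof cases
      case 1
      then obtain v where v: "set \<sigma> = {v}"
        by (auto simp: card_1_singleton_iff)
      then have "h \<sigma> = \<one>"
        using const_h[of v] K list_eq_replicate[OF len, of v] by (metis order_refl)
      moreover have "g (list_face i \<sigma>) = \<one>" for i
        using set_list_face[of i \<sigma>] v by (auto simp: g_def subset_singleton_iff)
      ultimately show ?thesis
        by (simp add: cobd_one)
    next
      case 2
      have "cobd A g \<sigma> = cobd A (G (set \<sigma>)) \<sigma>"
      proof (rule cobd_cong)
        fix i assume i: "i < length \<sigma>"
        let ?\<tau> = "list_face i \<sigma>"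
        have \<tau>: "length ?\<tau> = ?N" "set ?\<tau> \<subseteq> set \<sigma>" "?\<tau> \<noteq> []"
          using length_list_face[OF i] set_list_face[of i \<sigma>] len by auto
        show "g ?\<tau> = G (set \<sigma>) ?\<tau>"
        proof (cases "set ?\<tau> = set \<sigma>")
          case True
          then show ?thesis using K 2 by (simp add: g_def)
        next
          case False
          then have "card (set ?\<tau>) < 2"
            using psubset_card_mono[of "set \<sigma>" "set ?\<tau>"] \<tau>(2) 2 by auto
          moreover have "card (set ?\<tau>) \<noteq> 0"
            using \<tau>(3) by simp
          ultimately have "card (set ?\<tau>) = 1"
            by linarith
          then obtain v where v: "set ?\<tau> = {v}"
            by (rule card_1_singletonE)
          then have "?\<tau> = replicate ?N v"
            by (intro list_eq_replicate[OF \<tau>(1)]) simp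
          moreover have "v \<in> set \<sigma>"
            using v \<tau>(2) by auto
          ultimately have "G (set \<sigma>) ?\<tau> = \<one>"
            using good[OF K 2] by (simp add: good_def)
          then show ?thesis
            by (simp add: g_def v)
        qed
        show "G (set \<sigma>) ?\<tau> \<in> carrier A"
          using good[OF K 2] by (simp add: good_def)
      qed
      then show ?thesis
        using good[OF K 2] s by (simp add: good_def)
    qed
  qed
  moreover have "f \<sigma> = h \<sigma> \<otimes> cobd A u \<sigma>" for \<sigma>
    by (simp add: h_def f u m_assoc)
  ultimately have "f \<sigma> = cobd A (\<lambda>\<tau>. g \<tau> \<otimes> u \<tau>) \<sigma>" if "\<sigma> \<in> ordered_simplices K ?N" for \<sigma>
    using that by (simp add: cobd_mult g u)
  then show ?thesis
    using f g u by (intro coboundaryI[of "\<lambda>\<tau>. g \<tau> \<otimes> u \<tau>"]) auto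
qed

end

section \<open>Induced maps\<close>

lemma cobd_map: "cobd A (\<lambda>\<tau>. f (map \<pi> \<tau>)) \<sigma> = cobd A f (map \<pi> \<sigma>)"
  unfolding cobd_def map_list_face length_map ..

lemma map_ordered_simplices:
  "simplicial_vertex_map L K \<pi> \<Longrightarrow> \<sigma> \<in> ordered_simplices L n \<Longrightarrow> map \<pi> \<sigma> \<in> ordered_simplices K n"
  by (simp add: ordered_simplices_def simplicial_vertex_map_def)

locale simplicial_map_cohomology = dom: simplicial_cohomology A L + cod: simplicial_cohomology A K
  for A :: "('a, 'b) monoid_scheme" (structure) and L :: "'w set set" and K :: "'v set set" +
  fixes \<pi> :: "'w \<Rightarrow> 'v"
  assumes simplicial: "simplicial_vertex_map L K \<pi>"
begin

lemma pullback_restrict: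
  "pullback_cochain L n \<pi> (restrict f (ordered_simplices K n)) =
     restrict (\<lambda>\<tau>. f (map \<pi> \<tau>)) (ordered_simplices L n)"
  using map_ordered_simplices[OF simplicial] by (auto simp: pullback_cochain_def intro!: restrict_ext)

lemma pullback_cocycle:
  assumes "z \<in> cocycles K A n"
  shows "pullback_cochain L n \<pi> z \<in> cocycles L A n"
proof -
  obtain f where f: "\<And>\<tau>. f \<tau> \<in> carrier A" "z = restrict f (ordered_simplices K n)"
    and cobd: "\<And>\<sigma>. \<sigma> \<in> ordered_simplices K (Suc n) \<Longrightarrow> cobd A f \<sigma> = \<one>"
    by (rule cod.cocycle_totalE[OF assms]) blast
  have "cobd A (restrict (\<lambda>\<tau>. f (map \<pi> \<tau>)) (ordered_simplices L n)) \<sigma> = \<one>"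
    if s: "\<sigma> \<in> ordered_simplices L (Suc n)" for \<sigma>
  proof -
    have "cobd A (restrict (\<lambda>\<tau>. f (map \<pi> \<tau>)) (ordered_simplices L n)) \<sigma> = cobd A (\<lambda>\<tau>. f (map \<pi> \<tau>)) \<sigma>"
      using list_face_ordered_simplices[OF dom.complex s] f by (intro dom.cobd_cong) auto
    also have "\<dots> = \<one>"
      using cobd[OF map_ordered_simplices[OF simplicial s]] by (simp add: cobd_map)
    finally show ?thesis .
  qed
  then show ?thesis
    by (auto simp: dom.mem_cocycles_iff f(2) pullback_restrict carrier_cochain_group f(1))
qed

lemma pullback_coboundary:
  assumes "z \<in> coboundaries K A n"
  shows "pullback_cochain L n \<pi> z \<in> coboundaries L A n"
proof (cases n)
  case 0
  then show ?thesis
    using assms map_ordered_simplices[OF simplicial]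
    by (auto simp: coboundaries_def cochain_group_def pullback_cochain_def intro!: restrict_ext)
next
  case (Suc m)
  then obtain f where f: "\<And>\<tau>. f \<tau> \<in> carrier A" "z = restrict (cobd A f) (ordered_simplices K n)"
    using assms cod.mem_coboundaries_Suc_iff by metis
  have "pullback_cochain L n \<pi> z = restrict (cobd A (\<lambda>\<tau>. f (map \<pi> \<tau>))) (ordered_simplices L n)"
    unfolding f(2) pullback_restrict by (simp add: cobd_map[symmetric])
  then show ?thesis
    unfolding Suc dom.mem_coboundaries_Suc_iff using f(1) by (intro exI[of _ "\<lambda>\<tau>. f (map \<pi> \<tau>)"]) auto
qed

lemma pullback_mult:
  "pullback_cochain L n \<pi> (z \<otimes>\<^bsub>cochain_group K A n\<^esub> w) =
     pullback_cochain L n \<pi> z \<otimes>\<^bsub>cochain_group L A n\<^esub> pullback_cochain L n \<pi> w"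
  using map_ordered_simplices[OF simplicial]
  by (auto simp: pullback_cochain_def cochain_group_def intro!: restrict_ext)

text \<open>
  The map induced in cohomology is determined by its effect on one representative; all members of the
  class give the same coset because pullback preserves coboundaries.
\<close>

lemma cohomology_map_class:
  assumes z: "z \<in> cocycles K A n"
  shows "cohomology_map L A n \<pi> (cohomology_class K A n z) =
    cohomology_class L A n (pullback_cochain L n \<pi> z)"
proof -
  have "cohomology_class L A n (pullback_cochain L n \<pi> f) = cohomology_class L A n (pullback_cochain L n \<pi> z)"
    if f: "f \<in> cohomology_class K A n z" for f
  proof -
    obtain b where b: "b \<in> coboundaries K A n" "f = b \<otimes>\<^bsub>cochain_group K A n\<^esub> z"
      using f by (auto simp: cohomology_class_def r_coset_def)
    moreover have "f \<in> cocycles K A n"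
      using subgroup.m_closed[OF cod.subgroup_cocycles] cod.coboundaries_subset b z by blast
    moreover have "pullback_cochain L n \<pi> f =
        pullback_cochain L n \<pi> b \<otimes>\<^bsub>cochain_group L A n\<^esub> pullback_cochain L n \<pi> z"
      by (simp only: b(2) pullback_mult)
    ultimately show ?thesis
      using z pullback_cocycle pullback_coboundary by (subst dom.cls_eq_iff) blast+
  qed
  moreover have "z \<in> cohomology_class K A n z"
    unfolding cohomology_class_def
    using group.rcos_self[OF _ _ cod.subgroup_coboundaries] z cod.mem_cocycles_iff
      comm_group.axioms(2)[OF cod.comm_group_cochain] by metis
  ultimately show ?thesis
    unfolding cohomology_map_def cohomology_class_def[symmetric] by blast
qed

lemma cohomology_map_hom:
  "cohomology_map L A n \<pi> \<in> hom (cohomology_group K A n) (cohomology_group L A n)"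
proof (rule homI)
  fix x y assume "x \<in> carrier (cohomology_group K A n)" "y \<in> carrier (cohomology_group K A n)"
  then obtain z w where z: "z \<in> cocycles K A n" "x = cohomology_class K A n z"
    and w: "w \<in> cocycles K A n" "y = cohomology_class K A n w"
    by (auto simp: cod.carrier_cohomology)
  have zw: "z \<otimes>\<^bsub>cochain_group K A n\<^esub> w \<in> cocycles K A n"
    using subgroup.m_closed[OF cod.subgroup_cocycles] z w by blast
  show "cohomology_map L A n \<pi> x \<in> carrier (cohomology_group L A n)"
    using z by (simp add: cohomology_map_class dom.carrier_cohomology pullback_cocycle)
  have "x \<otimes>\<^bsub>cohomology_group K A n\<^esub> y = cohomology_class K A n (z \<otimes>\<^bsub>cochain_group K A n\<^esub> w)"
    using hom_mult[OF cod.cls_hom, of z n w] z w by simp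
  then show "cohomology_map L A n \<pi> (x \<otimes>\<^bsub>cohomology_group K A n\<^esub> y) =
      cohomology_map L A n \<pi> x \<otimes>\<^bsub>cohomology_group L A n\<^esub> cohomology_map L A n \<pi> y"
    using hom_mult[OF dom.cls_hom, of "pullback_cochain L n \<pi> z" n "pullback_cochain L n \<pi> w"] z w zw
    by (simp add: cohomology_map_class pullback_mult pullback_cocycle)
qed

end

section \<open>Direct limits of abelian groups\<close>

locale direct_system =
  fixes I :: "'i set" and G :: "'i \<Rightarrow> ('a, 'b) monoid_scheme" and F :: "'i \<Rightarrow> 'i \<Rightarrow> ('a \<Rightarrow> 'a) set"
  assumes comm: "\<And>i. i \<in> I \<Longrightarrow> comm_group (G i)"
    and trans_closed:
      "\<And>i j h x. i \<in> I \<Longrightarrow> j \<in> I \<Longrightarrow> h \<in> F i j \<Longrightarrow> x \<in> carrier (G i) \<Longrightarrow> h x \<in> carrier (G j)"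
begin

abbreviation "S \<equiv> sum_group I G"
abbreviation "incl \<equiv> sum_inclusion I G"
abbreviation "colim \<equiv> direct_limit_group I G F"

definition relators :: "('i \<Rightarrow> 'a) set" where
  "relators = {incl i x \<otimes>\<^bsub>S\<^esub> inv\<^bsub>S\<^esub> (incl j (h x))
          | i j h x. i \<in> I \<and> j \<in> I \<and> h \<in> F i j \<and> x \<in> carrier (G i)}"

definition to_colim :: "'i \<Rightarrow> 'a \<Rightarrow> ('i \<Rightarrow> 'a) set" where
  "to_colim i x = generate S relators #>\<^bsub>S\<^esub> incl i x"

lemma grp: "i \<in> I \<Longrightarrow> group (G i)"
  using comm comm_group.axioms(2) by blast

lemma carrier_S: "carrier S = {x \<in> \<Pi>\<^sub>E i\<in>I. carrier (G i). finite {i \<in> I. x i \<noteq> \<one>\<^bsub>G i\<^esub>}}"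
  using carrier_sum_group grp by blast

lemma comm_group_S: "comm_group S"
proof (rule group.group_comm_groupI)
  show "group S" using grp by simp
  fix x y assume "x \<in> carrier S" "y \<in> carrier S"
  then show "x \<otimes>\<^bsub>S\<^esub> y = y \<otimes>\<^bsub>S\<^esub> x"
    using comm_monoid.m_comm[OF comm_group.axioms(1)[OF comm]]
    by (auto simp: carrier_S PiE_iff intro!: restrict_ext)
qed

sublocale S: comm_group S by (rule comm_group_S)

lemma incl_closed: "i \<in> I \<Longrightarrow> x \<in> carrier (G i) \<Longrightarrow> incl i x \<in> carrier S"
proof -
  assume i: "i \<in> I" "x \<in> carrier (G i)"
  have "{j \<in> I. incl i x j \<noteq> \<one>\<^bsub>G j\<^esub>} \<subseteq> {i}"
    by (auto simp: sum_inclusion_def)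
  then have "finite {j \<in> I. incl i x j \<noteq> \<one>\<^bsub>G j\<^esub>}"
    using finite_subset by blast
  with i show ?thesis
    using grp by (auto simp: carrier_S sum_inclusion_def group.is_monoid monoid.one_closed)
qed

lemma incl_mult:
  assumes "i \<in> I" "x \<in> carrier (G i)" "y \<in> carrier (G i)"
  shows "incl i (x \<otimes>\<^bsub>G i\<^esub> y) = incl i x \<otimes>\<^bsub>S\<^esub> incl i y"
  using grp group.is_monoid monoid.l_one monoid.one_closed
  by (fastforce simp: sum_inclusion_def intro!: restrict_ext)

lemma relators_subset: "relators \<subseteq> carrier S"
  using incl_closed trans_closed by (auto simp: relators_def simp del: mult_sum_group inv_sum_group)

lemma colim_eq: "colim = S Mod generate S relators"
  by (simp add: direct_limit_group_def relators_def)

lemma subgroup_relators: "subgroup (generate S relators) S"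
  by (rule S.generate_is_subgroup[OF relators_subset])

lemma normal_relators: "generate S relators \<lhd> S"
  by (rule S.subgroup_imp_normal[OF subgroup_relators])

lemma comm_group_colim: "comm_group colim"
  unfolding colim_eq by (rule S.abelian_FactGroup[OF subgroup_relators])

lemma coset_hom: "r_coset S (generate S relators) \<in> hom S colim"
  unfolding colim_eq by (rule normal.r_coset_hom_Mod[OF normal_relators])

lemma to_colim_hom: "i \<in> I \<Longrightarrow> to_colim i \<in> hom (G i) colim"
  using hom_mult[OF coset_hom] hom_in_carrier[OF coset_hom] incl_closed incl_mult
  by (intro homI) (simp_all add: to_colim_def del: mult_sum_group)

lemma to_colim_transition:
  assumes "i \<in> I" "j \<in> I" "h \<in> F i j" "x \<in> carrier (G i)"
  shows "to_colim j (h x) = to_colim i x"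
proof -
  let ?r = "incl i x \<otimes>\<^bsub>S\<^esub> inv\<^bsub>S\<^esub> (incl j (h x))"
  have c: "incl i x \<in> carrier S" "incl j (h x) \<in> carrier S"
    using assms incl_closed trans_closed by auto
  have "?r \<in> generate S relators"
    using assms by (intro generate.incl) (auto simp: relators_def simp del: mult_sum_group inv_sum_group)
  moreover have "incl i x = ?r \<otimes>\<^bsub>S\<^esub> incl j (h x)"
    using c by (simp add: S.m_assoc S.l_inv del: mult_sum_group inv_sum_group one_sum_group)
  ultimately have "incl i x \<in> generate S relators #>\<^bsub>S\<^esub> incl j (h x)"
    unfolding r_coset_def by blast
  then show ?thesis
    unfolding to_colim_def using S.repr_independence c subgroup_relators by blast
qed

text \<open>
  An element of the direct sum has finite support, so it is a finite product of elements of the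
  summands.
\<close>

lemma colim_generated:
  assumes H: "subgroup H colim" and incl: "\<And>i x. i \<in> I \<Longrightarrow> x \<in> carrier (G i) \<Longrightarrow> to_colim i x \<in> H"
  shows "carrier colim = H"
proof
  have "generate S relators #>\<^bsub>S\<^esub> y \<in> H"
    if "finite T" "T \<subseteq> I" "y \<in> carrier S" "{i \<in> I. y i \<noteq> \<one>\<^bsub>G i\<^esub>} \<subseteq> T" for T y
    using that
  proof (induction T arbitrary: y rule: finite_induct)
    case empty
    then have "y = \<one>\<^bsub>S\<^esub>"
      by (auto simp: carrier_S PiE_iff extensional_def fun_eq_iff)
    then show ?case
      using subgroup.one_closed[OF H] hom_one[OF coset_hom] S.is_group
        comm_group.axioms(2)[OF comm_group_colim] by (simp del: one_sum_group)
  next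
    case (insert i T)
    let ?y = "y(i := \<one>\<^bsub>G i\<^esub>)"
    have i: "i \<in> I" "y i \<in> carrier (G i)" and one: "\<And>j. j \<in> I \<Longrightarrow> \<one>\<^bsub>G j\<^esub> \<in> carrier (G j)"
      using insert.prems by (auto simp: carrier_S group.is_monoid[OF grp] monoid.one_closed)
    have "{j \<in> I. ?y j \<noteq> \<one>\<^bsub>G j\<^esub>} \<subseteq> {j \<in> I. y j \<noteq> \<one>\<^bsub>G j\<^esub>}"
      by auto
    moreover have "finite {j \<in> I. y j \<noteq> \<one>\<^bsub>G j\<^esub>}"
      using insert.prems(2) by (simp add: carrier_S)
    ultimately have "finite {j \<in> I. ?y j \<noteq> \<one>\<^bsub>G j\<^esub>}"
      by (rule finite_subset)
    then have y: "?y \<in> carrier S"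
      using insert.prems(2) i one unfolding carrier_S by (auto simp: PiE_iff extensional_def)
    have "y = incl i (y i) \<otimes>\<^bsub>S\<^esub> ?y"
      using insert.prems(2) i one grp
      by (auto simp: carrier_S PiE_iff extensional_def fun_eq_iff sum_inclusion_def
          group.is_monoid monoid.l_one monoid.r_one)
    then have "generate S relators #>\<^bsub>S\<^esub> y = to_colim i (y i) \<otimes>\<^bsub>colim\<^esub> (generate S relators #>\<^bsub>S\<^esub> ?y)"
      unfolding to_colim_def using hom_mult[OF coset_hom incl_closed[OF i] y] by metis
    moreover have "generate S relators #>\<^bsub>S\<^esub> ?y \<in> H"
      using insert.prems insert.hyps by (intro insert.IH y) auto
    ultimately show ?case
      using subgroup.m_closed[OF H] incl[OF i] by metis
  qed
  then have "generate S relators #>\<^bsub>S\<^esub> y \<in> H" if "y \<in> carrier S" for y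
    using that[unfolded carrier_S] that by blast
  then show "carrier colim \<subseteq> H"
    by (auto simp: colim_eq carrier_FactGroup)
qed (rule subgroup.subset[OF H])

lemma colim_hom_eqI:
  assumes B: "group B" and f: "f \<in> hom colim B" and g: "g \<in> hom colim B"
    and eq: "\<And>i x. i \<in> I \<Longrightarrow> x \<in> carrier (G i) \<Longrightarrow> f (to_colim i x) = g (to_colim i x)"
    and y: "y \<in> carrier colim"
  shows "f y = g y"
proof -
  interpret L: comm_group colim by (rule comm_group_colim)
  interpret f: group_hom colim B f
    using f B by (simp add: group_hom_def group_hom_axioms_def)
  interpret g: group_hom colim B g
    using g B by (simp add: group_hom_def group_hom_axioms_def)
  have "subgroup {y \<in> carrier colim. f y = g y} colim"
    by (rule L.subgroupI) (auto intro!: exI[of _ "\<one>\<^bsub>colim\<^esub>"] simp del: colim_eq)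
  then have "carrier colim = {y \<in> carrier colim. f y = g y}"
    using eq hom_in_carrier[OF to_colim_hom] by (intro colim_generated) auto
  with y show ?thesis by blast
qed

text \<open>
  Homomorphisms out of the limit are constructed by their values on the summands. On the direct sum,
  the product of these values runs over the support only, since the index set is infinite.
\<close>

lemma colim_universal:
  assumes B: "comm_group B" and e: "\<And>i. i \<in> I \<Longrightarrow> e i \<in> hom (G i) B"
    and compat: "\<And>i j h x. i \<in> I \<Longrightarrow> j \<in> I \<Longrightarrow> h \<in> F i j \<Longrightarrow> x \<in> carrier (G i) \<Longrightarrow> e j (h x) = e i x"
  obtains \<Phi> where "\<Phi> \<in> hom colim B" "\<And>i x. i \<in> I \<Longrightarrow> x \<in> carrier (G i) \<Longrightarrow> \<Phi> (to_colim i x) = e i x"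
proof -
  interpret B: comm_group B by (rule B)
  have e_one: "e i \<one>\<^bsub>G i\<^esub> = \<one>\<^bsub>B\<^esub>" if "i \<in> I" for i
    using hom_one[OF e[OF that] grp[OF that] B.is_group] .
  have e_closed: "e i x \<in> carrier B" if "i \<in> I" "x \<in> carrier (G i)" for i x
    using hom_in_carrier[OF e] that by blast
  define supp where "supp = (\<lambda>y. {i \<in> I. y i \<noteq> \<one>\<^bsub>G i\<^esub>})"
  define \<Psi> where "\<Psi> = (\<lambda>y. finprod B (\<lambda>i. e i (y i)) (supp y))"
  have \<Psi>: "\<Psi> y = finprod B (\<lambda>i. e i (y i)) T"
    if "finite T" "T \<subseteq> I" "supp y \<subseteq> T" "y \<in> carrier S" for T y
    unfolding \<Psi>_def using that e_one e_closed
    by (intro B.finprod_mono_neutral_cong_left) (auto simp: supp_def carrier_S PiE_iff)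
  have hom: "\<Psi> \<in> hom S B"
  proof (rule homI)
    fix x y assume x: "x \<in> carrier S" and y: "y \<in> carrier S"
    show "\<Psi> x \<in> carrier B"
      unfolding \<Psi>_def using x e_closed by (intro B.finprod_closed) (auto simp: supp_def carrier_S)
    let ?T = "supp x \<union> supp y"
    have T: "finite ?T" "?T \<subseteq> I"
      using x y by (auto simp: supp_def carrier_S)
    have xy: "x \<otimes>\<^bsub>S\<^esub> y \<in> carrier S"
      using x y by (rule S.m_closed)
    have "supp (x \<otimes>\<^bsub>S\<^esub> y) \<subseteq> ?T"
      using grp by (auto simp: supp_def group.is_monoid monoid.l_one monoid.one_closed)
    then have "\<Psi> (x \<otimes>\<^bsub>S\<^esub> y) = finprod B (\<lambda>i. e i ((x \<otimes>\<^bsub>S\<^esub> y) i)) ?T"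
      using \<Psi> T xy by blast
    also have "\<dots> = finprod B (\<lambda>i. e i (x i) \<otimes>\<^bsub>B\<^esub> e i (y i)) ?T"
      using T x y e_closed by (intro B.finprod_cong') (auto simp: carrier_S PiE_iff hom_mult[OF e])
    also have "\<dots> = finprod B (\<lambda>i. e i (x i)) ?T \<otimes>\<^bsub>B\<^esub> finprod B (\<lambda>i. e i (y i)) ?T"
      using T x y e_closed by (intro B.finprod_multf) (auto simp: carrier_S PiE_iff)
    also have "\<dots> = \<Psi> x \<otimes>\<^bsub>B\<^esub> \<Psi> y"
      using \<Psi>[OF T _ x] \<Psi>[OF T _ y] by simp
    finally show "\<Psi> (x \<otimes>\<^bsub>S\<^esub> y) = \<Psi> x \<otimes>\<^bsub>B\<^esub> \<Psi> y" .
  qed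
  interpret \<Psi>: group_hom S B \<Psi>
    using hom S.is_group B.is_group by (simp add: group_hom_def group_hom_axioms_def)
  have \<Psi>_incl: "\<Psi> (incl i x) = e i x" if i: "i \<in> I" "x \<in> carrier (G i)" for i x
  proof -
    have "\<Psi> (incl i x) = finprod B (\<lambda>j. e j (incl i x j)) {i}"
      using i incl_closed by (intro \<Psi>) (auto simp: supp_def sum_inclusion_def)
    then show ?thesis
      using i e_closed by (simp add: sum_inclusion_def)
  qed
  have "relators \<subseteq> kernel S B \<Psi>"
  proof
    fix r assume "r \<in> relators"
    then obtain i j h x where r: "r = incl i x \<otimes>\<^bsub>S\<^esub> inv\<^bsub>S\<^esub> (incl j (h x))"
      and ij: "i \<in> I" "j \<in> I" "h \<in> F i j" "x \<in> carrier (G i)"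
      unfolding relators_def by blast
    have c: "incl i x \<in> carrier S" "incl j (h x) \<in> carrier S"
      using ij incl_closed trans_closed by auto
    have "\<Psi> r = e i x \<otimes>\<^bsub>B\<^esub> inv\<^bsub>B\<^esub> (e j (h x))"
      unfolding r using c ij trans_closed \<Psi>_incl by (simp del: mult_sum_group inv_sum_group)
    then have "\<Psi> r = \<one>\<^bsub>B\<^esub>"
      using compat[OF ij] e_closed ij by simp
    moreover have "r \<in> carrier S"
      using \<open>r \<in> relators\<close> relators_subset by blast
    ultimately show "r \<in> kernel S B \<Psi>"
      by (simp add: kernel_def)
  qed
  then have ker: "generate S relators \<subseteq> kernel S B \<Psi>"
    using S.generate_subgroup_incl \<Psi>.subgroup_kernel by blast
  have "\<Psi> x = \<Psi> y" if xy: "x \<in> carrier S" "y \<in> carrier S"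
      and eq: "generate S relators #>\<^bsub>S\<^esub> x = generate S relators #>\<^bsub>S\<^esub> y" for x y
  proof -
    obtain r where r: "r \<in> generate S relators" "x = r \<otimes>\<^bsub>S\<^esub> y"
      using S.rcos_self[OF xy(1) subgroup_relators] eq unfolding r_coset_def by auto
    with ker have "r \<in> carrier S" "\<Psi> r = \<one>\<^bsub>B\<^esub>"
      by (auto simp: kernel_def)
    with r xy show ?thesis
      by (simp del: mult_sum_group)
  qed
  then obtain \<Phi> where \<Phi>: "\<Phi> \<in> hom (S Mod generate S relators) B"
    "\<And>x. x \<in> carrier S \<Longrightarrow> \<Phi> (generate S relators #>\<^bsub>S\<^esub> x) = \<Psi> x"
    using FactGroup_universal[OF hom normal_relators] by blast
  show thesis
  proof
    show "\<Phi> \<in> hom colim B"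
      using \<Phi>(1) by (simp add: colim_eq)
    show "\<Phi> (to_colim i x) = e i x" if "i \<in> I" "x \<in> carrier (G i)" for i x
      using that \<Phi>(2) incl_closed \<Psi>_incl by (simp add: to_colim_def)
  qed
qed

end

section \<open>Cech cohomology\<close>

lemma mem_nerve_iff:
  "S \<in> nerve \<U> \<longleftrightarrow> finite S \<and> S \<noteq> {} \<and> S \<subseteq> \<U> \<and> (\<exists>x. \<forall>V\<in>S. x \<in> V)"
  by (auto simp: nerve_def)

lemma abstract_complex_nerve: "abstract_complex (nerve \<U>)"
proof -
  have "t \<in> nerve \<U>" if "s \<in> nerve \<U>" "t \<subseteq> s" "t \<noteq> {}" for s t
    using that unfolding mem_nerve_iff by (meson finite_subset subset_iff)
  moreover have "finite s" "s \<noteq> {}" if "s \<in> nerve \<U>" for s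
    using that by (simp_all add: nerve_def)
  ultimately show ?thesis
    unfolding abstract_complex_def by blast
qed

lemma refinement_simplicial:
  assumes "refinement_projection \<V> \<U> \<pi>"
  shows "simplicial_vertex_map (nerve \<V>) (nerve \<U>) \<pi>"
  unfolding simplicial_vertex_map_def
proof
  fix S assume "S \<in> nerve \<V>"
  then obtain x where S: "finite S" "S \<noteq> {}" "S \<subseteq> \<V>" and x: "\<And>V. V \<in> S \<Longrightarrow> x \<in> V"
    by (auto simp: nerve_def)
  have "x \<in> \<pi> V" if "V \<in> S" for V
    using assms S(3) x[OF that] that by (auto simp: refinement_projection_def)
  then show "\<pi> ` S \<in> nerve \<U>"
    using assms S by (auto simp: mem_nerve_iff refinement_projection_def)
qed

lemma pullback_compose:
  assumes "simplicial_vertex_map M L \<rho>"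
  shows "pullback_cochain M n \<rho> (pullback_cochain L n \<pi> z) = pullback_cochain M n (\<pi> \<circ> \<rho>) z"
  using map_ordered_simplices[OF assms] by (auto simp: pullback_cochain_def intro!: restrict_ext)

text \<open>
  Only the values on vertices of the complex matter. The vertices are the \<open>v\<close> with \<open>{v} \<in> L\<close>.
\<close>

lemma pullback_cong:
  assumes "\<And>v. {v} \<in> L \<Longrightarrow> \<pi> v = \<rho> v" "abstract_complex L"
  shows "pullback_cochain L n \<pi> z = pullback_cochain L n \<rho> z"
proof -
  have eq: "map \<pi> \<sigma> = map \<rho> \<sigma>" if "\<sigma> \<in> ordered_simplices L n" for \<sigma>
    using that assms by (auto simp: ordered_simplices_def abstract_complex_def)
  show ?thesis
    unfolding pullback_cochain_def by (intro restrict_ext arg_cong[where f = z] eq)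
qed

lemma pullback_id: "z \<in> cocycles K A n \<Longrightarrow> pullback_cochain K n (\<lambda>v. v) z = z"
  by (auto simp: pullback_cochain_def cocycles_def kernel_def carrier_cochain_group PiE_iff
      extensional_def fun_eq_iff)

text \<open>
  The empty set may belong to an open cover; it is not a vertex of the nerve.
\<close>

lemma vertex_nerve [simp]: "[V] \<in> ordered_simplices (nerve \<U>) 0 \<longleftrightarrow> V \<in> \<U> \<and> V \<noteq> {}"
  by (auto simp: ordered_simplices_def nerve_def)

locale cech = comm_group A for A :: "('a, 'b) monoid_scheme" (structure) +
  fixes X :: "'x topology" and n :: nat
begin

abbreviation "ncls \<U> z \<equiv> cohomology_class (nerve \<U>) A n z"

lemma simplicial_cohomology_nerve: "simplicial_cohomology A (nerve \<U>)"
  by unfold_locales (rule abstract_complex_nerve)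

lemma simplicial_map_cohomology_nerve:
  "simplicial_vertex_map (nerve \<V>) (nerve \<U>) \<pi> \<Longrightarrow> simplicial_map_cohomology A (nerve \<V>) (nerve \<U>) \<pi>"
  by (intro simplicial_map_cohomology.intro simplicial_cohomology_nerve simplicial_map_cohomology_axioms.intro)

lemma direct_system_cech:
  "direct_system (open_covers X) (\<lambda>\<U>. cohomology_group (nerve \<U>) A n)
     (\<lambda>\<U> \<V>. {cohomology_map (nerve \<V>) A n \<pi> | \<pi>. refinement_projection \<V> \<U> \<pi>})"
proof (rule direct_system.intro)
  show "comm_group (cohomology_group (nerve \<U>) A n)" for \<U> :: "'x set set"
    by (rule simplicial_cohomology.comm_group_cohomology[OF simplicial_cohomology_nerve])
  fix \<U> \<V> :: "'x set set" and h x
  assume "h \<in> {cohomology_map (nerve \<V>) A n \<pi> | \<pi>. refinement_projection \<V> \<U> \<pi>}"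
    and x: "x \<in> carrier (cohomology_group (nerve \<U>) A n)"
  then obtain \<pi> where h: "h = cohomology_map (nerve \<V>) A n \<pi>" "refinement_projection \<V> \<U> \<pi>"
    by blast
  show "h x \<in> carrier (cohomology_group (nerve \<V>) A n)"
    unfolding h(1)
    using hom_in_carrier[OF simplicial_map_cohomology.cohomology_map_hom
        [OF simplicial_map_cohomology_nerve[OF refinement_simplicial[OF h(2)]]] x] .
qed

sublocale direct_system "open_covers X" "\<lambda>\<U>. cohomology_group (nerve \<U>) A n"
   "\<lambda>\<U> \<V>. {cohomology_map (nerve \<V>) A n \<pi> | \<pi>. refinement_projection \<V> \<U> \<pi>}"
  rewrites "direct_limit_group (open_covers X) (\<lambda>\<U>. cohomology_group (nerve \<U>) A n)
   (\<lambda>\<U> \<V>. {cohomology_map (nerve \<V>) A n \<pi> | \<pi>. refinement_projection \<V> \<U> \<pi>}) = cech_cohomology_group X A n"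
  using direct_system_cech by (simp_all add: cech_cohomology_group_def)

lemma carrier_cohomology_nerve:
  "carrier (cohomology_group (nerve \<U>) A n) = ncls \<U> ` cocycles (nerve \<U>) A n"
  by (rule simplicial_cohomology.carrier_cohomology[OF simplicial_cohomology_nerve])

definition cech_class :: "'x set set \<Rightarrow> ('x set list \<Rightarrow> 'a) \<Rightarrow> _" where
  "cech_class \<U> z = to_colim \<U> (ncls \<U> z)"

lemma cech_class_closed:
  "\<U> \<in> open_covers X \<Longrightarrow> z \<in> cocycles (nerve \<U>) A n \<Longrightarrow> cech_class \<U> z \<in> carrier (cech_cohomology_group X A n)"
  unfolding cech_class_def
  using hom_in_carrier[OF to_colim_hom] carrier_cohomology_nerve by blast

lemma cech_class_refine:
  assumes "\<U> \<in> open_covers X" "\<V> \<in> open_covers X" "refinement_projection \<V> \<U> \<pi>"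
    and z: "z \<in> cocycles (nerve \<U>) A n"
  shows "cech_class \<V> (pullback_cochain (nerve \<V>) n \<pi> z) = cech_class \<U> z"
proof -
  have "ncls \<V> (pullback_cochain (nerve \<V>) n \<pi> z) = cohomology_map (nerve \<V>) A n \<pi> (ncls \<U> z)"
    using simplicial_map_cohomology.cohomology_map_class[OF simplicial_map_cohomology_nerve
        [OF refinement_simplicial[OF assms(3)]] z] by simp
  then show ?thesis
    unfolding cech_class_def
    using to_colim_transition[OF assms(1,2), of "cohomology_map (nerve \<V>) A n \<pi>" "ncls \<U> z"]
      assms(3) z carrier_cohomology_nerve by auto
qed

lemma cech_generated:
  assumes "subgroup H (cech_cohomology_group X A n)"
    and "\<And>\<U> z. \<U> \<in> open_covers X \<Longrightarrow> z \<in> cocycles (nerve \<U>) A n \<Longrightarrow> cech_class \<U> z \<in> H"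
  shows "carrier (cech_cohomology_group X A n) = H"
  using assms by (intro colim_generated) (auto simp: carrier_cohomology_nerve cech_class_def)

text \<open>
  A direct limit is trivial as soon as each class dies under some transition map. The limit is
  generated by the classes of single covers, so one cover is treated at a time.
\<close>

lemma cech_trivialI:
  assumes null: "\<And>\<U> z. \<U> \<in> open_covers X \<Longrightarrow> z \<in> cocycles (nerve \<U>) A n \<Longrightarrow>
    \<exists>\<V> \<pi>. \<V> \<in> open_covers X \<and> refinement_projection \<V> \<U> \<pi> \<and>
      pullback_cochain (nerve \<V>) n \<pi> z \<in> coboundaries (nerve \<V>) A n"
  shows "trivial_group (cech_cohomology_group X A n)"
proof -
  have L: "group (cech_cohomology_group X A n)"
    using comm_group_colim by (rule comm_group.axioms(2))
  have "cech_class \<U> z \<in> {\<one>\<^bsub>cech_cohomology_group X A n\<^esub>}"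
    if U: "\<U> \<in> open_covers X" and z: "z \<in> cocycles (nerve \<U>) A n" for \<U> z
  proof -
    from null[OF U z] obtain \<V> \<pi> where V: "\<V> \<in> open_covers X" "refinement_projection \<V> \<U> \<pi>"
      and b: "pullback_cochain (nerve \<V>) n \<pi> z \<in> coboundaries (nerve \<V>) A n"
      by (elim exE conjE) (rule that)
    have "cech_class \<U> z = cech_class \<V> (pullback_cochain (nerve \<V>) n \<pi> z)"
      by (rule cech_class_refine[OF U V z, symmetric])
    also have "\<dots> = to_colim \<V> (\<one>\<^bsub>cohomology_group (nerve \<V>) A n\<^esub>)"
      unfolding cech_class_def simplicial_cohomology.cls_coboundary[OF simplicial_cohomology_nerve b] by (rule refl)
    also have "\<dots> = \<one>\<^bsub>cech_cohomology_group X A n\<^esub>"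
      using to_colim_hom[OF V(1)] grp[OF V(1)] L by (rule hom_one)
    finally show ?thesis by blast
  qed
  then have "carrier (cech_cohomology_group X A n) = {\<one>\<^bsub>cech_cohomology_group X A n\<^esub>}"
    by (rule cech_generated[OF group.triv_subgroup[OF L]])
  with L show ?thesis
    by (simp add: trivial_group_def)
qed

lemma cech_hom_eqI:
  assumes "group B" "f \<in> hom (cech_cohomology_group X A n) B" "g \<in> hom (cech_cohomology_group X A n) B"
    and "\<And>\<U> z. \<U> \<in> open_covers X \<Longrightarrow> z \<in> cocycles (nerve \<U>) A n \<Longrightarrow>
      f (cech_class \<U> z) = g (cech_class \<U> z)"
    and "y \<in> carrier (cech_cohomology_group X A n)"
  shows "f y = g y"
proof (rule colim_hom_eqI[OF assms(1-3) _ assms(5)])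
  fix \<U> x assume U: "\<U> \<in> open_covers X" and "x \<in> carrier (cohomology_group (nerve \<U>) A n)"
  then obtain z where z: "z \<in> cocycles (nerve \<U>) A n" "x = ncls \<U> z"
    unfolding carrier_cohomology_nerve by (elim imageE)
  show "f (to_colim \<U> x) = g (to_colim \<U> x)"
    using assms(4)[OF U z(1)] unfolding z(2) cech_class_def .
qed

lemma cech_universal:
  assumes B: "comm_group B"
    and e_hom: "\<And>\<U>. \<U> \<in> open_covers X \<Longrightarrow> e \<U> \<in> hom (cohomology_group (nerve \<U>) A n) B"
    and compat: "\<And>\<U> \<V> \<pi> z. \<U> \<in> open_covers X \<Longrightarrow> \<V> \<in> open_covers X \<Longrightarrow> refinement_projection \<V> \<U> \<pi> \<Longrightarrow>
      z \<in> cocycles (nerve \<U>) A n \<Longrightarrow> e \<V> (ncls \<V> (pullback_cochain (nerve \<V>) n \<pi> z)) = e \<U> (ncls \<U> z)"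
  obtains \<Phi> where "\<Phi> \<in> hom (cech_cohomology_group X A n) B"
    "\<And>\<U> z. \<U> \<in> open_covers X \<Longrightarrow> z \<in> cocycles (nerve \<U>) A n \<Longrightarrow> \<Phi> (cech_class \<U> z) = e \<U> (ncls \<U> z)"
proof (rule colim_universal[OF B e_hom])
  fix \<U> \<V> h x
  assume UV: "\<U> \<in> open_covers X" "\<V> \<in> open_covers X"
    and "h \<in> {cohomology_map (nerve \<V>) A n \<pi> | \<pi>. refinement_projection \<V> \<U> \<pi>}"
    and "x \<in> carrier (cohomology_group (nerve \<U>) A n)"
  then obtain \<pi> z where h: "h = cohomology_map (nerve \<V>) A n \<pi>" "refinement_projection \<V> \<U> \<pi>"
    and z: "z \<in> cocycles (nerve \<U>) A n" "x = ncls \<U> z"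
    unfolding carrier_cohomology_nerve by (elim imageE CollectE exE conjE)
  have "h x = ncls \<V> (pullback_cochain (nerve \<V>) n \<pi> z)"
    unfolding h(1) z(2)
    by (rule simplicial_map_cohomology.cohomology_map_class[OF simplicial_map_cohomology_nerve
        [OF refinement_simplicial[OF h(2)]] z(1)])
  then show "e \<V> (h x) = e \<U> x"
    using compat[OF UV h(2) z(1)] z(2) by simp
next
  fix \<Phi> assume hom: "\<Phi> \<in> hom (cech_cohomology_group X A n) B"
    and \<Phi>: "\<And>\<U> x. \<U> \<in> open_covers X \<Longrightarrow> x \<in> carrier (cohomology_group (nerve \<U>) A n) \<Longrightarrow> \<Phi> (to_colim \<U> x) = e \<U> x"
  show thesis
  proof (rule that[OF hom])
    fix \<U> z assume "\<U> \<in> open_covers X" and z: "z \<in> cocycles (nerve \<U>) A n"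
    then show "\<Phi> (cech_class \<U> z) = e \<U> (ncls \<U> z)"
      unfolding cech_class_def by (intro \<Phi>) (simp_all add: carrier_cohomology_nerve)
  qed
qed

end

section \<open>Degree zero\<close>

text \<open>
  A \<open>0\<close>-cocycle is a function on the members of the cover that agrees on members with a common point,
  that is, a locally constant function on the space.
\<close>

lemma (in comm_group) mem_cocycles_nerve_0:
  "z \<in> cocycles (nerve \<U>) G 0 \<longleftrightarrow> z \<in> (\<Pi>\<^sub>E \<sigma>\<in>ordered_simplices (nerve \<U>) 0. carrier G) \<and>
     (\<forall>V\<in>\<U>. \<forall>W\<in>\<U>. V \<inter> W \<noteq> {} \<longrightarrow> z [V] = z [W])"
  (is "_ \<longleftrightarrow> ?P \<and> ?C")
proof -
  interpret simplicial_cohomology G "nerve \<U>"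
    by unfold_locales (rule abstract_complex_nerve)
  have "(\<forall>\<sigma>\<in>ordered_simplices (nerve \<U>) (Suc 0). cobd G z \<sigma> = \<one>) \<longleftrightarrow> ?C" if z: ?P
  proof -
    have 1: "[V] \<in> ordered_simplices (nerve \<U>) 0" if "V \<in> \<U>" "V \<noteq> {}" for V
      using that by (auto simp: ordered_simplices_def nerve_def)
    have "cobd G z [V, W] = \<one> \<longleftrightarrow> z [V] = z [W]" if "V \<in> \<U>" "W \<in> \<U>" "V \<inter> W \<noteq> {}" for V W
    proof -
      have c: "z [V] \<in> carrier G" "z [W] \<in> carrier G"
        using that 1[of V] 1[of W] z by auto
      have "cobd G z [V, W] = z [W] \<otimes> inv (z [V])"
      proof -
        have *: "finprod G (\<lambda>i. if even i then z (list_face i [V, W]) else inv z (list_face i [V, W])) {..<2}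
            = z [W] \<otimes> inv (z [V])"
          using c by (simp add: numeral_2_eq_2 lessThan_Suc m_comm)
        then show ?thesis by (simp add: cobd_def numeral_2_eq_2)
      qed
      then show ?thesis
        using c by (metis inv_closed inv_equality inv_inv r_inv)
    qed
    note 2 = this
    have 3: "\<sigma> \<in> ordered_simplices (nerve \<U>) (Suc 0) \<longleftrightarrow>
        (\<exists>V W. \<sigma> = [V, W] \<and> V \<in> \<U> \<and> W \<in> \<U> \<and> V \<inter> W \<noteq> {})" for \<sigma>
      by (auto simp: ordered_simplices_def nerve_def length_Suc_conv)
    show ?thesis
    proof
      assume L: "\<forall>\<sigma>\<in>ordered_simplices (nerve \<U>) (Suc 0). cobd G z \<sigma> = \<one>"
      show ?C
      proof (intro ballI impI)
        fix V W assume VW: "V \<in> \<U>" "W \<in> \<U>" "V \<inter> W \<noteq> {}"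
        then have "[V, W] \<in> ordered_simplices (nerve \<U>) (Suc 0)"
          using 3[of "[V, W]"] by simp
        with L 2[OF VW] show "z [V] = z [W]" by blast
      qed
    next
      assume R: ?C
      show "\<forall>\<sigma>\<in>ordered_simplices (nerve \<U>) (Suc 0). cobd G z \<sigma> = \<one>"
      proof
        fix \<sigma> assume "\<sigma> \<in> ordered_simplices (nerve \<U>) (Suc 0)"
        from 3[THEN iffD1, OF this] obtain V W
          where \<sigma>: "\<sigma> = [V, W]" and VW: "V \<in> \<U>" "W \<in> \<U>" "V \<inter> W \<noteq> {}"
          by (elim exE conjE)
        have "z [V] = z [W]"
          using R[rule_format, OF VW] .
        with 2[OF VW] \<sigma> show "cobd G z \<sigma> = \<one>" by simp
      qed
    qed
  qed
  then show ?thesis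
    by (auto simp: mem_cocycles_iff carrier_cochain_group)
qed

context comm_group begin

lemma cocycle_0_value:
  assumes "z \<in> cocycles (nerve \<U>) G 0" "V \<in> \<U>" "x \<in> V"
  shows "z [V] \<in> carrier G"
proof -
  have "[V] \<in> ordered_simplices (nerve \<U>) 0"
    unfolding vertex_nerve using assms by blast
  then show ?thesis
    using assms(1) PiE_mem unfolding mem_cocycles_nerve_0 by metis
qed

lemma cocycle_0_eq:
  assumes "z \<in> cocycles (nerve \<U>) G 0" "V \<in> \<U>" "x \<in> V" "W \<in> \<U>" "x \<in> W"
  shows "z [V] = z [W]"
proof -
  have "V \<inter> W \<noteq> {}" using assms by blast
  then show ?thesis
    using assms(1,2,4) unfolding mem_cocycles_nerve_0 by simp
qed

lemma constant_cocycle: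
  "a \<in> carrier G \<Longrightarrow> (\<lambda>\<sigma>\<in>ordered_simplices (nerve \<U>) 0. a) \<in> cocycles (nerve \<U>) G 0"
  by (auto simp: mem_cocycles_nerve_0)

text \<open>
  The only coboundary in degree \<open>0\<close> is the unit, so a class has one representative.
\<close>

lemma cohomology_class_0:
  assumes "z \<in> cocycles (nerve \<U>) G 0"
  shows "cohomology_class (nerve \<U>) G 0 z = {z}"
proof -
  have "(\<lambda>\<sigma>\<in>ordered_simplices (nerve \<U>) 0. \<one> \<otimes> z \<sigma>) = z"
    using assms by (auto simp: mem_cocycles_nerve_0 PiE_iff extensional_def fun_eq_iff)
  then show ?thesis
    by (simp add: cohomology_class_def coboundaries_def cochain_group_def r_coset_def cong: restrict_cong)
qed

text \<open>
  A locally constant function has a value at \<open>x\<close>. Evaluations are how elements of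
  the direct limit are shown to be different.
\<close>

lemma cech_evaluation:
  assumes x: "x \<in> topspace X"
  obtains \<Phi> where "\<Phi> \<in> hom (cech_cohomology_group X G 0) G"
    "\<And>\<U> z V. \<U> \<in> open_covers X \<Longrightarrow> z \<in> cocycles (nerve \<U>) G 0 \<Longrightarrow> V \<in> \<U> \<Longrightarrow> x \<in> V \<Longrightarrow>
       \<Phi> (cech.cech_class G X 0 \<U> z) = z [V]"
proof -
  interpret cech G X 0 by unfold_locales
  define W where "W = (\<lambda>\<U>. SOME V. V \<in> \<U> \<and> x \<in> V)"
  have W: "W \<U> \<in> \<U>" "x \<in> W \<U>" if "\<U> \<in> open_covers X" for \<U>
  proof -
    have "\<exists>V. V \<in> \<U> \<and> x \<in> V" using that x by (auto simp: open_covers_def)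
    from someI_ex[OF this] show "W \<U> \<in> \<U>" "x \<in> W \<U>" by (auto simp: W_def)
  qed
  have val: "z [W \<U>] = z [V]" if "\<U> \<in> open_covers X" "z \<in> cocycles (nerve \<U>) G 0" "V \<in> \<U>" "x \<in> V" for \<U> z V
    using cocycle_0_eq[OF that(2) W[OF that(1)] that(3,4)] .
  define e where "e = (\<lambda>\<U> c. (the_elem c :: 'c set list \<Rightarrow> 'a) [W \<U>])"
  have e: "e \<U> (ncls \<U> z) = z [W \<U>]" if "z \<in> cocycles (nerve \<U>) G 0" for \<U> z
    by (simp add: e_def cohomology_class_0[OF that])
  have vert: "[V] \<in> ordered_simplices (nerve \<U>) 0" if "V \<in> \<U>" "x \<in> V" for V \<U>
    using that by auto
  show thesis
  proof (rule cech_universal)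
    show "comm_group G" by unfold_locales
    show "e \<U> \<in> hom (cohomology_group (nerve \<U>) G 0) G" if U: "\<U> \<in> open_covers X" for \<U>
    proof (rule homI)
      interpret simplicial_cohomology G "nerve \<U>" by (rule simplicial_cohomology_nerve)
      fix c d assume "c \<in> carrier (cohomology_group (nerve \<U>) G 0)" "d \<in> carrier (cohomology_group (nerve \<U>) G 0)"
      then obtain z w where z: "z \<in> cocycles (nerve \<U>) G 0" "c = ncls \<U> z"
        and w: "w \<in> cocycles (nerve \<U>) G 0" "d = ncls \<U> w"
        by (auto simp: carrier_cohomology_nerve)
      show "e \<U> c \<in> carrier G"
        using cocycle_0_value[OF z(1) W[OF U]] by (simp only: z(2) e[OF z(1)])
      have "c \<otimes>\<^bsub>cohomology_group (nerve \<U>) G 0\<^esub> d = ncls \<U> (z \<otimes>\<^bsub>cochain_group (nerve \<U>) G 0\<^esub> w)"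
        using hom_mult[OF cls_hom, of z 0 w] z w by simp
      moreover have "z \<otimes>\<^bsub>cochain_group (nerve \<U>) G 0\<^esub> w \<in> cocycles (nerve \<U>) G 0"
        using subgroup.m_closed[OF subgroup_cocycles] z w by blast
      ultimately show "e \<U> (c \<otimes>\<^bsub>cohomology_group (nerve \<U>) G 0\<^esub> d) = e \<U> c \<otimes> e \<U> d"
        using vert[OF W[OF U]] by (simp add: e z w) (simp add: cochain_group_def)
    qed
    fix \<U> \<V> \<pi> z
    assume UV: "\<U> \<in> open_covers X" "\<V> \<in> open_covers X" "refinement_projection \<V> \<U> \<pi>"
      and z: "z \<in> cocycles (nerve \<U>) G 0"
    have "pullback_cochain (nerve \<V>) 0 \<pi> z \<in> cocycles (nerve \<V>) G 0"
      using simplicial_map_cohomology.pullback_cocycle[OF simplicial_map_cohomology_nerve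
        [OF refinement_simplicial[OF UV(3)]] z] .
    moreover have "\<pi> (W \<V>) \<in> \<U>" "x \<in> \<pi> (W \<V>)"
      using UV(3) W[OF UV(2)] by (auto simp: refinement_projection_def)
    then have "z [W \<U>] = z [\<pi> (W \<V>)]"
      by (rule val[OF UV(1) z])
    ultimately show "e \<V> (ncls \<V> (pullback_cochain (nerve \<V>) 0 \<pi> z)) = e \<U> (ncls \<U> z)"
      using vert[OF W[OF UV(2)]] by (simp add: e z) (simp add: pullback_cochain_def)
  next
    fix \<Phi> assume "\<Phi> \<in> hom (cech_cohomology_group X G 0) G"
      "\<And>\<U> z. \<U> \<in> open_covers X \<Longrightarrow> z \<in> cocycles (nerve \<U>) G 0 \<Longrightarrow> \<Phi> (cech_class \<U> z) = e \<U> (ncls \<U> z)"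
    then show thesis
      using val by (intro that[of \<Phi>]) (auto simp: e)
  qed
qed

text \<open>
  The constants map onto \<open>H\<^sup>0\<close>, since a locally constant function on a connected space is constant, and
  evaluation at \<open>x\<close> is a left inverse.
\<close>

lemma cech_0_connected:
  assumes conn: "connected_space X" and x: "x \<in> topspace X"
  shows "cech_cohomology_group X G 0 \<cong> G"
proof -
  interpret cech G X 0 by unfold_locales
  interpret L: comm_group "cech_cohomology_group X G 0" by (rule comm_group_colim)
  obtain \<Phi> where \<Phi>: "\<Phi> \<in> hom (cech_cohomology_group X G 0) G"
    "\<And>\<U> z V. \<U> \<in> open_covers X \<Longrightarrow> z \<in> cocycles (nerve \<U>) G 0 \<Longrightarrow> V \<in> \<U> \<Longrightarrow> x \<in> V \<Longrightarrow>
       \<Phi> (cech_class \<U> z) = z [V]"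
    using cech_evaluation[OF x] by metis
  let ?U = "{topspace X}"
  let ?c = "\<lambda>\<U> a. \<lambda>\<sigma>\<in>ordered_simplices (nerve \<U>) 0. a"
  have U: "?U \<in> open_covers X"
    by (auto simp: open_covers_def)
  define \<kappa> where "\<kappa> = (\<lambda>a. cech_class ?U (?c ?U a))"
  have \<Phi>\<kappa>: "\<Phi> (\<kappa> a) = a" if "a \<in> carrier G" for a
    unfolding \<kappa>_def using \<Phi>(2)[OF U constant_cocycle[OF that], of "topspace X"] x
    by (metis vertex_nerve restrict_apply' empty_iff singletonI)
  have \<kappa>_hom: "\<kappa> \<in> hom G (cech_cohomology_group X G 0)"
  proof (rule homI)
    interpret simplicial_cohomology G "nerve ?U" by (rule simplicial_cohomology_nerve)
    fix a b assume ab: "a \<in> carrier G" "b \<in> carrier G"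
    show "\<kappa> a \<in> carrier (cech_cohomology_group X G 0)"
      unfolding \<kappa>_def by (rule cech_class_closed[OF U constant_cocycle[OF ab(1)]])
    have "?c ?U (a \<otimes> b) = ?c ?U a \<otimes>\<^bsub>cochain_group (nerve ?U) G 0\<^esub> ?c ?U b"
      by (auto simp: cochain_group_def intro!: restrict_ext)
    then have "ncls ?U (?c ?U (a \<otimes> b)) = ncls ?U (?c ?U a) \<otimes>\<^bsub>cohomology_group (nerve ?U) G 0\<^esub> ncls ?U (?c ?U b)"
      using hom_mult[OF cls_hom, of "?c ?U a" 0 "?c ?U b"]
        constant_cocycle[OF ab(1), of ?U] constant_cocycle[OF ab(2), of ?U] by simp
    then show "\<kappa> (a \<otimes> b) = \<kappa> a \<otimes>\<^bsub>cech_cohomology_group X G 0\<^esub> \<kappa> b"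
      unfolding \<kappa>_def cech_class_def
      using hom_mult[OF to_colim_hom[OF U], of "ncls ?U (?c ?U a)" "ncls ?U (?c ?U b)"]
        constant_cocycle[OF ab(1), of ?U] constant_cocycle[OF ab(2), of ?U]
      by (simp add: carrier_cohomology_nerve)
  qed
  have "cech_class \<U> z \<in> \<kappa> ` carrier G" if UU: "\<U> \<in> open_covers X" and z: "z \<in> cocycles (nerve \<U>) G 0" for \<U> z
  proof -
    obtain W where W: "W \<in> \<U>" "x \<in> W"
      using UU x by (auto simp: open_covers_def)
    let ?a = "z [W]"
    have zP: "z \<in> (\<Pi>\<^sub>E \<sigma>\<in>ordered_simplices (nerve \<U>) 0. carrier G)"
      using z unfolding mem_cocycles_nerve_0 by simp
    have a: "?a \<in> carrier G"
      by (rule cocycle_0_value[OF z W])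
    define P where "P = \<Union>{V \<in> \<U>. z [V] = ?a}"
    define N where "N = \<Union>{V \<in> \<U>. z [V] \<noteq> ?a}"
    have op: "openin X P" "openin X N"
      using UU unfolding P_def N_def open_covers_def by (auto intro!: openin_Union)
    have un: "topspace X \<subseteq> P \<union> N"
    proof
      fix y assume "y \<in> topspace X"
      then have "y \<in> \<Union>\<U>" using UU by (simp add: open_covers_def)
      then show "y \<in> P \<union> N" unfolding P_def N_def by blast
    qed
    have "P \<inter> N = {}"
    proof (rule equals0I)
      fix y assume "y \<in> P \<inter> N"
      then obtain V V' where "V \<in> \<U>" "z [V] = ?a" "y \<in> V" "V' \<in> \<U>" "z [V'] \<noteq> ?a" "y \<in> V'"
        unfolding P_def N_def by blast
      with cocycle_0_eq[OF z, of V y V'] show False by simp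
    qed
    moreover have "P \<noteq> {}"
      using W unfolding P_def by blast
    ultimately have "N = {}"
      using conn op un unfolding connected_space_def by metis
    then have V: "z [V] = ?a" if "V \<in> \<U>" "V \<noteq> {}" for V
      using that unfolding N_def by blast
    have "z \<sigma> = ?a" if \<sigma>: "\<sigma> \<in> ordered_simplices (nerve \<U>) 0" for \<sigma>
    proof -
      obtain V where "\<sigma> = [V]"
        using \<sigma> by (auto simp: ordered_simplices_def length_Suc_conv)
      moreover from this \<sigma> have "V \<in> \<U>" "V \<noteq> {}"
        by simp_all
      ultimately show ?thesis using V by blast
    qed
    then have zc: "z = ?c \<U> ?a"
      using zP by (intro ext) (auto simp: PiE_iff extensional_def)
    have r: "refinement_projection \<U> ?U (\<lambda>_. topspace X)"
      using UU by (auto simp: refinement_projection_def open_covers_def)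
    have "pullback_cochain (nerve \<U>) 0 (\<lambda>_. topspace X) (?c ?U ?a) = ?c \<U> ?a"
      using map_ordered_simplices[OF refinement_simplicial[OF r]]
      by (auto simp: pullback_cochain_def intro!: restrict_ext)
    then have "cech_class \<U> z = \<kappa> ?a"
      using cech_class_refine[OF U UU r constant_cocycle[OF a]] zc by (simp add: \<kappa>_def)
    with a show ?thesis by blast
  qed
  moreover have "subgroup (\<kappa> ` carrier G) (cech_cohomology_group X G 0)"
    using \<kappa>_hom by (intro group_hom.img_is_subgroup) (simp add: group_hom_def group_hom_axioms_def is_group L.is_group)
  ultimately have "carrier (cech_cohomology_group X G 0) = \<kappa> ` carrier G"
    by (rule cech_generated[rotated])
  moreover have "inj_on \<kappa> (carrier G)"
    using \<Phi>\<kappa> by (rule inj_on_inverseI)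
  ultimately have "\<kappa> \<in> iso G (cech_cohomology_group X G 0)"
    using \<kappa>_hom by (simp add: iso_def bij_betw_def)
  then show ?thesis
    using iso_sym is_isoI by blast
qed

text \<open>
  Evaluation at two points that are separated by clopen sets maps \<open>H\<^sup>0\<close> onto the square of the
  coefficient group.
\<close>

lemma cech_0_disconnected:
  assumes "\<not> connected_space X"
  shows "\<exists>f. f ` carrier (cech_cohomology_group X G 0) = carrier G \<times> carrier G"
proof -
  interpret cech G X 0 by unfold_locales
  obtain C D where CD: "openin X C" "openin X D" "C \<union> D = topspace X" "C \<inter> D = {}" "C \<noteq> {}" "D \<noteq> {}"
    using assms openin_subset unfolding connected_space_def by (metis Un_least subset_antisym)
  then obtain x y where xy: "x \<in> C" "y \<in> D"
    by blast
  obtain \<Phi> where \<Phi>: "\<Phi> \<in> hom (cech_cohomology_group X G 0) G"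
    "\<And>\<U> z V. \<U> \<in> open_covers X \<Longrightarrow> z \<in> cocycles (nerve \<U>) G 0 \<Longrightarrow> V \<in> \<U> \<Longrightarrow> x \<in> V \<Longrightarrow>
       \<Phi> (cech_class \<U> z) = z [V]"
    using cech_evaluation[of x X] xy CD by blast
  obtain \<Psi> where \<Psi>: "\<Psi> \<in> hom (cech_cohomology_group X G 0) G"
    "\<And>\<U> z V. \<U> \<in> open_covers X \<Longrightarrow> z \<in> cocycles (nerve \<U>) G 0 \<Longrightarrow> V \<in> \<U> \<Longrightarrow> y \<in> V \<Longrightarrow>
       \<Psi> (cech_class \<U> z) = z [V]"
    using cech_evaluation[of y X] xy CD by blast
  have U: "{C, D} \<in> open_covers X"
    using CD by (auto simp: open_covers_def)
  have "\<exists>c\<in>carrier (cech_cohomology_group X G 0). (\<Phi> c, \<Psi> c) = (a, b)"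
    if ab: "a \<in> carrier G" "b \<in> carrier G" for a b
  proof -
    define z where "z = (\<lambda>\<sigma>\<in>ordered_simplices (nerve {C, D}) 0. if \<sigma> = [C] then a else b)"
    have vert: "[C] \<in> ordered_simplices (nerve {C, D}) 0" "[D] \<in> ordered_simplices (nerve {C, D}) 0"
      using CD by auto
    have "z \<in> cocycles (nerve {C, D}) G 0"
      using CD ab by (auto simp: mem_cocycles_nerve_0 z_def)
    then have "cech_class {C, D} z \<in> carrier (cech_cohomology_group X G 0)"
      "\<Phi> (cech_class {C, D} z) = z [C]" "\<Psi> (cech_class {C, D} z) = z [D]"
      using cech_class_closed[OF U] \<Phi>(2)[OF U] \<Psi>(2)[OF U] xy by auto
    moreover have "C \<noteq> D" using CD by blast
    ultimately show ?thesis
      using vert by (auto simp: z_def)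
  qed
  moreover have "\<Phi> c \<in> carrier G" "\<Psi> c \<in> carrier G" if "c \<in> carrier (cech_cohomology_group X G 0)" for c
    using that \<Phi>(1) \<Psi>(1) hom_in_carrier by metis+
  ultimately have "(\<lambda>c. (\<Phi> c, \<Psi> c)) ` carrier (cech_cohomology_group X G 0) = carrier G \<times> carrier G"
    by (auto simp: image_iff)
  then show ?thesis by blast
qed

end

section \<open>Acyclic spaces\<close>

lemma trivial_groups_iso: "trivial_group G \<Longrightarrow> trivial_group H \<Longrightarrow> G \<cong> H"
  by (rule is_isoI[of "\<lambda>_. \<one>\<^bsub>H\<^esub>"])
    (auto simp: trivial_group_def iso_def hom_def bij_betw_def group.is_monoid monoid.l_one monoid.one_closed)

text \<open>
  By counting: \<open>H\<^sup>0\<close> has exactly \<open>p\<close> elements, but at least \<open>p\<^sup>2\<close> if the space is disconnected.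
\<close>

lemma mod_acyclic_imp_connected_space:
  assumes p: "prime p" and X: "mod_acyclic p X"
  shows "connected_space X"
proof (rule ccontr)
  let ?A = "integer_mod_group p"
  interpret A: comm_group ?A by simp
  have "cech_cohomology_group (discrete_topology {()}) ?A 0 \<cong> ?A"
    by (rule A.cech_0_connected[of _ "()"]) (auto simp: connected_space_discrete_topology)
  moreover have "cech_cohomology_group X ?A 0 \<cong> cech_cohomology_group (discrete_topology {()}) ?A 0"
    using X by (simp add: mod_acyclic_def)
  ultimately obtain h where h: "bij_betw h (carrier (cech_cohomology_group X ?A 0)) (carrier ?A)"
    using iso_trans unfolding is_iso_def iso_def by blast
  have p0: "p > 1" using p prime_gt_1_nat by blast
  have A: "card (carrier ?A) = p" "finite (carrier ?A)"
    using p0 by (simp_all add: carrier_integer_mod_group)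
  assume "\<not> connected_space X"
  then obtain f where "f ` carrier (cech_cohomology_group X ?A 0) = carrier ?A \<times> carrier ?A"
    using A.cech_0_disconnected by blast
  then have "card (carrier ?A \<times> carrier ?A) \<le> card (carrier (cech_cohomology_group X ?A 0))"
    using card_image_le[of "carrier (cech_cohomology_group X ?A 0)" f] h A bij_betw_finite by metis
  then have "p * p \<le> p"
    using A bij_betw_same_card[OF h] by (simp add: card_cartesian_product)
  with p0 show False by simp
qed

text \<open>
  The nerve of a cover of a point is a cone over any member that contains the point.
\<close>

lemma (in comm_group) cech_point_trivial:
  "trivial_group (cech_cohomology_group (discrete_topology {()}) G (Suc n))"
proof -
  interpret cech G "discrete_topology {()}" "Suc n" by unfold_locales
  show ?thesis
  proof (rule cech_trivialI)
    fix \<U> :: "unit set set" and z :: "unit set list \<Rightarrow> 'a"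
    assume U: "\<U> \<in> open_covers (discrete_topology {()})" and z: "z \<in> cocycles (nerve \<U>) G (Suc n)"
    have "() \<in> \<Union>\<U>"
      using U by (simp add: open_covers_def)
    then obtain V where V: "V \<in> \<U>" "() \<in> V" by blast
    have "insert V S \<in> nerve \<U>" if "S \<in> nerve \<U>" for S
      using that V by (auto simp: mem_nerve_iff)
    then have "z \<in> coboundaries (nerve \<U>) G (Suc n)"
      by (rule simplicial_cohomology.cone_cocycle_is_coboundary[OF simplicial_cohomology_nerve _ z])
    then have "pullback_cochain (nerve \<U>) (Suc n) (\<lambda>v. v) z \<in> coboundaries (nerve \<U>) G (Suc n)"
      using pullback_id[OF z] by simp
    moreover have "refinement_projection \<U> \<U> (\<lambda>v. v)"
      by (simp add: refinement_projection_def)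
    ultimately show "\<exists>\<V> \<pi>. \<V> \<in> open_covers (discrete_topology {()}) \<and> refinement_projection \<V> \<U> \<pi> \<and>
      pullback_cochain (nerve \<V>) (Suc n) \<pi> z \<in> coboundaries (nerve \<V>) G (Suc n)"
      using U by (intro exI conjI)
  qed
qed

lemma mod_acyclicI:
  assumes conn: "connected_space X" and x: "x \<in> topspace X"
    and null: "\<And>n \<U> z. \<U> \<in> open_covers X \<Longrightarrow> z \<in> cocycles (nerve \<U>) (integer_mod_group p) (Suc n) \<Longrightarrow>
      \<exists>\<V> \<pi>. \<V> \<in> open_covers X \<and> refinement_projection \<V> \<U> \<pi> \<and>
        pullback_cochain (nerve \<V>) (Suc n) \<pi> z \<in> coboundaries (nerve \<V>) (integer_mod_group p) (Suc n)"
  shows "mod_acyclic p X"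
  unfolding mod_acyclic_def
proof
  let ?A = "integer_mod_group p"
  interpret A: comm_group ?A by simp
  fix n
  show "cech_cohomology_group X ?A n \<cong> cech_cohomology_group (discrete_topology {()}) ?A n"
  proof (cases n)
    case 0
    have "cech_cohomology_group (discrete_topology {()}) ?A 0 \<cong> ?A"
      by (rule A.cech_0_connected[of _ "()"]) (auto simp: connected_space_discrete_topology)
    moreover have "group (cech_cohomology_group (discrete_topology {()}) ?A 0)"
    proof -
      interpret P: cech ?A "discrete_topology {()}" 0 by unfold_locales
      show ?thesis using P.comm_group_colim by (rule comm_group.axioms(2))
    qed
    ultimately show ?thesis
      unfolding 0 using A.cech_0_connected[OF conn x] group.iso_sym iso_trans by blast
  next
    case (Suc m)
    interpret X: cech ?A X "Suc m" by unfold_locales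
    have "trivial_group (cech_cohomology_group X ?A (Suc m))"
      by (rule X.cech_trivialI[OF null])
    then show ?thesis
      unfolding Suc by (rule trivial_groups_iso[OF _ A.cech_point_trivial])
  qed
qed

section \<open>Homeomorphism invariance\<close>

definition push_cover :: "('x \<Rightarrow> 'y) \<Rightarrow> 'x set set \<Rightarrow> 'y set set" where
  "push_cover f \<U> = (\<lambda>V. f ` V) ` \<U>"

lemma homeomorphic_maps_image_inverse:
  "homeomorphic_maps X Y f g \<Longrightarrow> V \<subseteq> topspace X \<Longrightarrow> g ` f ` V = V"
  unfolding homeomorphic_maps_def by (force simp: image_iff subset_iff)

lemma open_coversD: "\<U> \<in> open_covers X \<Longrightarrow> V \<in> \<U> \<Longrightarrow> V \<subseteq> topspace X"
  by (auto simp: open_covers_def)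

lemma push_cover_open_covers:
  assumes h: "homeomorphic_maps X Y f g" and U: "\<U> \<in> open_covers X"
  shows "push_cover f \<U> \<in> open_covers Y"
proof -
  have hm: "homeomorphic_map X Y f"
    using h homeomorphic_map_maps by blast
  have "openin Y (f ` V)" if "V \<in> \<U>" for V
    using homeomorphic_map_openness[OF hm open_coversD[OF U that]] U that by (simp add: open_covers_def)
  moreover have "\<Union>(push_cover f \<U>) = f ` \<Union>\<U>"
    by (auto simp: push_cover_def)
  moreover have "f ` \<Union>\<U> = topspace Y"
    using U homeomorphic_imp_surjective_map[OF hm] by (simp add: open_covers_def)
  ultimately show ?thesis
    by (auto simp: open_covers_def push_cover_def)
qed

lemma push_cover_inverse:
  assumes "homeomorphic_maps X Y f g" "\<U> \<in> open_covers X"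
  shows "push_cover g (push_cover f \<U>) = \<U>"
  using homeomorphic_maps_image_inverse[OF assms(1) open_coversD[OF assms(2)]]
  by (simp add: push_cover_def image_image)

lemma push_cover_simplicial:
  assumes h: "homeomorphic_maps X Y f g" and U: "\<U> \<in> open_covers X"
  shows "simplicial_vertex_map (nerve (push_cover f \<U>)) (nerve \<U>) ((`) g)"
  unfolding simplicial_vertex_map_def
proof
  fix S assume "S \<in> nerve (push_cover f \<U>)"
  then obtain y where S: "finite S" "S \<noteq> {}" "S \<subseteq> push_cover f \<U>" and y: "\<And>W. W \<in> S \<Longrightarrow> y \<in> W"
    by (auto simp: mem_nerve_iff)
  have "g ` W \<in> \<U>" if "W \<in> S" for W
    using that S(3) homeomorphic_maps_image_inverse[OF h open_coversD[OF U]] by (auto simp: push_cover_def)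
  moreover have "g y \<in> g ` W" if "W \<in> S" for W
    using y[OF that] by blast
  ultimately show "(`) g ` S \<in> nerve \<U>"
    using S(1,2) unfolding mem_nerve_iff by blast
qed

context comm_group begin

text \<open>
  The homomorphism in the direction of \<open>f\<close> pulls cochains back along the vertex map \<open>(`) g\<close> between
  nerves. A refinement projection \<open>\<pi>\<close> upstairs corresponds to the conjugate \<open>f \<circ> \<pi> \<circ> g\<close> on images.
\<close>

lemma cech_homeomorphic_hom:
  fixes X :: "'x topology" and Y :: "'y topology"
  assumes h: "homeomorphic_maps X Y f g"
  obtains \<Phi> where "\<Phi> \<in> hom (cech_cohomology_group X G n) (cech_cohomology_group Y G n)"
    "\<And>\<U> z. \<U> \<in> open_covers X \<Longrightarrow> z \<in> cocycles (nerve \<U>) G n \<Longrightarrow>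
       \<Phi> (cech.cech_class G X n \<U> z) =
         cech.cech_class G Y n (push_cover f \<U>) (pullback_cochain (nerve (push_cover f \<U>)) n ((`) g) z)"
proof -
  interpret X: cech G X n by unfold_locales
  interpret Y: cech G Y n by unfold_locales
  define e where "e = (\<lambda>\<U> c. Y.to_colim (push_cover f \<U>) (cohomology_map (nerve (push_cover f \<U>)) G n ((`) g) c))"
  have map: "simplicial_map_cohomology G (nerve (push_cover f \<U>)) (nerve \<U>) ((`) g)"
    if "\<U> \<in> open_covers X" for \<U>
    using push_cover_simplicial[OF h that]
    by (intro simplicial_map_cohomology.intro simplicial_cohomology.intro simplicial_cohomology_axioms.intro
        simplicial_map_cohomology_axioms.intro abstract_complex_nerve comm_group_axioms)
  have e: "e \<U> (X.ncls \<U> z) = Y.cech_class (push_cover f \<U>) (pullback_cochain (nerve (push_cover f \<U>)) n ((`) g) z)"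
    if "\<U> \<in> open_covers X" "z \<in> cocycles (nerve \<U>) G n" for \<U> z
    unfolding e_def Y.cech_class_def
    by (simp only: simplicial_map_cohomology.cohomology_map_class[OF map[OF that(1)] that(2)])
  show thesis
  proof (rule X.cech_universal[OF Y.comm_group_colim])
    fix \<U> assume U: "\<U> \<in> open_covers X"
    show "e \<U> \<in> hom (cohomology_group (nerve \<U>) G n) (cech_cohomology_group Y G n)"
      using Group.hom_compose[OF simplicial_map_cohomology.cohomology_map_hom[OF map[OF U]]
          Y.to_colim_hom[OF push_cover_open_covers[OF h U]]]
      by (simp add: e_def comp_def)
  next
    fix \<U> \<V> \<pi> z
    assume U: "\<U> \<in> open_covers X" and V: "\<V> \<in> open_covers X"
      and \<pi>: "refinement_projection \<V> \<U> \<pi>" and z: "z \<in> cocycles (nerve \<U>) G n"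
    let ?U = "push_cover f \<U>" and ?V = "push_cover f \<V>"
    let ?\<pi> = "\<lambda>W. f ` \<pi> (g ` W)"
    note gf = homeomorphic_maps_image_inverse[OF h open_coversD]
    have z': "pullback_cochain (nerve \<V>) n \<pi> z \<in> cocycles (nerve \<V>) G n"
      by (rule simplicial_map_cohomology.pullback_cocycle[OF X.simplicial_map_cohomology_nerve
        [OF refinement_simplicial[OF \<pi>]] z])
    have z'': "pullback_cochain (nerve ?U) n ((`) g) z \<in> cocycles (nerve ?U) G n"
      by (rule simplicial_map_cohomology.pullback_cocycle[OF map[OF U] z])
    have \<pi>': "refinement_projection ?V ?U ?\<pi>"
      unfolding refinement_projection_def
    proof
      fix W assume "W \<in> ?V"
      then obtain V where "V \<in> \<V>" "W = f ` V" by (auto simp: push_cover_def)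
      with \<pi> gf[OF V] show "?\<pi> W \<in> ?U \<and> W \<subseteq> ?\<pi> W"
        by (auto simp: push_cover_def refinement_projection_def)
    qed
    have "pullback_cochain (nerve ?V) n ((`) g) (pullback_cochain (nerve \<V>) n \<pi> z) =
        pullback_cochain (nerve ?V) n (\<pi> \<circ> (`) g) z"
      by (rule pullback_compose[OF push_cover_simplicial[OF h V]])
    also have "\<dots> = pullback_cochain (nerve ?V) n ((`) g \<circ> ?\<pi>) z"
    proof (rule pullback_cong[OF _ abstract_complex_nerve])
      fix W assume "{W} \<in> nerve ?V"
      then obtain V where W: "V \<in> \<V>" "W = f ` V" by (auto simp: push_cover_def mem_nerve_iff)
      then have "\<pi> V \<in> \<U>"
        using \<pi> by (simp add: refinement_projection_def)
      then have "g ` f ` \<pi> V = \<pi> V" "g ` W = V"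
        using gf[OF U] gf[OF V W(1)] W(2) by auto
      then show "(\<pi> \<circ> (`) g) W = ((`) g \<circ> ?\<pi>) W" by simp
    qed
    also have "\<dots> = pullback_cochain (nerve ?V) n ?\<pi> (pullback_cochain (nerve ?U) n ((`) g) z)"
      by (rule pullback_compose[OF refinement_simplicial[OF \<pi>'], symmetric])
    finally have "e \<V> (X.ncls \<V> (pullback_cochain (nerve \<V>) n \<pi> z)) =
        Y.cech_class ?V (pullback_cochain (nerve ?V) n ?\<pi> (pullback_cochain (nerve ?U) n ((`) g) z))"
      by (simp only: e[OF V z'])
    also have "\<dots> = Y.cech_class ?U (pullback_cochain (nerve ?U) n ((`) g) z)"
      by (rule Y.cech_class_refine[OF push_cover_open_covers[OF h U] push_cover_open_covers[OF h V] \<pi>' z''])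
    also have "\<dots> = e \<U> (X.ncls \<U> z)"
      by (simp only: e[OF U z])
    finally show "e \<V> (X.ncls \<V> (pullback_cochain (nerve \<V>) n \<pi> z)) = e \<U> (X.ncls \<U> z)" .
  next
    fix \<Phi> assume "\<Phi> \<in> hom (cech_cohomology_group X G n) (cech_cohomology_group Y G n)"
      "\<And>\<U> z. \<U> \<in> open_covers X \<Longrightarrow> z \<in> cocycles (nerve \<U>) G n \<Longrightarrow> \<Phi> (X.cech_class \<U> z) = e \<U> (X.ncls \<U> z)"
    then show thesis
      by (intro that[of \<Phi>]) (simp_all only: e)
  qed
qed

lemma cech_hom_inverse:
  fixes X :: "'x topology" and Y :: "'y topology"
  assumes h: "homeomorphic_maps X Y f g"
    and \<Phi>: "\<Phi> \<in> hom (cech_cohomology_group X G n) (cech_cohomology_group Y G n)"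
    "\<And>\<U> z. \<U> \<in> open_covers X \<Longrightarrow> z \<in> cocycles (nerve \<U>) G n \<Longrightarrow>
       \<Phi> (cech.cech_class G X n \<U> z) =
         cech.cech_class G Y n (push_cover f \<U>) (pullback_cochain (nerve (push_cover f \<U>)) n ((`) g) z)"
    and \<Psi>: "\<Psi> \<in> hom (cech_cohomology_group Y G n) (cech_cohomology_group X G n)"
    "\<And>\<U> z. \<U> \<in> open_covers Y \<Longrightarrow> z \<in> cocycles (nerve \<U>) G n \<Longrightarrow>
       \<Psi> (cech.cech_class G Y n \<U> z) =
         cech.cech_class G X n (push_cover g \<U>) (pullback_cochain (nerve (push_cover g \<U>)) n ((`) f) z)"
    and c: "c \<in> carrier (cech_cohomology_group X G n)"
  shows "\<Psi> (\<Phi> c) = c"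
proof -
  interpret X: cech G X n by unfold_locales
  interpret Y: cech G Y n by unfold_locales
  have g: "group (cech_cohomology_group X G n)"
    using X.comm_group_colim by (rule comm_group.axioms(2))
  have hom: "(\<lambda>c. \<Psi> (\<Phi> c)) \<in> hom (cech_cohomology_group X G n) (cech_cohomology_group X G n)"
    using Group.hom_compose[OF \<Phi>(1) \<Psi>(1)] by (simp add: comp_def)
  have id: "(\<lambda>c. c) \<in> hom (cech_cohomology_group X G n) (cech_cohomology_group X G n)"
    by (simp add: hom_def)
  show ?thesis
  proof (rule X.cech_hom_eqI[OF g hom id _ c])
    fix \<U> z assume U: "\<U> \<in> open_covers X" and z: "z \<in> cocycles (nerve \<U>) G n"
    let ?U = "push_cover f \<U>"
    have map: "simplicial_map_cohomology G (nerve ?U) (nerve \<U>) ((`) g)"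
      using push_cover_simplicial[OF h U]
      by (intro simplicial_map_cohomology.intro simplicial_cohomology.intro simplicial_cohomology_axioms.intro
          simplicial_map_cohomology_axioms.intro abstract_complex_nerve comm_group_axioms)
    have h': "homeomorphic_maps Y X g f"
      using h homeomorphic_maps_sym by blast
    note U' = push_cover_open_covers[OF h U]
    have simp: "simplicial_vertex_map (nerve \<U>) (nerve ?U) ((`) f)"
      using push_cover_simplicial[OF h' U'] unfolding push_cover_inverse[OF h U] .
    have "\<Psi> (\<Phi> (X.cech_class \<U> z)) =
        X.cech_class \<U> (pullback_cochain (nerve \<U>) n ((`) f) (pullback_cochain (nerve ?U) n ((`) g) z))"
      unfolding \<Phi>(2)[OF U z] \<Psi>(2)[OF U' simplicial_map_cohomology.pullback_cocycle[OF map z]]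
        push_cover_inverse[OF h U] ..
    also have "pullback_cochain (nerve \<U>) n ((`) f) (pullback_cochain (nerve ?U) n ((`) g) z) =
        pullback_cochain (nerve \<U>) n ((`) g \<circ> (`) f) z"
      by (rule pullback_compose[OF simp])
    also have "\<dots> = pullback_cochain (nerve \<U>) n (\<lambda>v. v) z"
    proof (rule pullback_cong[OF _ abstract_complex_nerve])
      fix V assume "{V} \<in> nerve \<U>"
      then have "V \<in> \<U>" by (simp add: mem_nerve_iff)
      then show "((`) g \<circ> (`) f) V = V"
        using homeomorphic_maps_image_inverse[OF h open_coversD[OF U]] by simp
    qed
    also have "\<dots> = z" by (rule pullback_id[OF z])
    finally show "\<Psi> (\<Phi> (X.cech_class \<U> z)) = X.cech_class \<U> z" .
  qed
qed

lemma cech_homeomorphic_iso: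
  assumes h: "homeomorphic_maps X Y f g"
  shows "cech_cohomology_group X G n \<cong> cech_cohomology_group Y G n"
proof -
  have h': "homeomorphic_maps Y X g f"
    using h homeomorphic_maps_sym by blast
  obtain \<Phi> where \<Phi>: "\<Phi> \<in> hom (cech_cohomology_group X G n) (cech_cohomology_group Y G n)"
    "\<And>\<U> z. \<U> \<in> open_covers X \<Longrightarrow> z \<in> cocycles (nerve \<U>) G n \<Longrightarrow>
       \<Phi> (cech.cech_class G X n \<U> z) =
         cech.cech_class G Y n (push_cover f \<U>) (pullback_cochain (nerve (push_cover f \<U>)) n ((`) g) z)"
    by (rule cech_homeomorphic_hom[OF h]) (rule that)
  obtain \<Psi> where \<Psi>: "\<Psi> \<in> hom (cech_cohomology_group Y G n) (cech_cohomology_group X G n)"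
    "\<And>\<U> z. \<U> \<in> open_covers Y \<Longrightarrow> z \<in> cocycles (nerve \<U>) G n \<Longrightarrow>
       \<Psi> (cech.cech_class G Y n \<U> z) =
         cech.cech_class G X n (push_cover g \<U>) (pullback_cochain (nerve (push_cover g \<U>)) n ((`) f) z)"
    by (rule cech_homeomorphic_hom[OF h']) (rule that)
  have "bij_betw \<Phi> (carrier (cech_cohomology_group X G n)) (carrier (cech_cohomology_group Y G n))"
  proof (rule bij_betw_byWitness[where f' = \<Psi>])
    show "\<forall>c\<in>carrier (cech_cohomology_group X G n). \<Psi> (\<Phi> c) = c"
      by (intro ballI cech_hom_inverse[OF h \<Phi> \<Psi>])
    show "\<forall>c\<in>carrier (cech_cohomology_group Y G n). \<Phi> (\<Psi> c) = c"
      by (intro ballI cech_hom_inverse[OF h' \<Psi> \<Phi>])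
    show "\<Phi> ` carrier (cech_cohomology_group X G n) \<subseteq> carrier (cech_cohomology_group Y G n)"
      using \<Phi>(1) by (rule hom_carrier)
    show "\<Psi> ` carrier (cech_cohomology_group Y G n) \<subseteq> carrier (cech_cohomology_group X G n)"
      using \<Psi>(1) by (rule hom_carrier)
  qed
  with \<Phi>(1) show ?thesis
    by (intro is_isoI[of \<Phi>]) (simp add: iso_def)
qed

end

lemma mod_acyclic_homeomorphic:
  assumes "homeomorphic_maps X Y f g" "mod_acyclic p X"
  shows "mod_acyclic p Y"
proof -
  interpret comm_group "integer_mod_group p" by simp
  have "cech_cohomology_group Y (integer_mod_group p) n \<cong> cech_cohomology_group X (integer_mod_group p) n" for n
    using cech_homeomorphic_iso homeomorphic_maps_sym assms(1) by blast
  then show ?thesis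
    using assms(2) iso_trans unfolding mod_acyclic_def by blast
qed

lemma covering_dim_le_homeomorphic:
  assumes h: "homeomorphic_maps X Y f g" and X: "covering_dim_le X n"
  shows "covering_dim_le Y n"
  unfolding covering_dim_le_def
proof
  fix \<U> assume U: "\<U> \<in> open_covers Y"
  have h': "homeomorphic_maps Y X g f"
    using h homeomorphic_maps_sym by blast
  from X[unfolded covering_dim_le_def, rule_format, OF push_cover_open_covers[OF h' U]]
  obtain \<V> where V: "\<V> \<in> open_covers X" "\<forall>V\<in>\<V>. \<exists>U\<in>push_cover g \<U>. V \<subseteq> U" "\<forall>S\<in>nerve \<V>. card S \<le> Suc n"
    by (elim bexE conjE)
  have 1: "\<exists>U\<in>\<U>. W \<subseteq> U" if W: "W \<in> push_cover f \<V>" for W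
  proof -
    obtain V where "V \<in> \<V>" "W = f ` V"
      using W by (auto simp: push_cover_def)
    moreover from this V(2) obtain U where "U \<in> \<U>" "V \<subseteq> g ` U"
      by (auto simp: push_cover_def)
    ultimately have "U \<in> \<U> \<and> W \<subseteq> U"
      using homeomorphic_maps_image_inverse[OF h' open_coversD[OF U], of U] image_mono[of V "g ` U" f] by simp
    then show ?thesis by blast
  qed
  have 2: "card S \<le> Suc n" if S: "S \<in> nerve (push_cover f \<V>)" for S
  proof -
    have "(`) g ` S \<in> nerve \<V>"
      using push_cover_simplicial[OF h V(1)] S by (simp add: simplicial_vertex_map_def)
    moreover have "inj_on ((`) g) S"
    proof (rule inj_on_inverseI[where g = "(`) f"])
      fix W assume "W \<in> S"
      then have "W \<subseteq> topspace Y"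
        using S open_coversD[OF push_cover_open_covers[OF h V(1)]] by (auto simp: mem_nerve_iff)
      then show "f ` g ` W = W"
        by (rule homeomorphic_maps_image_inverse[OF h'])
    qed
    ultimately show ?thesis
      using bspec[OF V(3), of "(`) g ` S"] card_image[of "(`) g" S] by simp
  qed
  show "\<exists>\<V>\<in>open_covers Y. (\<forall>V\<in>\<V>. \<exists>U\<in>\<U>. V \<subseteq> U) \<and> (\<forall>S\<in>nerve \<V>. card S \<le> Suc n)"
    by (rule bexI[OF _ push_cover_open_covers[OF h V(1)]], intro conjI ballI 1 2)
qed

lemma acyclic_spaces_homeomorphic:
  assumes h: "homeomorphic_maps X Y f g" and X: "X \<in> acyclic_spaces"
  shows "Y \<in> acyclic_spaces"
proof -
  have "Hausdorff_space Y"
    using X h homeomorphic_Hausdorff_space[of X Y] homeomorphic_space_def by (auto simp: acyclic_spaces_def)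
  then show ?thesis
    using X mod_acyclic_homeomorphic[OF h] covering_dim_le_homeomorphic[OF h]
    unfolding acyclic_spaces_def by blast
qed

section \<open>Transport of actions\<close>

text \<open>
  The action group \<open>BijGroup\<close> consists of extensional bijections; bijectivity follows from the action
  of inverses.
\<close>

lemma group_actionI:
  assumes Q: "group Q"
    and ext: "\<And>q. q \<in> carrier Q \<Longrightarrow> \<phi> q \<in> extensional E"
    and closed: "\<And>q x. q \<in> carrier Q \<Longrightarrow> x \<in> E \<Longrightarrow> \<phi> q x \<in> E"
    and mult: "\<And>q r x. q \<in> carrier Q \<Longrightarrow> r \<in> carrier Q \<Longrightarrow> x \<in> E \<Longrightarrow> \<phi> (q \<otimes>\<^bsub>Q\<^esub> r) x = \<phi> q (\<phi> r x)"
    and one: "\<And>x. x \<in> E \<Longrightarrow> \<phi> \<one>\<^bsub>Q\<^esub> x = x"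
  shows "group_action Q E \<phi>"
proof -
  interpret Q: group Q by (rule Q)
  have inv: "\<phi> (inv\<^bsub>Q\<^esub> q) (\<phi> q x) = x" "\<phi> q (\<phi> (inv\<^bsub>Q\<^esub> q) x) = x"
    if "q \<in> carrier Q" "x \<in> E" for q x
    using that mult[of "inv\<^bsub>Q\<^esub> q" q x] mult[of q "inv\<^bsub>Q\<^esub> q" x] one by simp_all
  have "bij_betw (\<phi> q) E E" if "q \<in> carrier Q" for q
    using inv[OF that] closed that
    by (intro bij_betw_byWitness[where f' = "\<phi> (inv\<^bsub>Q\<^esub> q)"]) auto
  then have Bij: "\<phi> q \<in> Bij E" if "q \<in> carrier Q" for q
    using that ext by (simp add: Bij_def)
  have "\<phi> \<in> hom Q (BijGroup E)"
  proof (rule homI)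
    fix q r assume qr: "q \<in> carrier Q" "r \<in> carrier Q"
    show "\<phi> q \<in> carrier (BijGroup E)"
      using Bij qr by (simp add: BijGroup_def)
    show "\<phi> (q \<otimes>\<^bsub>Q\<^esub> r) = \<phi> q \<otimes>\<^bsub>BijGroup E\<^esub> \<phi> r"
    proof
      fix x
      show "\<phi> (q \<otimes>\<^bsub>Q\<^esub> r) x = (\<phi> q \<otimes>\<^bsub>BijGroup E\<^esub> \<phi> r) x"
        using qr Bij mult ext[of "q \<otimes>\<^bsub>Q\<^esub> r"]
        by (cases "x \<in> E") (auto simp: BijGroup_def compose_def extensional_def)
    qed
  qed
  then show ?thesis
    by (simp add: group_action_def group_hom_def group_hom_axioms_def Q group_BijGroup)
qed

lemma topological_actionI:
  assumes Q: "group Q"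
    and ext: "\<And>q. q \<in> carrier Q \<Longrightarrow> \<phi> q \<in> extensional (topspace X)"
    and cont: "\<And>q. q \<in> carrier Q \<Longrightarrow> continuous_map X X (\<phi> q)"
    and mult: "\<And>q r x. q \<in> carrier Q \<Longrightarrow> r \<in> carrier Q \<Longrightarrow> x \<in> topspace X \<Longrightarrow>
      \<phi> (q \<otimes>\<^bsub>Q\<^esub> r) x = \<phi> q (\<phi> r x)"
    and one: "\<And>x. x \<in> topspace X \<Longrightarrow> \<phi> \<one>\<^bsub>Q\<^esub> x = x"
  shows "topological_action Q X \<phi>"
proof -
  interpret Q: group Q by (rule Q)
  have closed: "\<phi> q x \<in> topspace X" if "q \<in> carrier Q" "x \<in> topspace X" for q x
    using cont[OF that(1)] that(2) by (auto simp: continuous_map_def)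
  have "homeomorphic_map X X (\<phi> q)" if q: "q \<in> carrier Q" for q
  proof -
    have "\<phi> (inv\<^bsub>Q\<^esub> q) (\<phi> q x) = x" "\<phi> q (\<phi> (inv\<^bsub>Q\<^esub> q) x) = x" if "x \<in> topspace X" for x
      using q that mult[of "inv\<^bsub>Q\<^esub> q" q x] mult[of q "inv\<^bsub>Q\<^esub> q" x] one by simp_all
    then have "homeomorphic_maps X X (\<phi> q) (\<phi> (inv\<^bsub>Q\<^esub> q))"
      using cont q by (simp add: homeomorphic_maps_def)
    then show ?thesis
      using homeomorphic_map_maps by blast
  qed
  then show ?thesis
    using group_actionI[OF Q ext closed mult one] by (simp add: topological_action_def)
qed

lemma topological_actionD:
  assumes "topological_action Q X \<phi>"
  shows "group Q"
    and "\<And>q. q \<in> carrier Q \<Longrightarrow> continuous_map X X (\<phi> q)"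
    and "\<And>q x. q \<in> carrier Q \<Longrightarrow> x \<in> topspace X \<Longrightarrow> \<phi> q x \<in> topspace X"
    and "\<And>q r x. q \<in> carrier Q \<Longrightarrow> r \<in> carrier Q \<Longrightarrow> x \<in> topspace X \<Longrightarrow>
      \<phi> (q \<otimes>\<^bsub>Q\<^esub> r) x = \<phi> q (\<phi> r x)"
    and "\<And>x. x \<in> topspace X \<Longrightarrow> \<phi> \<one>\<^bsub>Q\<^esub> x = x"
proof -
  have act: "group_action Q (topspace X) \<phi>" and hm: "\<And>q. q \<in> carrier Q \<Longrightarrow> homeomorphic_map X X (\<phi> q)"
    using assms by (auto simp: topological_action_def)
  show "group Q"
    using group_action.group_hom[OF act] by (simp add: group_hom_def)
  show "continuous_map X X (\<phi> q)" if "q \<in> carrier Q" for q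
    using hm[OF that] homeomorphic_imp_continuous_map by blast
  then show "\<phi> q x \<in> topspace X" if "q \<in> carrier Q" "x \<in> topspace X" for q x
    using that by (auto simp: continuous_map_def)
  show "\<phi> (q \<otimes>\<^bsub>Q\<^esub> r) x = \<phi> q (\<phi> r x)" if "q \<in> carrier Q" "r \<in> carrier Q" "x \<in> topspace X" for q r x
    using group_action.composition_rule[OF act that(3,1,2)] .
  show "\<phi> \<one>\<^bsub>Q\<^esub> x = x" if "x \<in> topspace X" for x
    using group_action.id_eq_one[OF act] that by (metis restrict_apply')
qed

lemma transport_action:
  assumes h: "homeomorphic_maps X Y f g" and act: "topological_action Q X \<phi>"
  defines "\<psi> \<equiv> \<lambda>q. \<lambda>y\<in>topspace Y. f (\<phi> q (g y))"
  shows "topological_action Q Y \<psi>" "fixed_points Q Y \<psi> = f ` fixed_points Q X \<phi>"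
proof -
  note act = topological_actionD[OF act]
  have f: "continuous_map X Y f" and g: "continuous_map Y X g"
    and gf: "\<And>x. x \<in> topspace X \<Longrightarrow> g (f x) = x" and fg: "\<And>y. y \<in> topspace Y \<Longrightarrow> f (g y) = y"
    using h by (auto simp: homeomorphic_maps_def)
  have fX: "f x \<in> topspace Y" if "x \<in> topspace X" for x
    using f that by (auto simp: continuous_map_def)
  have gY: "g y \<in> topspace X" if "y \<in> topspace Y" for y
    using g that by (auto simp: continuous_map_def)
  show "topological_action Q Y \<psi>"
  proof (rule topological_actionI[OF act(1)])
    fix q assume q: "q \<in> carrier Q"
    show "\<psi> q \<in> extensional (topspace Y)"
      by (simp add: \<psi>_def)
    have "continuous_map Y Y (f \<circ> \<phi> q \<circ> g)"
      by (rule continuous_map_compose[OF g continuous_map_compose[OF act(2)[OF q] f]])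
    then show "continuous_map Y Y (\<psi> q)"
      by (rule continuous_map_eq) (simp add: \<psi>_def)
  next
    fix q r y assume "q \<in> carrier Q" "r \<in> carrier Q" "y \<in> topspace Y"
    then show "\<psi> (q \<otimes>\<^bsub>Q\<^esub> r) y = \<psi> q (\<psi> r y)"
      using act(3,4) gY gf fX by (simp add: \<psi>_def)
  next
    fix y assume "y \<in> topspace Y"
    then show "\<psi> \<one>\<^bsub>Q\<^esub> y = y"
      using act(5) gY fg by (simp add: \<psi>_def)
  qed
  show "fixed_points Q Y \<psi> = f ` fixed_points Q X \<phi>"
  proof (intro equalityI subsetI)
    fix y assume "y \<in> fixed_points Q Y \<psi>"
    then have y: "y \<in> topspace Y" "\<And>q. q \<in> carrier Q \<Longrightarrow> f (\<phi> q (g y)) = y"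
      by (auto simp: fixed_points_def \<psi>_def)
    have "\<phi> q (g y) = g y" if "q \<in> carrier Q" for q
      using gf[OF act(3)[OF that gY[OF y(1)]]] y(2)[OF that] by simp
    then have "g y \<in> fixed_points Q X \<phi>"
      using gY[OF y(1)] by (simp add: fixed_points_def)
    then show "y \<in> f ` fixed_points Q X \<phi>"
      using fg[OF y(1)] by force
  next
    fix y assume "y \<in> f ` fixed_points Q X \<phi>"
    then show "y \<in> fixed_points Q Y \<psi>"
      using fX gf by (auto simp: fixed_points_def \<psi>_def)
  qed
qed

text \<open>
  An injection of the points into another type carries the topology along.
\<close>

lemma homeomorphic_copy:
  fixes h :: "'x \<Rightarrow> 'u"
  assumes "inj_on h (topspace X)"
  obtains Y :: "'u topology" and g where "homeomorphic_maps X Y h g"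
proof
  let ?g = "inv_into (topspace X) h"
  let ?Y = "pullback_topology (h ` topspace X) ?g X"
  have gh: "?g (h x) = x" if "x \<in> topspace X" for x
    using assms that by simp
  have "topspace ?Y = h ` topspace X"
    using gh by (auto simp: topspace_pullback_topology)
  moreover have "continuous_map ?Y X ?g"
    using continuous_map_pullback[OF continuous_map_id, of "h ` topspace X" ?g X] by simp
  moreover have "continuous_map X ?Y h"
  proof (rule continuous_map_pullback')
    show "continuous_map X X (?g \<circ> h)"
      by (rule continuous_map_eq[OF continuous_map_id]) (simp add: gh)
  qed auto
  ultimately show "homeomorphic_maps X ?Y h ?g"
    using gh by (auto simp: homeomorphic_maps_def)
qed

lemma transport_fixed_point:
  fixes h :: "'x \<Rightarrow> 'u"
  assumes a: "\<forall>(X :: 'u topology) \<phi>. X \<in> acyclic_spaces \<and> topological_action Q X \<phi> \<longrightarrow>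
              (\<exists>x \<in> topspace X. \<forall>g \<in> carrier Q. \<phi> g x = x)"
    and h: "inj_on h (topspace X)" and X: "X \<in> acyclic_spaces" and act: "topological_action Q X \<phi>"
  shows "fixed_points Q X \<phi> \<noteq> {}"
proof -
  obtain Y :: "'u topology" and g where hm: "homeomorphic_maps X Y h g"
    by (rule homeomorphic_copy[OF h])
  have "fixed_points Q Y (\<lambda>q. \<lambda>y\<in>topspace Y. h (\<phi> q (g y))) \<noteq> {}"
    using a[rule_format, OF conjI, OF acyclic_spaces_homeomorphic[OF hm X] transport_action(1)[OF hm act]]
    by (auto simp: fixed_points_def)
  then show ?thesis
    unfolding transport_action(2)[OF hm act] by simp
qed

lemma transport_acyclic_fixed_points:
  fixes h :: "'x \<Rightarrow> 'u"
  assumes b: "\<forall>p (X :: 'u topology) \<phi>.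
              prime p \<and> X \<in> acyclic_spaces \<and> mod_acyclic p X \<and> topological_action Q X \<phi> \<longrightarrow>
              mod_acyclic p (subtopology X (fixed_points Q X \<phi>))"
    and h: "inj_on h (topspace X)" and X: "X \<in> acyclic_spaces" and act: "topological_action Q X \<phi>"
    and p: "prime p" "mod_acyclic p X"
  shows "mod_acyclic p (subtopology X (fixed_points Q X \<phi>))"
proof -
  obtain Y :: "'u topology" and g where hm: "homeomorphic_maps X Y h g"
    by (rule homeomorphic_copy[OF h])
  let ?\<psi> = "\<lambda>q. \<lambda>y\<in>topspace Y. h (\<phi> q (g y))"
  have "mod_acyclic p (subtopology Y (fixed_points Q Y ?\<psi>))"
    by (rule b[rule_format], intro conjI p(1) acyclic_spaces_homeomorphic[OF hm X]
        mod_acyclic_homeomorphic[OF hm p(2)] transport_action(1)[OF hm act])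
  moreover have "homeomorphic_maps (subtopology X (fixed_points Q X \<phi>)) (subtopology Y (fixed_points Q Y ?\<psi>)) h g"
  proof (rule homeomorphic_maps_subtopologies[OF hm])
    have "topspace X \<inter> fixed_points Q X \<phi> = fixed_points Q X \<phi>"
      "topspace Y \<inter> fixed_points Q Y ?\<psi> = fixed_points Q Y ?\<psi>"
      by (auto simp: fixed_points_def)
    then show "h ` (topspace X \<inter> fixed_points Q X \<phi>) = topspace Y \<inter> fixed_points Q Y ?\<psi>"
      using transport_action(2)[OF hm act] by simp
  qed
  ultimately show ?thesis
    using mod_acyclic_homeomorphic homeomorphic_maps_sym by blast
qed

text \<open>
  A point of a second countable \<open>T\<^sub>1\<close> space is determined by the basic open sets that contain it, and
  there are continuum many sets of natural numbers.
\<close>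

lemma second_countable_inj_real:
  "\<exists>f :: 'a :: {second_countable_topology, t1_space} \<Rightarrow> real. inj f"
proof -
  obtain B :: "'a set set" where B: "countable B" "topological_basis B"
    using ex_countable_basis by blast
  let ?c = "\<lambda>x. {n. x \<in> from_nat_into B n}"
  have "B \<noteq> {}"
    using B(2) topological_basisE[OF B(2) open_UNIV UNIV_I] by blast
  have "inj ?c"
  proof (rule injI, rule ccontr)
    fix x y :: 'a assume eq: "?c x = ?c y" and "x \<noteq> y"
    then obtain U where "open U" "x \<in> U" "y \<notin> U"
      using t1_space by blast
    then obtain V where V: "V \<in> B" "x \<in> V" "y \<notin> V"
      using topological_basisE[OF B(2)] by (metis subsetD)
    then obtain n where "from_nat_into B n = V"
      using from_nat_into_surj[OF B(1)] by blast
    with V eq show False by blast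
  qed
  moreover obtain k :: "nat set \<Rightarrow> real" where "inj k"
    using nat_sets_eqpoll_reals by (auto simp: eqpoll_def bij_betw_def)
  ultimately have "inj (k \<circ> ?c)"
    by (rule inj_compose[rotated])
  then show ?thesis by blast
qed

section \<open>Locally finite complexes\<close>

definition complex_vertices :: "'v set set \<Rightarrow> 'v set" where
  "complex_vertices K = {v. {v} \<in> K}"

primrec simplex_ball :: "'v set set \<Rightarrow> 'v set \<Rightarrow> nat \<Rightarrow> 'v set" where
  "simplex_ball K s 0 = s"
| "simplex_ball K s (Suc n) = simplex_ball K s n \<union> {v. \<exists>u\<in>simplex_ball K s n. {u, v} \<in> K}"

lemma abstract_complex_subset:
  "abstract_complex K \<Longrightarrow> \<sigma> \<in> K \<Longrightarrow> t \<subseteq> \<sigma> \<Longrightarrow> t \<noteq> {} \<Longrightarrow> t \<in> K"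
  unfolding abstract_complex_def by blast

lemma abstract_complex_finite: "abstract_complex K \<Longrightarrow> \<sigma> \<in> K \<Longrightarrow> finite \<sigma>"
  and abstract_complex_nonempty: "abstract_complex K \<Longrightarrow> \<sigma> \<in> K \<Longrightarrow> \<sigma> \<noteq> {}"
  unfolding abstract_complex_def by blast+

lemma finite_simplex_ball:
  assumes K: "abstract_complex K" "locally_finite_complex K" and s: "s \<in> K"
  shows "finite (simplex_ball K s n)"
proof (induction n)
  case 0
  then show ?case using abstract_complex_finite[OF K(1) s] by simp
next
  case (Suc n)
  have "finite (\<Union>{\<sigma> \<in> K. u \<in> \<sigma>})" for u
    using K(2) abstract_complex_finite[OF K(1)] by (intro finite_Union) (auto simp: locally_finite_complex_def)
  then have "finite (\<Union>u\<in>simplex_ball K s n. \<Union>{\<sigma> \<in> K. u \<in> \<sigma>})"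
    using Suc by blast
  moreover have "{v. \<exists>u\<in>simplex_ball K s n. {u, v} \<in> K} \<subseteq> (\<Union>u\<in>simplex_ball K s n. \<Union>{\<sigma> \<in> K. u \<in> \<sigma>})"
    by blast
  ultimately have "finite {v. \<exists>u\<in>simplex_ball K s n. {u, v} \<in> K}"
    using finite_subset by blast
  then show ?case
    using Suc by simp
qed

text \<open>
  The points carried by vertices that edge paths connect to \<open>s\<close>, and the points carried by the other
  vertices, form two disjoint sets that are open in the weak topology: each closed simplex lies in one
  of them.
\<close>

lemma vertices_subset_simplex_balls:
  assumes K: "abstract_complex K" and conn: "connected_space (realization K)" and s: "s \<in> K"
  shows "complex_vertices K \<subseteq> (\<Union>n. simplex_ball K s n)"
proof -
  define C where "C = (\<Union>n. simplex_ball K s n)"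
  \<comment> \<open>\<open>U\<close> and \<open>W\<close> are the two clopen parts; \<open>W\<close> will turn out to be empty.\<close>
  define U where "U = {t \<in> realization_points K. {v. t v \<noteq> 0} \<subseteq> C}"
  define W where "W = {t \<in> realization_points K. {v. t v \<noteq> 0} \<inter> C = {}}"
  \<comment> \<open>A simplex with one vertex in \<open>C\<close> has all its vertices in \<open>C\<close>.\<close>
  have dich: "\<sigma> \<subseteq> C \<or> \<sigma> \<inter> C = {}" if "\<sigma> \<in> K" for \<sigma>
  proof -
    have "v \<in> C" if u: "u \<in> \<sigma>" "u \<in> C" and v: "v \<in> \<sigma>" for u v
    proof -
      have "{u, v} \<in> K"
        using u(1) v by (intro abstract_complex_subset[OF K \<open>\<sigma> \<in> K\<close>]) auto
      moreover obtain n where "u \<in> simplex_ball K s n"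
        using u(2) unfolding C_def by blast
      ultimately have "v \<in> simplex_ball K s (Suc n)"
        by auto
      then show ?thesis unfolding C_def by blast
    qed
    then show ?thesis by blast
  qed
  have supp: "{v. t v \<noteq> 0} \<in> K" "{v. t v \<noteq> 0} \<noteq> {}" if "t \<in> realization_points K" for t
  proof -
    show "{v. t v \<noteq> 0} \<in> K"
      using that by (simp add: realization_points_def)
    then show "{v. t v \<noteq> 0} \<noteq> {}"
      by (rule abstract_complex_nonempty[OF K])
  qed
  have open1: "openin (realization K) U"
    unfolding openin_realization
  proof (intro conjI ballI)
    fix \<sigma> assume \<sigma>: "\<sigma> \<in> K"
    show "openin (top_of_set (closed_simplex K \<sigma>)) (U \<inter> closed_simplex K \<sigma>)"
    proof (cases "\<sigma> \<subseteq> C")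
      case True
      then have "U \<inter> closed_simplex K \<sigma> = closed_simplex K \<sigma>"
        by (auto simp: U_def closed_simplex_def)
      then show ?thesis by simp
    next
      case False
      then have "\<sigma> \<inter> C = {}" using dich[OF \<sigma>] by blast
      then have "U \<inter> closed_simplex K \<sigma> = {}"
        using supp(2) unfolding U_def closed_simplex_def by blast
      then show ?thesis by simp
    qed
  qed (simp add: U_def)
  have open2: "openin (realization K) W"
    unfolding openin_realization
  proof (intro conjI ballI)
    fix \<sigma> assume \<sigma>: "\<sigma> \<in> K"
    show "openin (top_of_set (closed_simplex K \<sigma>)) (W \<inter> closed_simplex K \<sigma>)"
    proof (cases "\<sigma> \<subseteq> C")
      case True
      then have "W \<inter> closed_simplex K \<sigma> = {}"
        using supp(2) unfolding W_def closed_simplex_def by blast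
      then show ?thesis by simp
    next
      case False
      then have "\<sigma> \<inter> C = {}" using dich[OF \<sigma>] by blast
      then have "W \<inter> closed_simplex K \<sigma> = closed_simplex K \<sigma>"
        unfolding W_def closed_simplex_def by blast
      then show ?thesis by simp
    qed
  qed (simp add: W_def)
  have vertex: "(\<lambda>w. if w = v then 1 else 0) \<in> realization_points K" if "{v} \<in> K" for v
    using that by (simp add: realization_points_def)
  have "U \<inter> W = {}"
    using supp(2) unfolding U_def W_def by blast
  moreover have "topspace (realization K) \<subseteq> U \<union> W"
    unfolding topspace_realization U_def W_def using supp(1) dich by blast
  moreover have "U \<noteq> {}"
  proof -
    obtain v where "v \<in> s"
      using abstract_complex_nonempty[OF K s] by blast
    then have v: "v \<in> s" "{v} \<in> K"
      by (auto intro: abstract_complex_subset[OF K s])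
    then have "v \<in> simplex_ball K s 0" by simp
    then have "v \<in> C"
      unfolding C_def by blast
    then have "(\<lambda>w. if w = v then 1 else 0) \<in> U"
      using vertex[OF v(2)] by (auto simp: U_def)
    then show ?thesis by blast
  qed
  ultimately have "W = {}"
    using conn open1 open2 unfolding connected_space_def by metis
  have "complex_vertices K \<subseteq> C"
  proof
    fix v assume "v \<in> complex_vertices K"
    then have v: "{v} \<in> K" by (simp add: complex_vertices_def)
    have "(\<lambda>w. if w = v then 1 else 0) \<notin> W"
      using \<open>W = {}\<close> by blast
    then show "v \<in> C"
      using vertex[OF v] by (auto simp: W_def split: if_splits)
  qed
  then show ?thesis unfolding C_def .
qed

lemma countable_vertices:
  assumes "abstract_complex K" "locally_finite_complex K" "connected_space (realization K)"
  shows "countable (complex_vertices K)"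
proof (cases "K = {}")
  case False
  then obtain s where s: "s \<in> K" by blast
  have "countable (\<Union>n. simplex_ball K s n)"
    using finite_simplex_ball[OF assms(1,2) s] by (intro countable_UN) (auto intro: countable_finite)
  then show ?thesis
    using vertices_subset_simplex_balls[OF assms(1,3) s] countable_subset by blast
qed (simp add: complex_vertices_def)

text \<open>
  A point of the realization vanishes outside the countable set of vertices, so it is a real sequence.
\<close>

lemma realization_inj_real:
  assumes K: "abstract_complex K" "locally_finite_complex K" "connected_space (realization K)"
  obtains h :: "('v \<Rightarrow> real) \<Rightarrow> real" where "inj_on h (realization_points (K :: 'v set set))"
proof -
  obtain k :: "(nat \<Rightarrow> real) \<Rightarrow> real" where k: "inj k"
    using second_countable_inj_real[where 'a = "nat \<Rightarrow> real"] by (elim exE)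
  let ?V = "complex_vertices K"
  have "inj_on (\<lambda>t. k (\<lambda>n. t (from_nat_into ?V n))) (realization_points K)"
  proof (rule inj_onI)
    fix t u assume t: "t \<in> realization_points K" and u: "u \<in> realization_points K"
      and "k (\<lambda>n. t (from_nat_into ?V n)) = k (\<lambda>n. u (from_nat_into ?V n))"
    then have "(\<lambda>n. t (from_nat_into ?V n)) = (\<lambda>n. u (from_nat_into ?V n))"
      using k by (simp only: inj_eq)
    note eq = fun_cong[OF this]
    have zero: "x v = 0" if "v \<notin> ?V" "x \<in> realization_points K" for v x
    proof (rule ccontr)
      assume "x v \<noteq> 0"
      have "{v. x v \<noteq> 0} \<in> K"
        using that(2) unfolding realization_points_def by (elim CollectE conjE)
      then have "{v} \<in> K"
        by (rule abstract_complex_subset[OF K(1)]) (simp_all add: \<open>x v \<noteq> 0\<close>)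
      with that(1) show False by (simp add: complex_vertices_def)
    qed
    show "t = u"
    proof
      fix v
      show "t v = u v"
      proof (cases "v \<in> ?V")
        case True
        then obtain n where "from_nat_into ?V n = v"
          using from_nat_into_surj[OF countable_vertices[OF K]] by blast
        then show ?thesis
          using eq[of n] by simp
      next
        case False
        then show ?thesis
          using zero[OF False t] zero[OF False u] by simp
      qed
    qed
  qed
  then show thesis by (rule that)
qed

definition vertex_point :: "'v \<Rightarrow> 'v \<Rightarrow> real" where
  "vertex_point v = (\<lambda>w. if w = v then 1 else 0)"

lemma vertex_point_eq_iff: "vertex_point v = vertex_point w \<longleftrightarrow> v = w"
  unfolding vertex_point_def by (metis zero_neq_one)

lemma vertex_point_mem: "{v} \<in> K \<Longrightarrow> vertex_point v \<in> realization_points K"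
  by (simp add: realization_points_def vertex_point_def)

lemma realization_map_vertex_point: "realization_map f (vertex_point v) = vertex_point (f v)"
proof
  fix w
  have "{u. vertex_point v u \<noteq> 0 \<and> f u = w} = (if f v = w then {v} else {})"
    by (auto simp: vertex_point_def)
  then show "realization_map f (vertex_point v) w = vertex_point (f v) w"
    by (auto simp: realization_map_def vertex_point_def)
qed

lemma realization_map_id:
  assumes "\<And>v. t v \<noteq> 0 \<Longrightarrow> f v = v"
  shows "realization_map f t = t"
proof
  fix w
  have "{v. t v \<noteq> 0 \<and> f v = w} = (if t w \<noteq> 0 then {w} else {})"
    using assms by auto
  then show "realization_map f t w = t w"
    by (auto simp: realization_map_def)
qed

text \<open>
  The support of the image is contained in the image of the support. If the point is fixed, the two
  finite sets have to agree.
\<close>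

lemma realization_map_fixed_support:
  assumes "realization_map f t = t" "finite {v. t v \<noteq> 0}"
  shows "f ` {v. t v \<noteq> 0} = {v. t v \<noteq> 0}"
proof -
  have "w \<in> f ` {v. t v \<noteq> 0}" if "t w \<noteq> 0" for w
  proof (rule ccontr)
    assume "w \<notin> f ` {v. t v \<noteq> 0}"
    then have "{v. t v \<noteq> 0 \<and> f v = w} = {}" by blast
    then have "realization_map f t w = 0"
      unfolding realization_map_def by (simp only: sum.empty)
    with that assms(1) show False by simp
  qed
  then have "{v. t v \<noteq> 0} \<subseteq> f ` {v. t v \<noteq> 0}" by blast
  then show ?thesis
    using assms(2) card_image_le[of "{v. t v \<noteq> 0}" f] card_seteq[of "f ` {v. t v \<noteq> 0}" "{v. t v \<noteq> 0}"]
    by simp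
qed

text \<open>
  The vertex maps of the action preserve the simplex that carries a fixed point, hence all balls around
  it. Some vertex is moved, because an action that fixes all vertices is trivial, and it lies in one of
  the balls.
\<close>

lemma simplicial_action_finite_orbit:
  fixes K :: "'v set set"
  assumes K: "abstract_complex K" "locally_finite_complex K"
    and conn: "connected_space (realization K)"
    and act: "simplicial_action Q K \<phi>"
    and fix_pt: "fixed_points Q (realization K) \<phi> \<noteq> {}"
    and nontriv: "nontrivial_action Q (realization K) \<phi>"
  obtains B :: "'v set" and f where "finite B"
    "\<And>q v. q \<in> carrier Q \<Longrightarrow> v \<in> B \<Longrightarrow> f q v \<in> B"
    "\<And>q r v. q \<in> carrier Q \<Longrightarrow> r \<in> carrier Q \<Longrightarrow> v \<in> B \<Longrightarrow> f (q \<otimes>\<^bsub>Q\<^esub> r) v = f q (f r v)"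
    "\<And>v. v \<in> B \<Longrightarrow> f \<one>\<^bsub>Q\<^esub> v = v"
    "\<exists>q\<in>carrier Q. \<exists>v\<in>B. f q v \<noteq> v"
proof -
  have top: "topological_action Q (realization K) \<phi>"
    using act by (simp add: simplicial_action_def)
  note top = topological_actionD[OF top, unfolded topspace_realization]
  define f where "f = (\<lambda>q. SOME f. simplicial_vertex_map K K f \<and>
        (\<forall>t\<in>realization_points K. \<phi> q t = realization_map f t))"
  have f: "simplicial_vertex_map K K (f q)" "\<And>t. t \<in> realization_points K \<Longrightarrow> \<phi> q t = realization_map (f q) t"
    if "q \<in> carrier Q" for q
  proof -
    have "\<exists>f. simplicial_vertex_map K K f \<and> (\<forall>t\<in>realization_points K. \<phi> q t = realization_map f t)"
      using act that unfolding simplicial_action_def topspace_realization by blast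
    from someI_ex[OF this] show "simplicial_vertex_map K K (f q)"
      "\<And>t. t \<in> realization_points K \<Longrightarrow> \<phi> q t = realization_map (f q) t"
      unfolding f_def by blast+
  qed
  have simp: "f q ` \<sigma> \<in> K" if "q \<in> carrier Q" "\<sigma> \<in> K" for q \<sigma>
    using f(1)[OF that(1)] that(2) by (simp add: simplicial_vertex_map_def)
  have \<phi>v: "\<phi> q (vertex_point v) = vertex_point (f q v)" if "q \<in> carrier Q" "{v} \<in> K" for q v
    using f(2)[OF that(1) vertex_point_mem[OF that(2)]] by (simp add: realization_map_vertex_point)
  have fv: "{f q v} \<in> K" if "q \<in> carrier Q" "{v} \<in> K" for q v
    using simp[OF that] by simp
  have mult: "f (q \<otimes>\<^bsub>Q\<^esub> r) v = f q (f r v)"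
    if q: "q \<in> carrier Q" and r: "r \<in> carrier Q" and v: "{v} \<in> K" for q r v
  proof -
    have "q \<otimes>\<^bsub>Q\<^esub> r \<in> carrier Q"
      using top(1) q r by (simp add: group.is_monoid monoid.m_closed)
    then have "vertex_point (f (q \<otimes>\<^bsub>Q\<^esub> r) v) = vertex_point (f q (f r v))"
      using top(4)[OF q r vertex_point_mem[OF v]] \<phi>v q r v fv by metis
    then show ?thesis by (simp add: vertex_point_eq_iff)
  qed
  have one: "f \<one>\<^bsub>Q\<^esub> v = v" if v: "{v} \<in> K" for v
  proof -
    have "\<one>\<^bsub>Q\<^esub> \<in> carrier Q"
      using top(1) by (simp add: group.is_monoid monoid.one_closed)
    then have "vertex_point (f \<one>\<^bsub>Q\<^esub> v) = vertex_point v"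
      using top(5)[OF vertex_point_mem[OF v]] \<phi>v v by metis
    then show ?thesis by (simp add: vertex_point_eq_iff)
  qed
  obtain t where t: "t \<in> realization_points K" "\<And>q. q \<in> carrier Q \<Longrightarrow> \<phi> q t = t"
    using fix_pt unfolding fixed_points_def topspace_realization by blast
  define s where "s = {v. t v \<noteq> 0}"
  have s: "s \<in> K"
    using t(1) by (simp add: realization_points_def s_def)
  have fs: "f q ` s = s" if "q \<in> carrier Q" for q
    unfolding s_def
    by (rule realization_map_fixed_support)
       (use f(2)[OF that t(1)] t(2)[OF that] abstract_complex_finite[OF K(1) s] in \<open>simp_all add: s_def\<close>)
  have inv: "f q v \<in> simplex_ball K s n" if q: "q \<in> carrier Q" and "v \<in> simplex_ball K s n" for q v n
    using that(2)
  proof (induction n arbitrary: v)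
    case 0
    then show ?case using fs[OF q] by auto
  next
    case (Suc n)
    show ?case
    proof (cases "v \<in> simplex_ball K s n")
      case True
      then show ?thesis using Suc.IH by simp
    next
      case False
      then obtain u where u: "u \<in> simplex_ball K s n" "{u, v} \<in> K"
        using Suc.prems by auto
      have "{f q u, f q v} \<in> K"
        using simp[OF q u(2)] by simp
      with Suc.IH[OF u(1)] show ?thesis by auto
    qed
  qed
  have vert: "{v} \<in> K" if "v \<in> simplex_ball K s n" for v n
    using that
  proof (induction n)
    case 0
    then show ?case using abstract_complex_subset[OF K(1) s, of "{v}"] by simp
  next
    case (Suc n)
    then show ?case using abstract_complex_subset[OF K(1), of "{_, v}" "{v}"] by auto
  qed
  obtain q x where q: "q \<in> carrier Q" and x: "x \<in> realization_points K" "\<phi> q x \<noteq> x"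
    using nontriv unfolding nontrivial_action_def topspace_realization by blast
  then obtain v where v: "x v \<noteq> 0" "f q v \<noteq> v"
    using realization_map_id[of x "f q"] f(2)[OF q x(1)] by auto
  have "{v. x v \<noteq> 0} \<in> K"
    using x(1) unfolding realization_points_def by (elim CollectE conjE)
  then have "{v} \<in> K"
    by (rule abstract_complex_subset[OF K(1)]) (simp_all add: v)
  then obtain n where n: "v \<in> simplex_ball K s n"
    using vertices_subset_simplex_balls[OF K(1) conn s] by (auto simp: complex_vertices_def)
  show thesis
  proof (rule that[of "simplex_ball K s n" f])
    show "finite (simplex_ball K s n)"
      by (rule finite_simplex_ball[OF K s])
    show "\<exists>q\<in>carrier Q. \<exists>v\<in>simplex_ball K s n. f q v \<noteq> v"
      using q v(2) n by (intro bexI)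
  qed (use inv mult one vert in \<open>simp_all\<close>)
qed

section \<open>Finite quotients\<close>

text \<open>
  From a finite set with a non-trivial action to the finite group \<open>P\<close> of permutations through which
  \<open>Q\<close> acts. The elements of \<open>P\<close> are numbered by \<open>{..<m}\<close>; \<open>\<alpha> q\<close> is left translation by the image of
  \<open>q\<close>, and \<open>r j\<close> is right translation by the \<open>j\<close>-th element. The given set is replaced by \<open>P\<close> itself
  for the sake of these right translations: they commute with the action, and \<open>j \<mapsto> r j i\<close> is
  bijective for every \<open>i\<close>. Left translation by a non-trivial permutation fixes no element of \<open>P\<close>.
\<close>

lemma finite_action_regular:
  fixes Q :: "('g, 'm) monoid_scheme" and B :: "'v set"
  assumes Q: "group Q" and B: "finite B"
    and closed: "\<And>q v. q \<in> carrier Q \<Longrightarrow> v \<in> B \<Longrightarrow> f q v \<in> B"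
    and mult: "\<And>q r v. q \<in> carrier Q \<Longrightarrow> r \<in> carrier Q \<Longrightarrow> v \<in> B \<Longrightarrow> f (q \<otimes>\<^bsub>Q\<^esub> r) v = f q (f r v)"
    and one: "\<And>v. v \<in> B \<Longrightarrow> f \<one>\<^bsub>Q\<^esub> v = v"
    and nontriv: "\<exists>q\<in>carrier Q. \<exists>v\<in>B. f q v \<noteq> v"
  obtains m :: nat and \<alpha> :: "'g \<Rightarrow> nat \<Rightarrow> nat" and r :: "nat \<Rightarrow> nat \<Rightarrow> nat" where
    "m \<ge> 2"
    "\<And>q i. q \<in> carrier Q \<Longrightarrow> i < m \<Longrightarrow> \<alpha> q i < m"
    "\<And>q q' i. q \<in> carrier Q \<Longrightarrow> q' \<in> carrier Q \<Longrightarrow> i < m \<Longrightarrow> \<alpha> (q \<otimes>\<^bsub>Q\<^esub> q') i = \<alpha> q (\<alpha> q' i)"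
    "\<And>i. i < m \<Longrightarrow> \<alpha> \<one>\<^bsub>Q\<^esub> i = i"
    "\<And>i. i < m \<Longrightarrow> \<exists>q\<in>carrier Q. \<alpha> q i \<noteq> i"
    "\<And>i. i < m \<Longrightarrow> bij_betw (\<lambda>j. r j i) {..<m} {..<m}"
    "\<And>q i j. q \<in> carrier Q \<Longrightarrow> i < m \<Longrightarrow> j < m \<Longrightarrow> r j (\<alpha> q i) = \<alpha> q (r j i)"
proof -
  interpret Q: group Q by (rule Q)
  define F where "F = (\<lambda>q. restrict (f q) B)"
  define P where "P = F ` carrier Q"
  have P_sub: "P \<subseteq> (B \<rightarrow>\<^sub>E B)"
    using closed by (auto simp: P_def F_def)
  have fin: "finite P"
    using finite_subset[OF P_sub finite_PiE[OF B]] B by blast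
  have F_mult: "compose B (F q) (F r) = F (q \<otimes>\<^bsub>Q\<^esub> r)" if "q \<in> carrier Q" "r \<in> carrier Q" for q r
    using that closed mult by (auto simp: F_def compose_def intro!: restrict_ext)
  have F_P: "F q \<in> P" if "q \<in> carrier Q" for q
    using that by (simp add: P_def)
  have PE: "\<exists>q\<in>carrier Q. x = F q" if "x \<in> P" for x
    using that by (auto simp: P_def)
  have comp_P: "compose B x y \<in> P" if xy: "x \<in> P" "y \<in> P" for x y
  proof -
    obtain q r where "q \<in> carrier Q" "x = F q" "r \<in> carrier Q" "y = F r"
      using PE[OF xy(1)] PE[OF xy(2)] by (elim bexE)
    then show ?thesis
      using F_mult[of q r] F_P[of "q \<otimes>\<^bsub>Q\<^esub> r"] by simp
  qed
  have assoc: "compose B x (compose B y z) = compose B (compose B x y) z" if "x \<in> P" "y \<in> P" "z \<in> P" for x y z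
  proof (rule compose_assoc)
    show "z \<in> B \<rightarrow> B"
      using that(3) P_sub by (auto simp: PiE_def)
  qed
  have one_F: "compose B (F \<one>\<^bsub>Q\<^esub>) x = x" if "x \<in> P" for x
  proof -
    obtain q where "q \<in> carrier Q" "x = F q" using PE[OF \<open>x \<in> P\<close>] by blast
    then show ?thesis using F_mult by simp
  qed
  have inv_F: "compose B (F (inv\<^bsub>Q\<^esub> q)) (F q) = F \<one>\<^bsub>Q\<^esub>" if "q \<in> carrier Q" for q
    using that F_mult[of "inv\<^bsub>Q\<^esub> q" q] by simp
  define m where "m = card P"
  obtain e where e: "bij_betw e {..<m} P"
    using ex_bij_betw_nat_finite[OF fin] by (auto simp: m_def atLeast0LessThan)
  define d where "d = inv_into {..<m} e"
  have eP: "e i \<in> P" if "i < m" for i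
    using e that by (auto simp: bij_betw_def)
  have dm: "d x < m" "e (d x) = x" if "x \<in> P" for x
  proof -
    have "x \<in> e ` {..<m}" using e that by (simp add: bij_betw_def)
    then show "d x < m" "e (d x) = x"
      using inv_into_into[of x e "{..<m}"] f_inv_into_f[of x e "{..<m}"] by (simp_all add: d_def)
  qed
  have de: "d (e i) = i" if "i < m" for i
    using e that by (simp add: d_def bij_betw_def)
  have d_inj: "x = y" if "d x = d y" "x \<in> P" "y \<in> P" for x y
    using arg_cong[OF that(1), of e] unfolding dm(2)[OF that(2)] dm(2)[OF that(3)] .
  obtain q0 v0 where q0: "q0 \<in> carrier Q" "v0 \<in> B" "f q0 v0 \<noteq> v0"
    using nontriv by blast
  define \<alpha> where "\<alpha> = (\<lambda>q i. d (compose B (F q) (e i)))"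
  define r where "r = (\<lambda>j i. d (compose B (e i) (e j)))"
  have no_fix: "\<exists>q\<in>carrier Q. compose B (F q) x \<noteq> x" if "x \<in> P" for x
  proof (rule ccontr)
    assume "\<not> ?thesis"
    then have fixed: "compose B (F q) x = x" if "q \<in> carrier Q" for q
      using that by blast
    obtain q where q: "q \<in> carrier Q" "x = F q" using PE[OF \<open>x \<in> P\<close>] by blast
    have "compose B (F (inv\<^bsub>Q\<^esub> q)) x = x"
      using fixed q by simp
    then have x1: "x = F \<one>\<^bsub>Q\<^esub>"
      using inv_F[OF q(1)] q(2) by simp
    have "compose B (F q0) (F \<one>\<^bsub>Q\<^esub>) = F \<one>\<^bsub>Q\<^esub>"
      using fixed[OF q0(1)] x1 by simp
    then have "F q0 = F \<one>\<^bsub>Q\<^esub>"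
      using F_mult[OF q0(1) Q.one_closed] q0(1) by simp
    then have "F q0 v0 = F \<one>\<^bsub>Q\<^esub> v0" by simp
    then show False
      using q0 one by (simp add: F_def)
  qed
  show thesis
  proof (rule that[of m \<alpha> r])
    have "F q0 v0 \<noteq> F \<one>\<^bsub>Q\<^esub> v0"
      using q0 one by (simp add: F_def)
    then have "F q0 \<noteq> F \<one>\<^bsub>Q\<^esub>" by metis
    then have "card {F q0, F \<one>\<^bsub>Q\<^esub>} = 2" by simp
    moreover have "{F q0, F \<one>\<^bsub>Q\<^esub>} \<subseteq> P"
      using F_P q0(1) by simp
    ultimately show "2 \<le> m"
      unfolding m_def using card_mono[OF fin] by metis
    show "\<alpha> q i < m" if "q \<in> carrier Q" "i < m" for q i
      unfolding \<alpha>_def using that by (intro dm comp_P F_P eP)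
    show "\<alpha> (q \<otimes>\<^bsub>Q\<^esub> q') i = \<alpha> q (\<alpha> q' i)" if "q \<in> carrier Q" "q' \<in> carrier Q" "i < m" for q q' i
      unfolding \<alpha>_def
      using dm(2)[OF comp_P[OF F_P[OF that(2)] eP[OF that(3)]]] assoc[OF F_P[OF that(1)] F_P[OF that(2)] eP[OF that(3)]]
        F_mult[OF that(1,2)] by simp
    show "\<alpha> \<one>\<^bsub>Q\<^esub> i = i" if "i < m" for i
      unfolding \<alpha>_def using one_F[OF eP[OF that]] de[OF that] by simp
    show "\<exists>q\<in>carrier Q. \<alpha> q i \<noteq> i" if i: "i < m" for i
    proof -
      obtain q where q: "q \<in> carrier Q" "compose B (F q) (e i) \<noteq> e i"
        using no_fix[OF eP[OF i]] by blast
      have "\<alpha> q i \<noteq> i"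
      proof
        assume "\<alpha> q i = i"
        then have "e (d (compose B (F q) (e i))) = e i" by (simp add: \<alpha>_def)
        then show False
          using dm(2)[OF comp_P[OF F_P[OF q(1)] eP[OF i]]] q(2) by simp
      qed
      with q(1) show ?thesis by blast
    qed
    show "bij_betw (\<lambda>j. r j i) {..<m} {..<m}" if i: "i < m" for i
    proof -
      obtain q where q: "q \<in> carrier Q" "e i = F q"
        using PE[OF eP[OF i]] by blast
      have "inj_on (\<lambda>j. r j i) {..<m}"
      proof (rule inj_onI)
        fix j k assume "j \<in> {..<m}" "k \<in> {..<m}" and eq: "r j i = r k i"
        then have j: "j < m" and k: "k < m" by auto
        have "compose B (e i) (e j) = compose B (e i) (e k)"
          using eq unfolding r_def by (rule d_inj) (intro comp_P eP i j k)+
        then have "compose B (F (inv\<^bsub>Q\<^esub> q)) (compose B (e i) (e j)) =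
            compose B (F (inv\<^bsub>Q\<^esub> q)) (compose B (e i) (e k))" by simp
        then have "e j = e k"
          using assoc[OF F_P[OF Q.inv_closed[OF q(1)]] eP[OF i] eP[OF j]]
            assoc[OF F_P[OF Q.inv_closed[OF q(1)]] eP[OF i] eP[OF k]]
            inv_F[OF q(1)] q(2) one_F[OF eP[OF j]] one_F[OF eP[OF k]] by simp
        from arg_cong[OF this, of d] show "j = k"
          unfolding de[OF j] de[OF k] .
      qed
      moreover have "(\<lambda>j. r j i) ` {..<m} \<subseteq> {..<m}"
      proof (rule image_subsetI)
        fix j assume "j \<in> {..<m}"
        then have "e j \<in> P" by (intro eP) simp
        then show "r j i \<in> {..<m}"
          unfolding r_def lessThan_iff by (intro dm(1) comp_P eP[OF i])
      qed
      ultimately show ?thesis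
        unfolding bij_betw_def by (intro conjI endo_inj_surj) simp_all
    qed
    show "r j (\<alpha> q i) = \<alpha> q (r j i)" if q: "q \<in> carrier Q" and i: "i < m" and j: "j < m" for q i j
      unfolding \<alpha>_def r_def
      using dm(2)[OF comp_P[OF F_P[OF q] eP[OF i]]] dm(2)[OF comp_P[OF eP[OF i] eP[OF j]]]
        assoc[OF F_P[OF q] eP[OF i] eP[OF j]] by simp
  qed
qed

section \<open>An inverse limit of suspensions\<close>

text \<open>
  The point at height \<open>t\<close> on the arc with number \<open>s\<close>. The arcs are the graphs of the multiples
  of \<open>t (1 - t)\<close>, with common ends at heights \<open>0\<close> and \<open>1\<close>; together they form the suspension of a finite set, with poles \<open>(0, 0)\<close>
  and \<open>(1, 0)\<close>.
\<close>

definition arc_point :: "nat \<Rightarrow> real \<Rightarrow> real \<times> real" where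
  "arc_point s t = (t, real s * (t * (1 - t)))"

lemma arc_point_eq_iff: "arc_point s t = arc_point s' t' \<longleftrightarrow> t = t' \<and> (s = s' \<or> t = 0 \<or> t = 1)"
  by (auto simp: arc_point_def)

lemma fst_arc_point [simp]: "fst (arc_point s t) = t"
  by (simp add: arc_point_def)

lemma continuous_on_arc_point: "continuous_on S f \<Longrightarrow> continuous_on S (\<lambda>x. arc_point s (f x))"
  unfolding arc_point_def by (intro continuous_intros)

text \<open>
  Even laps run upwards, odd laps run downwards; \<open>u\<close> is the time within the lap \<open>l\<close>.
\<close>

definition lap_height :: "nat \<Rightarrow> real \<Rightarrow> real" where
  "lap_height l u = (if even l then u else 1 - u)"

lemma lap_height_range: "0 \<le> u \<Longrightarrow> u \<le> 1 \<Longrightarrow> 0 \<le> lap_height l u \<and> lap_height l u \<le> 1"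
  by (simp add: lap_height_def)

text \<open>
  The counterpart of \<open>lap_height\<close> for a grid of mesh \<open>1 / N\<close>: after \<open>i\<close> of the \<open>N\<close> steps of lap \<open>l\<close>, the
  height is the grid point with this number.
\<close>

definition lap_grid :: "nat \<Rightarrow> nat \<Rightarrow> nat \<Rightarrow> nat" where
  "lap_grid N l i = (if even l then i else N - i)"

text \<open>
  The number \<open>m\<close> of arcs and the maps \<open>r j\<close> that select the arcs of the upward laps. Acyclicity of
  the limit rests on one property of these maps: the upward laps visit all arcs equally often.
\<close>

locale zigzag =
  fixes m :: nat and r :: "nat \<Rightarrow> nat \<Rightarrow> nat"
  assumes m: "m \<ge> 2" and r_bij: "\<And>s. s < m \<Longrightarrow> bij_betw (\<lambda>j. r j s) {..<m} {..<m}"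
begin

text \<open>
  There are \<open>2 m\<close> upward laps, two for each arc, and \<open>2 m - 1\<close> downward laps in between. With one visit
  to each arc, the prime would have to divide \<open>m - 1\<close>, and there is none for \<open>m = 2\<close>.
\<close>

definition laps :: nat where "laps = 4 * m - 1"

definition lap_arc :: "nat \<Rightarrow> nat \<Rightarrow> nat" where
  "lap_arc s l = (if even l then r ((l div 2) mod m) s else s)"

definition graph :: "(real \<times> real) set" where
  "graph = {arc_point s t | s t. s < m \<and> 0 \<le> t \<and> t \<le> 1}"

text \<open>
  The graph of the self-map of the suspension, with the image as first component, parametrized by arc,
  lap and time. In this form it is visibly compact.
\<close>

definition zigzag_rel :: "((real \<times> real) \<times> (real \<times> real)) set" where
  "zigzag_rel = {(arc_point (lap_arc s l) (lap_height l u), arc_point s ((real l + u) / real laps)) | s l u.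
     s < m \<and> l < laps \<and> 0 \<le> u \<and> u \<le> 1}"

text \<open>
  The inverse limit; the bonding map takes \<open>x (Suc n)\<close> to \<open>x n\<close>.
\<close>

definition limit :: "(nat \<Rightarrow> real \<times> real) set" where
  "limit = {x. \<forall>n. (x n, x (Suc n)) \<in> zigzag_rel}"

text \<open>
  The open star of the grid point at height \<open>i / N\<close> on arc \<open>s\<close>. For \<open>i = 0\<close> and \<open>i = N\<close> this is the star
  of a pole, which reaches into all arcs and does not depend on \<open>s\<close>.
\<close>

definition star :: "nat \<Rightarrow> nat \<Rightarrow> nat \<Rightarrow> (real \<times> real) set" where
  "star N s i = {arc_point s' t | s' t. s' < m \<and> 0 \<le> t \<and> t \<le> 1 \<and> \<bar>t * real N - real i\<bar> < 1 \<and>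
     (s' = s \<or> i = 0 \<or> i = N)}"

definition cell :: "nat \<Rightarrow> nat \<Rightarrow> nat \<Rightarrow> nat \<Rightarrow> (nat \<Rightarrow> real \<times> real) set" where
  "cell n N s i = {x \<in> limit. x n \<in> star N s i}"

definition star_cover :: "nat \<Rightarrow> nat \<Rightarrow> (nat \<Rightarrow> real \<times> real) set set" where
  "star_cover n N = {cell n N s i | s i. s < m \<and> i \<le> N}"

lemma laps_pos: "laps > 0" and laps_ge: "laps \<ge> 3" and laps_odd: "odd laps"
  using m by (auto simp: laps_def)

lemma lap_arc_less: "s < m \<Longrightarrow> lap_arc s l < m"
  using bij_betwE[OF r_bij] m by (simp add: lap_arc_def)

lemma lap_grid_le: "i \<le> N \<Longrightarrow> lap_grid N l i \<le> N"
  by (simp add: lap_grid_def)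

lemma lap_height_grid: "i \<le> N \<Longrightarrow> \<bar>lap_height l u * real N - real (lap_grid N l i)\<bar> = \<bar>u * real N - real i\<bar>"
  by (auto simp: lap_height_def lap_grid_def of_nat_diff algebra_simps)

lemma cell_pole: "i = 0 \<or> i = N \<Longrightarrow> cell n N s i = cell n N s' i"
  unfolding cell_def star_def by simp

lemma zigzag_relI: "s < m \<Longrightarrow> l < laps \<Longrightarrow> 0 \<le> u \<Longrightarrow> u \<le> 1 \<Longrightarrow>
    (arc_point (lap_arc s l) (lap_height l u), arc_point s ((real l + u) / real laps)) \<in> zigzag_rel"
  unfolding zigzag_rel_def by blast

lemma zigzag_relE:
  assumes "(y, x) \<in> zigzag_rel"
  obtains s l u where "s < m" "l < laps" "0 \<le> u" "u \<le> 1" "y = arc_point (lap_arc s l) (lap_height l u)" "x = arc_point s ((real l + u) / real laps)"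
  using assms unfolding zigzag_rel_def by blast

lemma graphE:
  assumes "x \<in> graph"
  obtains s t where "s < m" "0 \<le> t" "t \<le> 1" "x = arc_point s t"
  using assms unfolding graph_def by blast

lemma graphI: "s < m \<Longrightarrow> 0 \<le> t \<Longrightarrow> t \<le> 1 \<Longrightarrow> arc_point s t \<in> graph"
  unfolding graph_def by blast

lemma lap_range:
  assumes "l < laps" "0 \<le> u" "u \<le> 1"
  shows "0 \<le> (real l + u) / real laps" "(real l + u) / real laps \<le> 1"
proof -
  have "real l + 1 \<le> real laps" using assms(1) by linarith
  then show "0 \<le> (real l + u) / real laps" "(real l + u) / real laps \<le> 1"
    using assms laps_pos by (simp_all add: divide_simps)
qed

lemma rel_graph:
  assumes "(y, x) \<in> zigzag_rel"
  shows "y \<in> graph" "x \<in> graph"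
proof -
  obtain s l u where *: "s < m" "l < laps" "0 \<le> u" "u \<le> 1" "y = arc_point (lap_arc s l) (lap_height l u)" "x = arc_point s ((real l + u) / real laps)"
    by (rule zigzag_relE[OF assms])
  show "y \<in> graph"
    unfolding *(5) using lap_arc_less[OF *(1)] lap_height_range[OF *(3,4), of l] by (intro graphI) auto
  show "x \<in> graph"
    unfolding *(6) using lap_range[OF *(2-4)] *(1) by (intro graphI)
qed

lemma limit_graph: "x \<in> limit \<Longrightarrow> x n \<in> graph"
  using rel_graph(1) unfolding limit_def by blast

subsection \<open>Existence of points\<close>

lemma rel_total: "x \<in> graph \<Longrightarrow> \<exists>y. (y, x) \<in> zigzag_rel"
proof -
  assume "x \<in> graph"
  then obtain s t where st: "s < m" "0 \<le> t" "t \<le> 1" "x = arc_point s t"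
    by (rule graphE)
  define l where "l = min (nat \<lfloor>t * real laps\<rfloor>) (laps - 1)"
  define u where "u = t * real laps - real l"
  have tL: "0 \<le> t * real laps" "t * real laps \<le> real laps"
    using st laps_pos by (simp_all add: mult_left_le_one_le)
  have l: "l < laps" using laps_pos by (simp add: l_def)
  have "real l \<le> t * real laps"
    using tL by (simp add: l_def min_def) linarith
  moreover have "t * real laps \<le> real l + 1"
  proof (cases "nat \<lfloor>t * real laps\<rfloor> \<le> laps - 1")
    case True
    then have "real l = of_int \<lfloor>t * real laps\<rfloor>"
      using tL by (simp add: l_def min_def)
    then show ?thesis by linarith
  next
    case False
    then have "l = laps - 1" by (simp add: l_def)
    then show ?thesis using tL laps_pos by (simp add: of_nat_diff)
  qed
  ultimately have u: "0 \<le> u" "u \<le> 1" by (simp_all add: u_def)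
  have "(real l + u) / real laps = t"
    using laps_pos by (simp add: u_def)
  then have "(arc_point (lap_arc s l) (lap_height l u), x) \<in> zigzag_rel"
    using zigzag_relI[OF st(1) l u] st(4) by simp
  then show ?thesis by (rule exI)
qed

text \<open>
  Lap \<open>1\<close>, the first downward one, stays on its own arc, so it supplies preimages.
\<close>

lemma rel_surj: "y \<in> graph \<Longrightarrow> \<exists>x. (y, x) \<in> zigzag_rel"
proof -
  assume "y \<in> graph"
  then obtain s t where st: "s < m" "0 \<le> t" "t \<le> 1" "y = arc_point s t"
    by (rule graphE)
  have "(arc_point (lap_arc s 1) (lap_height 1 (1 - t)), arc_point s ((real 1 + (1 - t)) / real laps)) \<in> zigzag_rel"
    using st laps_ge by (intro zigzag_relI) auto
  then have "(y, arc_point s ((real 1 + (1 - t)) / real laps)) \<in> zigzag_rel"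
    using st(4) by (simp add: lap_arc_def lap_height_def)
  then show ?thesis by (rule exI)
qed

text \<open>
  The bonding map is total and surjective, so a point of one stage extends in both directions. This
  makes the sets \<open>cell\<close> non-empty, and neighbouring ones intersect.
\<close>

lemma limit_point_exists:
  assumes "p \<in> graph"
  obtains x where "x \<in> limit" "x n = p"
proof -
  define D where "D = (\<lambda>x. SOME y. (y, x) \<in> zigzag_rel)"
  define U where "U = (\<lambda>y. SOME x. (y, x) \<in> zigzag_rel)"
  have D: "(D x, x) \<in> zigzag_rel" if "x \<in> graph" for x
    unfolding D_def using someI_ex[OF rel_total[OF that]] .
  have U: "(y, U y) \<in> zigzag_rel" if "y \<in> graph" for y
    unfolding U_def using someI_ex[OF rel_surj[OF that]] .
  have Dn: "(D ^^ k) p \<in> graph" for k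
    by (induction k) (use assms rel_graph(1)[OF D] in auto)
  have Un: "(U ^^ k) p \<in> graph" for k
    by (induction k) (use assms rel_graph(2)[OF U] in auto)
  \<comment> \<open>Downwards along the bonding map, upwards along chosen preimages.\<close>
  define x where "x = (\<lambda>k. if k \<le> n then (D ^^ (n - k)) p else (U ^^ (k - n)) p)"
  have "(x k, x (Suc k)) \<in> zigzag_rel" for k
  proof (cases "k < n")
    case True
    then have "n - k = Suc (n - Suc k)" by simp
    then show ?thesis
      using D[OF Dn[of "n - Suc k"]] True by (simp add: x_def)
  next
    case False
    then have "x k = (U ^^ (k - n)) p" "x (Suc k) = U ((U ^^ (k - n)) p)"
      by (auto simp: x_def Suc_diff_le)
    then show ?thesis
      using U[OF Un[of "k - n"]] by simp
  qed
  then have "x \<in> limit" by (simp add: limit_def)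
  moreover have "x n = p" by (simp add: x_def)
  ultimately show thesis by (rule that)
qed

subsection \<open>Compactness\<close>

lemma compact_rel: "compact zigzag_rel"
proof -
  let ?f = "\<lambda>(s, l) u. (arc_point (lap_arc s l) (lap_height l u), arc_point s ((real l + u) / real laps))"
  have eq: "zigzag_rel = (\<Union>sl\<in>{..<m} \<times> {..<laps}. ?f sl ` {0..1})"
  proof (intro equalityI subsetI)
    fix p assume "p \<in> zigzag_rel"
    then obtain s l u where "s < m" "l < laps" "0 \<le> u" "u \<le> 1" "p = ?f (s, l) u"
      unfolding zigzag_rel_def by auto
    then show "p \<in> (\<Union>sl\<in>{..<m} \<times> {..<laps}. ?f sl ` {0..1})"
      by (intro UN_I[of "(s, l)"] image_eqI[of _ _ u]) simp_all
  next
    fix p assume "p \<in> (\<Union>sl\<in>{..<m} \<times> {..<laps}. ?f sl ` {0..1})"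
    then obtain s l u where *: "s < m" "l < laps" "0 \<le> u" "u \<le> 1" and p: "p = ?f (s, l) u"
      by auto
    show "p \<in> zigzag_rel"
      unfolding p prod.case by (rule zigzag_relI[OF *])
  qed
  have cont: "continuous_on {0..1} (?f sl)" for sl
  proof -
    have "continuous_on {0..1} (lap_height l)" for l
      unfolding lap_height_def by (cases "even l") (auto intro!: continuous_intros)
    then show ?thesis
      using laps_pos by (auto simp: case_prod_beta intro!: continuous_on_Pair continuous_on_arc_point continuous_intros)
  qed
  show ?thesis
    unfolding eq by (intro compact_UN compact_continuous_image cont) auto
qed

lemma compact_arc: "compact (arc_point s ` {0..1})"
  by (intro compact_continuous_image continuous_on_arc_point) (auto intro: continuous_intros)

lemma graph_eq: "graph = (\<Union>s\<in>{..<m}. arc_point s ` {0..1})"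
proof (intro equalityI subsetI)
  fix p assume "p \<in> graph"
  then obtain s t where "s < m" "0 \<le> t" "t \<le> 1" "p = arc_point s t"
    by (rule graphE)
  then show "p \<in> (\<Union>s\<in>{..<m}. arc_point s ` {0..1})"
    by (intro UN_I[of s] image_eqI[of _ _ t]) simp_all
qed (auto simp: graphI)

text \<open>
  A closed subset of a power of the compact graph.
\<close>

lemma compact_limit: "compact limit"
proof -
  have "compact graph"
    unfolding graph_eq by (intro compact_UN compact_arc) auto
  then have "compactin euclidean (PiE UNIV (\<lambda>_::nat. graph))"
    unfolding euclidean_product_topology[symmetric] compactin_PiE by simp
  then have c: "compact (PiE UNIV (\<lambda>_::nat. graph))"
    by simp
  have "closed ((\<lambda>x::nat \<Rightarrow> real \<times> real. (x n, x (Suc n))) -` zigzag_rel)" for n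
    by (intro closed_vimage compact_imp_closed compact_rel continuous_on_Pair continuous_on_product_coordinates)
  then have "closed (\<Inter>n. (\<lambda>x::nat \<Rightarrow> real \<times> real. (x n, x (Suc n))) -` zigzag_rel)"
    by blast
  moreover have "limit = (\<Inter>n. (\<lambda>x. (x n, x (Suc n))) -` zigzag_rel)"
    unfolding limit_def by auto
  ultimately have "closed limit" by simp
  moreover have "limit \<subseteq> PiE UNIV (\<lambda>_. graph)"
    using limit_graph by auto
  ultimately show ?thesis
    using compact_Int_closed[OF c, of limit] Int_absorb1[of limit "PiE UNIV (\<lambda>_. graph)"] by simp
qed

subsection \<open>Covers by stars\<close>

lemma starI:
  "s' < m \<Longrightarrow> 0 \<le> t \<Longrightarrow> t \<le> 1 \<Longrightarrow> \<bar>t * real N - real i\<bar> < 1 \<Longrightarrow> s' = s \<or> i = 0 \<or> i = N \<Longrightarrow> arc_point s' t \<in> star N s i"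
  unfolding star_def by blast

lemma star_arc_pointD:
  assumes "arc_point s t \<in> star N s' i" "i \<le> N"
  shows "\<bar>t * real N - real i\<bar> < 1" "s = s' \<or> i = 0 \<or> i = N"
proof -
  obtain s'' t' where *: "arc_point s t = arc_point s'' t'" "\<bar>t' * real N - real i\<bar> < 1" "s'' = s' \<or> i = 0 \<or> i = N"
    using assms(1) unfolding star_def by blast
  then have t: "t' = t" and s: "s = s'' \<or> t = 0 \<or> t = 1"
    by (auto simp: arc_point_eq_iff)
  show 1: "\<bar>t * real N - real i\<bar> < 1" using *(2) t by simp
  show "s = s' \<or> i = 0 \<or> i = N"
  proof (rule ccontr)
    assume "\<not> ?thesis"
    then have "0 < i" "i < N" "t = 0 \<or> t = 1" using s *(3) assms(2) by auto
    then show False using 1 by auto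
  qed
qed

text \<open>
  Away from the poles, \<open>t (1 - t)\<close> is positive and the condition \<open>?E\<close> says that the arc number differs
  from \<open>s\<close> by less than \<open>1\<close>.
\<close>

lemma star_openin: "s < m \<Longrightarrow> i \<le> N \<Longrightarrow> \<exists>O'. open O' \<and> star N s i = graph \<inter> O'"
proof -
  assume s: "s < m" and i: "i \<le> N"
  let ?O = "{p :: real \<times> real. \<bar>fst p * real N - real i\<bar> < 1}"
  let ?E = "{p :: real \<times> real. \<bar>snd p - real s * (fst p * (1 - fst p))\<bar> < fst p * (1 - fst p)}"
  have op: "open ?O" "open ?E"
    by (intro open_Collect_less continuous_intros)+
  show ?thesis
  proof (cases "i = 0 \<or> i = N")
    case True
    have "star N s i = graph \<inter> ?O"
    proof (intro equalityI subsetI)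
      fix p assume "p \<in> star N s i"
      then obtain s' t where "p = arc_point s' t" "s' < m" "0 \<le> t" "t \<le> 1" "\<bar>t * real N - real i\<bar> < 1"
        unfolding star_def by blast
      then show "p \<in> graph \<inter> ?O" by (simp add: graphI)
    next
      fix p assume p: "p \<in> graph \<inter> ?O"
      then obtain s' t where "p = arc_point s' t" "s' < m" "0 \<le> t" "t \<le> 1"
        using graphE by blast
      with p True show "p \<in> star N s i" by (auto intro!: starI)
    qed
    then show ?thesis using op by blast
  next
    case False
    then have i': "0 < i" "i < N" using i by auto
    have "star N s i = graph \<inter> (?O \<inter> ?E)"
    proof (intro equalityI subsetI)
      fix p assume "p \<in> star N s i"
      then obtain t where p: "p = arc_point s t" "0 \<le> t" "t \<le> 1" "\<bar>t * real N - real i\<bar> < 1"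
        using False unfolding star_def by blast
      have "t \<noteq> 0" "t \<noteq> 1" using p(4) i' by auto
      then have "0 < t * (1 - t)" using p by simp
      then have "p \<in> ?E" using p(1) by (simp add: arc_point_def)
      moreover have "p \<in> graph \<inter> ?O" using p s by (simp add: graphI)
      ultimately show "p \<in> graph \<inter> (?O \<inter> ?E)" by blast
    next
      fix p assume p: "p \<in> graph \<inter> (?O \<inter> ?E)"
      then obtain s' t where st: "p = arc_point s' t" "s' < m" "0 \<le> t" "t \<le> 1"
        using graphE by blast
      define w where "w = t * (1 - t)"
      have E: "\<bar>real s' * w - real s * w\<bar> < w"
        using p st(1) by (simp add: arc_point_def w_def)
      then have pos: "0 < w" by linarith
      have "\<bar>real s' - real s\<bar> * w < 1 * w"
        using E pos by (simp add: left_diff_distrib[symmetric] abs_mult)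
      then have "\<bar>real s' - real s\<bar> < 1"
        using pos by (simp only: mult_less_cancel_right_pos)
      then have "s' = s" by linarith
      with st p show "p \<in> star N s i" by (auto intro!: starI)
    qed
    then show ?thesis using op by blast
  qed
qed

lemma openin_cell: "s < m \<Longrightarrow> i \<le> N \<Longrightarrow> openin (top_of_set limit) (cell n N s i)"
proof -
  assume "s < m" "i \<le> N"
  then obtain O' where O': "open O'" "star N s i = graph \<inter> O'"
    using star_openin by blast
  have "open ((\<lambda>x :: nat \<Rightarrow> real \<times> real. x n) -` O')"
    by (intro open_vimage O'(1) continuous_on_product_coordinates)
  moreover have "cell n N s i = limit \<inter> ((\<lambda>x. x n) -` O')"
    unfolding cell_def O'(2) using limit_graph by auto
  ultimately show ?thesis
    by (auto simp: openin_open)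
qed

lemma grid_near:
  assumes "0 \<le> t" "t \<le> (1::real)"
  obtains i where "i \<le> N" "\<bar>t * real N - real i\<bar> < 1"
proof
  have t: "0 \<le> t * real N" "t * real N \<le> real N"
    using assms by (simp_all add: mult_left_le_one_le)
  then show "nat \<lfloor>t * real N\<rfloor> \<le> N" by linarith
  show "\<bar>t * real N - real (nat \<lfloor>t * real N\<rfloor>)\<bar> < 1" using t by linarith
qed

lemma cell_subset: "cell n N s i \<subseteq> limit"
  unfolding cell_def by blast

lemma star_cover_open_cover: "star_cover n N \<in> open_covers (top_of_set limit)"
proof -
  have "x \<in> \<Union>(star_cover n N)" if x: "x \<in> limit" for x
  proof -
    obtain s t where st: "s < m" "0 \<le> t" "t \<le> 1" "x n = arc_point s t"
      using limit_graph[OF x] by (rule graphE)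
    obtain i where "i \<le> N" "\<bar>t * real N - real i\<bar> < 1"
      by (rule grid_near[OF st(2,3)])
    with st x have "x \<in> cell n N s i"
      by (auto simp: cell_def intro!: starI)
    with st(1) \<open>i \<le> N\<close> show ?thesis
      unfolding star_cover_def by blast
  qed
  moreover have "V \<subseteq> limit" "openin (top_of_set limit) V" if "V \<in> star_cover n N" for V
    using that openin_cell cell_subset unfolding star_cover_def by blast+
  ultimately show ?thesis
    unfolding open_covers_def by (simp add: set_eq_iff) blast
qed

text \<open>
  Near a point with known position, the label of a set of the cover may be taken on the arc of that
  point, since labels on other arcs occur only for the two poles.
\<close>

lemma cell_common_point:
  assumes x: "x \<in> cell n N s1 i1" and i1: "i1 \<le> N" and xn: "x n = arc_point s t"
  shows "cell n N s1 i1 = cell n N s i1" "\<bar>t * real N - real i1\<bar> < 1" "s = s1 \<or> i1 = 0 \<or> i1 = N"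
proof -
  have "arc_point s t \<in> star N s1 i1"
    using x xn by (simp add: cell_def)
  note D = star_arc_pointD[OF this i1]
  show "\<bar>t * real N - real i1\<bar> < 1" "s = s1 \<or> i1 = 0 \<or> i1 = N" by (rule D)+
  then show "cell n N s1 i1 = cell n N s i1"
    using cell_pole by blast
qed

text \<open>
  At most two grid points are at distance less than one mesh from a given height, so the nerve is a
  graph.
\<close>

lemma star_cover_nerve:
  assumes S: "S \<in> nerve (star_cover n N)"
  shows "card S \<le> 2"
proof -
  obtain x where x: "\<And>V. V \<in> S \<Longrightarrow> x \<in> V" and S': "S \<noteq> {}" "S \<subseteq> star_cover n N"
    using S by (auto simp: mem_nerve_iff)
  have "x \<in> limit"
    using S' x cell_subset unfolding star_cover_def by blast
  then obtain s t where st: "s < m" "0 \<le> t" "t \<le> 1" "x n = arc_point s t"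
    using graphE[OF limit_graph[of x n]] by metis
  define k where "k = nat \<lfloor>t * real N\<rfloor>"
  have "V \<in> {cell n N s k, cell n N s (Suc k)}" if V: "V \<in> S" for V
  proof -
    obtain s1 i1 where V1: "V = cell n N s1 i1" "i1 \<le> N"
      using V S'(2) unfolding star_cover_def by blast
    note c = cell_common_point[OF x[OF V, unfolded V1(1)] V1(2) st(4)]
    have "0 \<le> t * real N" using st by simp
    with c(2) have "i1 = k \<or> i1 = Suc k" unfolding k_def by linarith
    then show ?thesis using c(1) V1(1) by auto
  qed
  then have "S \<subseteq> {cell n N s k, cell n N s (Suc k)}" by blast
  then have "card S \<le> card {cell n N s k, cell n N s (Suc k)}"
    by (intro card_mono) auto
  also have "\<dots> \<le> 2" by (simp add: card_insert_if)
  finally show ?thesis .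
qed

subsection \<open>Refinement\<close>

text \<open>
  The bonding map is simplicial from the grid with mesh \<open>1 / (laps * N)\<close> to the grid with mesh \<open>1 / N\<close>,
  so it maps stars into stars. The label \<open>l * N + i\<close> is step \<open>i\<close> of lap \<open>l\<close>; \<open>i = N\<close> is admitted only at
  the end of the last lap, so each grid point has one label. A point of the star may lie on the previous
  lap if \<open>i = 0\<close>, but then the image is near a pole.
\<close>

lemma star_image:
  assumes rel: "(y, x) \<in> zigzag_rel" and x: "x \<in> star (laps * N) s (l * N + i)"
    and s: "s < m" and l: "l < laps" and i: "i \<le> N" "i < N \<or> l = laps - 1" and N: "N > 0"
  shows "y \<in> star N (lap_arc s l) (lap_grid N l i)"
proof -
  let ?j = "l * N + i"
  obtain s' l' u where *: "s' < m" "l' < laps" "0 \<le> u" "u \<le> 1" "y = arc_point (lap_arc s' l') (lap_height l' u)"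
    "x = arc_point s' ((real l' + u) / real laps)"
    by (rule zigzag_relE[OF rel])
  have jL: "?j \<le> laps * N"
  proof -
    have "?j \<le> Suc l * N" using i by simp
    also have "\<dots> \<le> laps * N" using l by (intro mult_le_mono1) simp
    finally show ?thesis .
  qed
  have tL: "(real l' + u) / real laps * real (laps * N) = (real l' + u) * real N"
    using laps_pos by simp
  have near: "\<bar>(real l' + u) * real N - real ?j\<bar> < 1" and s': "s' = s \<or> ?j = 0 \<or> ?j = laps * N"
    using star_arc_pointD[OF x[unfolded *(6)] jL] unfolding tL by auto
  have lap_height: "0 \<le> lap_height l' u" "lap_height l' u \<le> 1" "lap_arc s' l' < m"
    using lap_height_range[OF *(3,4), of l'] lap_arc_less[OF *(1)] by auto
  have uN: "0 \<le> u * real N" "u * real N \<le> real N"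
    using *(3,4) N by (simp_all add: mult_left_le_one_le)
  have exp: "(real l' + u) * real N = real (l' * N) + u * real N" by (simp add: algebra_simps)
  consider "l' = l" | "l' > l" | "l' < l" by linarith
  then show ?thesis
  proof cases
    case 1
    have "\<bar>u * real N - real i\<bar> < 1"
      using near 1 unfolding exp by simp
    then have n: "\<bar>lap_height l' u * real N - real (lap_grid N l i)\<bar> < 1"
      using lap_height_grid[OF i(1), of l u] 1 by simp
    have "lap_arc s' l' = lap_arc s l \<or> lap_grid N l i = 0 \<or> lap_grid N l i = N"
    proof -
      consider "s' = s" | "?j = 0" | "?j = laps * N" using s' by (elim disjE)
      then show ?thesis
      proof cases
        case 2
        then have "l = 0" "i = 0" using N by auto
        then show ?thesis by (simp add: lap_grid_def)
      next
        case 3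
        have "i = N"
        proof (rule ccontr)
          assume "i \<noteq> N"
          then have "?j < Suc l * N" using i by simp
          also have "\<dots> \<le> laps * N" using l by (intro mult_le_mono1) simp
          finally show False using 3 by simp
        qed
        then show ?thesis by (simp add: lap_grid_def)
      qed (simp add: 1)
    qed
    then show ?thesis
      unfolding *(5) by (intro starI lap_height n)
  next
    case 2
    then have "Suc l \<le> l'" by simp
    then have "real (Suc l * N) \<le> real (l' * N)"
      by (intro of_nat_mono mult_le_mono1)
    then have "real N - real i < 1"
      using near uN unfolding exp by simp
    then have "i = N" using i(1) by linarith
    then have "l = laps - 1" using i(2) by simp
    then show ?thesis using 2 *(2) by simp
  next
    case 3
    then obtain d where d: "l = l' + Suc d" by (metis add_Suc_right less_imp_Suc_add)
    have "real (l * N) = real (l' * N) + real N + real (d * N)"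
      by (simp add: d algebra_simps)
    then have lt: "real (d * N) + real i + (real N - u * real N) < 1"
      using near uN unfolding exp by simp
    moreover have "0 \<le> real (d * N)" "0 \<le> real i" by simp_all
    ultimately have "real (d * N) < 1" "real i < 1" using uN by linarith+
    then have "d * N = 0" "i = 0" by linarith+
    then have d0: "d = 0" and i0: "i = 0" using N by auto
    have close: "real N - u * real N < 1" using lt i0 d0 by simp
    have par: "even l \<longleftrightarrow> odd l'" using d d0 by simp
    have n: "\<bar>lap_height l' u * real N - real (lap_grid N l i)\<bar> < 1"
      using close uN par by (auto simp: lap_height_def lap_grid_def i0 algebra_simps)
    have "lap_grid N l i = 0 \<or> lap_grid N l i = N" by (simp add: lap_grid_def i0)
    then show ?thesis
      unfolding *(5) by (intro starI lap_height n) auto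
  qed
qed

lemma grid_decompose:
  assumes "j \<le> laps * N" "N > 0"
  obtains l i where "j = l * N + i" "l < laps" "i \<le> N" "i < N \<or> l = laps - 1"
proof (cases "j < laps * N")
  case True
  then have "j div N < laps" using assms(2) by (simp add: less_mult_imp_div_less)
  then show thesis
    using assms(2) by (intro that[of "j div N" "j mod N"]) (auto simp: less_imp_le)
next
  case False
  then have "j = laps * N" using assms(1) by simp
  also have "\<dots> = (laps - 1) * N + N" using laps_pos by (simp add: algebra_simps)
  finally show thesis using laps_pos by (intro that[of "laps - 1" N]) auto
qed

lemma cell_refine:
  assumes "s < m" "l < laps" "i \<le> N" "i < N \<or> l = laps - 1" "N > 0"
  shows "cell (Suc n) (laps * N) s (l * N + i) \<subseteq> cell n N (lap_arc s l) (lap_grid N l i)"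
proof
  fix x assume x: "x \<in> cell (Suc n) (laps * N) s (l * N + i)"
  then have "(x n, x (Suc n)) \<in> zigzag_rel" "x (Suc n) \<in> star (laps * N) s (l * N + i)"
    by (auto simp: cell_def limit_def)
  then have "x n \<in> star N (lap_arc s l) (lap_grid N l i)"
    by (rule star_image) (use assms in auto)
  with x show "x \<in> cell n N (lap_arc s l) (lap_grid N l i)"
    by (simp add: cell_def)
qed

text \<open>
  Coordinates below \<open>n\<close> are confined to stars of coarser grids, which are still of mesh at most \<open>1 / N\<close>.
\<close>

lemma cell_refine_lower:
  assumes "s < m" "i \<le> N * laps ^ n" "N > 0" "d \<le> n"
  shows "\<exists>s' i'. s' < m \<and> i' \<le> N * laps ^ (n - d) \<and> cell n (N * laps ^ n) s i \<subseteq> cell (n - d) (N * laps ^ (n - d)) s' i'"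
  using assms(4)
proof (induction d)
  case 0
  then show ?case using assms by auto
next
  case (Suc d)
  then obtain s' i' where s': "s' < m" "i' \<le> N * laps ^ (n - d)"
    and sub: "cell n (N * laps ^ n) s i \<subseteq> cell (n - d) (N * laps ^ (n - d)) s' i'"
    by auto
  let ?k = "n - Suc d" and ?N = "N * laps ^ (n - Suc d)"
  have k: "n - d = Suc ?k" using Suc.prems by simp
  have N: "N * laps ^ (n - d) = laps * ?N" unfolding k by simp
  have Npos: "?N > 0" using assms(3) laps_pos by simp
  obtain l j where *: "i' = l * ?N + j" "l < laps" "j \<le> ?N" "j < ?N \<or> l = laps - 1"
    using grid_decompose[of i' ?N] s'(2) Npos unfolding N by blast
  have "cell (n - d) (N * laps ^ (n - d)) s' i' \<subseteq> cell ?k ?N (lap_arc s' l) (lap_grid ?N l j)"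
    using cell_refine[OF s'(1) *(2-4) Npos, of ?k]
    by (simp only: *(1)[symmetric] N[symmetric] k[symmetric])
  with sub show ?case
    using lap_arc_less[OF s'(1)] lap_grid_le[OF *(3)] by blast
qed

text \<open>
  Near a pole the arcs are as close to each other as they are to the pole; elsewhere the star stays on
  one arc.
\<close>

lemma star_diameter:
  assumes p: "p \<in> star N s i" and q: "q \<in> star N s i" and N: "N > 0" and i: "i \<le> N"
  shows "dist p q \<le> (2 + 2 * real m) / real N"
proof -
  obtain a t where a: "p = arc_point a t" "a < m" "0 \<le> t" "t \<le> 1" "\<bar>t * real N - real i\<bar> < 1" "a = s \<or> i = 0 \<or> i = N"
    using p unfolding star_def by blast
  obtain b u where b: "q = arc_point b u" "b < m" "0 \<le> u" "u \<le> 1" "\<bar>u * real N - real i\<bar> < 1" "b = s \<or> i = 0 \<or> i = N"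
    using q unfolding star_def by blast
  have "\<bar>t - u\<bar> * real N = \<bar>t * real N - u * real N\<bar>"
    by (simp add: left_diff_distrib[symmetric] abs_mult)
  also have "\<dots> < 2" using a(5) b(5) by linarith
  finally have tu: "\<bar>t - u\<bar> \<le> 2 / real N"
    using N by (simp add: field_simps)
  have y: "\<bar>real a * (t * (1 - t)) - real b * (u * (1 - u))\<bar> \<le> real m * (2 / real N)"
  proof (cases "i = 0 \<or> i = N")
    case True
    have small: "0 \<le> v * (1 - v) \<and> v * (1 - v) \<le> 1 / real N"
      if v: "0 \<le> v" "v \<le> 1" "\<bar>v * real N - real i\<bar> < 1" for v
    proof -
      consider "v * real N < 1" | "(1 - v) * real N < 1"
        using True v(3) by (auto simp: algebra_simps)
      then have "v \<le> 1 / real N \<or> 1 - v \<le> 1 / real N"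
        using N by cases (auto simp: field_simps)
      moreover have "v * (1 - v) \<le> v" "v * (1 - v) \<le> 1 - v"
        using v by (simp_all add: mult_left_le mult_left_le_one_le)
      ultimately show ?thesis using v by auto
    qed
    have bnd: "0 \<le> real c * w" "real c * w \<le> real m * (1 / real N)" if "c < m" "0 \<le> w" "w \<le> 1 / real N" for c w
      using that mult_mono[of "real c" "real m" w "1 / real N"] by simp_all
    have "0 \<le> real a * (t * (1 - t))" "real a * (t * (1 - t)) \<le> real m * (1 / real N)"
      using small[OF a(3-5)] a(2) by (intro bnd; simp)+
    moreover have "0 \<le> real b * (u * (1 - u))" "real b * (u * (1 - u)) \<le> real m * (1 / real N)"
      using small[OF b(3-5)] b(2) by (intro bnd; simp)+
    moreover have "real m * (1 / real N) \<le> real m * (2 / real N)"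
      by (intro mult_left_mono divide_right_mono) auto
    ultimately show ?thesis unfolding abs_le_iff by linarith
  next
    case False
    then have "a = b" using a(6) b(6) by simp
    then have "real a * (t * (1 - t)) - real b * (u * (1 - u)) = real a * ((t - u) * (1 - t - u))"
      by (simp add: algebra_simps)
    moreover have "\<bar>real a * ((t - u) * (1 - t - u))\<bar> \<le> real m * (2 / real N * 1)"
      unfolding abs_mult using a b tu by (intro mult_mono) auto
    ultimately show ?thesis by simp
  qed
  have "dist p q \<le> \<bar>t - u\<bar> + \<bar>real a * (t * (1 - t)) - real b * (u * (1 - u))\<bar>"
    unfolding a(1) b(1) arc_point_def dist_Pair_Pair dist_real_def by (rule order_trans[OF sqrt_sum_squares_le_sum_abs]) simp
  also have "\<dots> \<le> 2 / real N + real m * (2 / real N)"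
    using tu y by linarith
  also have "\<dots> = (2 + 2 * real m) / real N"
    by (simp add: add_divide_distrib)
  finally show ?thesis .
qed

text \<open>
  By a Lebesgue number of the cover: in the product metric, finitely many coordinates decide about
  closeness, and all coordinates up to \<open>n\<close> are controlled by a fine grid at stage \<open>n\<close>.
\<close>

lemma star_covers_cofinal:
  assumes U: "\<U> \<in> open_covers (top_of_set limit)"
  obtains n N where "N > 0" "\<And>s i. s < m \<Longrightarrow> i \<le> N \<Longrightarrow> \<exists>A\<in>\<U>. cell n N s i \<subseteq> A"
proof -
  define \<C> where "\<C> = {B. open B \<and> limit \<inter> B \<in> \<U>}"
  have A: "\<exists>B\<in>\<C>. A = limit \<inter> B" if "A \<in> \<U>" for A
    using U that by (auto simp: open_covers_def openin_open \<C>_def)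
  obtain x where "x \<in> limit"
    using limit_point_exists[of "arc_point 0 0"] graphI[of 0 0] m by auto
  have cov: "limit \<subseteq> \<Union>\<C>"
  proof
    fix y assume "y \<in> limit"
    then have "y \<in> \<Union>\<U>" using U by (simp add: open_covers_def)
    then show "y \<in> \<Union>\<C>" using A by blast
  qed
  then have ne: "\<C> \<noteq> {}" using \<open>x \<in> limit\<close> by blast
  obtain \<delta> where \<delta>: "0 < \<delta>" "\<And>T. \<lbrakk>T \<subseteq> limit; diameter T < \<delta>\<rbrakk> \<Longrightarrow> \<exists>B \<in> \<C>. T \<subseteq> B"
    by (rule Lebesgue_number_lemma[OF compact_limit ne cov]) (auto simp: \<C>_def)
  obtain k where k: "(1 / 2 :: real) ^ k < \<delta> / 4"
    using real_arch_pow_inv[of "\<delta> / 4" "1 / 2"] \<delta>(1) by auto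
  obtain N where N: "real N > (2 + 2 * real m) / (\<delta> / 8)"
    using reals_Archimedean2 by blast
  have Npos: "N > 0"
  proof -
    have "0 < (2 + 2 * real m) / (\<delta> / 8)" using \<delta>(1) by (intro divide_pos_pos) auto
    then show ?thesis using N by linarith
  qed
  have small: "(2 + 2 * real m) / real N < \<delta> / 8"
    using N Npos \<delta>(1) by (simp add: field_simps)
  define n where "n = Max ((from_nat :: nat \<Rightarrow> nat) ` {..k})"
  have n: "from_nat a \<le> n" if "a \<le> k" for a
    unfolding n_def using that by (intro Max_ge) auto
  let ?N = "N * laps ^ n"
  show thesis
  proof (rule that[of ?N n])
    show "?N > 0" using Npos laps_pos by simp
    fix s i assume s: "s < m" and i: "i \<le> ?N"
    have coord: "dist (x c) (y c) \<le> \<delta> / 8" if c: "c \<le> n" and x: "x \<in> cell n ?N s i" and y: "y \<in> cell n ?N s i" for x y c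
    proof -
      have nc: "n - (n - c) = c" using c by simp
      obtain s' i' where s': "s' < m" "i' \<le> N * laps ^ c" "cell n ?N s i \<subseteq> cell c (N * laps ^ c) s' i'"
        using cell_refine_lower[OF s i Npos, of "n - c"] unfolding nc by auto
      then have "x c \<in> star (N * laps ^ c) s' i'" "y c \<in> star (N * laps ^ c) s' i'"
        using x y unfolding cell_def by auto
      then have "dist (x c) (y c) \<le> (2 + 2 * real m) / real (N * laps ^ c)"
        using Npos laps_pos by (intro star_diameter[OF _ _ _ s'(2)]) auto
      also have "\<dots> \<le> (2 + 2 * real m) / real N"
      proof (intro divide_left_mono)
        show "real N \<le> real (N * laps ^ c)" using laps_pos by (intro of_nat_mono) simp
      qed (use Npos laps_pos in auto)
      finally show ?thesis using small by linarith
    qed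
    have dist: "dist x y \<le> \<delta> / 2" if x: "x \<in> cell n ?N s i" and y: "y \<in> cell n ?N s i" for x y
    proof -
      have "Max {dist (x (from_nat a)) (y (from_nat a)) | a. a \<le> k} \<le> \<delta> / 8"
      proof (rule Max.boundedI)
        have "{dist (x (from_nat a)) (y (from_nat a)) | a. a \<le> k} = (\<lambda>a. dist (x (from_nat a)) (y (from_nat a))) ` {..k}"
          by auto
        then show "finite {dist (x (from_nat a)) (y (from_nat a)) | a. a \<le> k}" by simp
        show "{dist (x (from_nat a)) (y (from_nat a)) | a. a \<le> k} \<noteq> {}" by blast
        fix d assume "d \<in> {dist (x (from_nat a)) (y (from_nat a)) | a. a \<le> k}"
        then obtain a where "a \<le> k" "d = dist (x (from_nat a)) (y (from_nat a))" by blast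
        then show "d \<le> \<delta> / 8" using coord[OF n x y] by simp
      qed
      then show ?thesis
        using dist_fun_le_dist_first_terms[of x y k] k by linarith
    qed
    have "diameter (cell n ?N s i) \<le> \<delta> / 2"
    proof (cases "cell n ?N s i = {}")
      case True
      then show ?thesis using \<delta>(1) by (simp add: diameter_def)
    next
      case False
      then have "diameter (cell n ?N s i) = (SUP (x, y)\<in>cell n ?N s i \<times> cell n ?N s i. dist x y)"
        by (simp add: diameter_def)
      also have "\<dots> \<le> \<delta> / 2"
      proof (rule cSUP_least)
        show "cell n ?N s i \<times> cell n ?N s i \<noteq> {}" using False by simp
        fix xy assume "xy \<in> cell n ?N s i \<times> cell n ?N s i"
        then show "(case xy of (x, y) \<Rightarrow> dist x y) \<le> \<delta> / 2"
          by (elim SigmaE) (simp only: prod.case dist)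
      qed
      finally show ?thesis .
    qed
    then have "diameter (cell n ?N s i) < \<delta>" using \<delta>(1) by linarith
    from \<delta>(2)[OF cell_subset this] obtain B where B: "B \<in> \<C>" "cell n ?N s i \<subseteq> B"
      by (elim bexE)
    show "\<exists>A\<in>\<U>. cell n ?N s i \<subseteq> A"
    proof (rule bexI[of _ "limit \<inter> B"])
      show "cell n ?N s i \<subseteq> limit \<inter> B"
        using B(2) cell_subset by (rule Int_greatest[rotated])
      show "limit \<inter> B \<in> \<U>" using B(1) by (simp add: \<C>_def)
    qed
  qed
qed

end

section \<open>Cohomology of the limit\<close>

lemma sum_odd_split:
  fixes c :: "nat \<Rightarrow> int"
  shows "(\<Sum>l<2 * k + 1. c l) = (\<Sum>j<k + 1. c (2 * j)) + (\<Sum>j<k. c (2 * j + 1))"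
  by (induction k) simp_all

lemma sum_double_mod:
  fixes c :: "nat \<Rightarrow> int"
  shows "(\<Sum>j<2 * k. c (j mod k)) = 2 * (\<Sum>j<k. c j)"
proof -
  have "(\<Sum>j<k + i. c (j mod k)) = (\<Sum>j<k. c j) + (\<Sum>j<i. c j)" if "i \<le> k" for i
    using that by (induction i) simp_all
  from this[of k, OF order_refl] show ?thesis by (simp only: mult_2)
qed

lemma sum_blocks:
  fixes c :: "nat \<Rightarrow> int"
  shows "(\<Sum>j<l * N. c j) = (\<Sum>k<l. \<Sum>i<N. c (k * N + i))"
proof (induction l)
  case (Suc l)
  have "(\<Sum>j<l * N + i. c j) = (\<Sum>j<l * N. c j) + (\<Sum>j<i. c (l * N + j))" for i
    by (induction i) simp_all
  from this[of N] Suc show ?case by (simp add: add.commute)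
qed simp

lemma integer_mod_group_mod: "x \<in> carrier (integer_mod_group p) \<Longrightarrow> x mod int p = x"
  by (auto simp: carrier_integer_mod_group split: if_splits)

lemma cobd_integer_mod_group_pair:
  assumes "f [a] \<in> carrier (integer_mod_group p)" "f [b] \<in> carrier (integer_mod_group p)"
  shows "cobd (integer_mod_group p) f [a, b] = (f [b] - f [a]) mod int p"
proof -
  interpret comm_group "integer_mod_group p" by simp
  have 1: "cobd (integer_mod_group p) (\<lambda>\<tau>. f (a # \<tau>)) [b] = f [a]"
    using assms cobd_Cons[of "\<lambda>\<tau>. f (a # \<tau>)" "[]" b] by (simp add: integer_mod_group_mod)
  have "cobd (integer_mod_group p) f [a, b] = f [b] \<otimes>\<^bsub>integer_mod_group p\<^esub> inv\<^bsub>integer_mod_group p\<^esub> f [a]"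
    using assms cobd_Cons[of f "[b]" a] 1 by (simp add: less_Suc_eq)
  also have "\<dots> = (f [b] - f [a]) mod int p"
    using assms by (simp add: mod_add_right_eq)
  finally show ?thesis .
qed

lemma cobd_integer_mod_group_triple:
  assumes "f [a, b] \<in> carrier (integer_mod_group p)" "f [a, c] \<in> carrier (integer_mod_group p)"
    "f [b, c] \<in> carrier (integer_mod_group p)"
  shows "cobd (integer_mod_group p) f [a, b, c] = (f [b, c] - (f [a, c] - f [a, b])) mod int p"
proof -
  interpret comm_group "integer_mod_group p" by simp
  let ?x = "(f [a, c] - f [a, b]) mod int p"
  have 1: "cobd (integer_mod_group p) (\<lambda>\<tau>. f (a # \<tau>)) [b, c] = ?x"
    using assms cobd_integer_mod_group_pair[of "\<lambda>\<tau>. f (a # \<tau>)" b p c] by simp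
  have "?x \<in> carrier (integer_mod_group p)"
    unfolding 1[symmetric] by (rule cobd_closed) (use assms in \<open>auto simp: less_Suc_eq\<close>)
  moreover have "f (a # list_face i [b, c]) \<in> carrier (integer_mod_group p)" if "i < length [b, c]" for i
    using that assms by (auto simp: less_Suc_eq)
  then have "cobd (integer_mod_group p) f [a, b, c] =
      f [b, c] \<otimes>\<^bsub>integer_mod_group p\<^esub> inv\<^bsub>integer_mod_group p\<^esub> ?x"
    unfolding 1[symmetric] by (rule cobd_Cons[of f "[b, c]" a, OF assms(3)])
  ultimately have "cobd (integer_mod_group p) f [a, b, c] = (f [b, c] + (- ?x) mod int p) mod int p"
    by simp
  also have "\<dots> = (f [b, c] - (f [a, c] - f [a, b])) mod int p"
    by (simp add: mod_add_right_eq mod_minus_eq mod_diff_right_eq algebra_simps)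
  finally show ?thesis .
qed

text \<open>
  The cocycle condition on \<open>[a, a, a]\<close> and \<open>[a, b, a]\<close>. Congruences of integers are used in place of the
  group operation, so that sums of values can be rearranged freely.
\<close>

lemma cocycle_1_relations:
  assumes z: "z \<in> cocycles (nerve \<U>) (integer_mod_group p) (Suc 0)"
  shows "\<And>a b x. a \<in> \<U> \<Longrightarrow> b \<in> \<U> \<Longrightarrow> x \<in> a \<Longrightarrow> x \<in> b \<Longrightarrow> z [a, b] \<in> carrier (integer_mod_group p)"
    and "\<And>a x. a \<in> \<U> \<Longrightarrow> x \<in> a \<Longrightarrow> [z [a, a] = 0] (mod int p)"
    and "\<And>a b x. a \<in> \<U> \<Longrightarrow> b \<in> \<U> \<Longrightarrow> x \<in> a \<Longrightarrow> x \<in> b \<Longrightarrow> [z [b, a] = - z [a, b]] (mod int p)"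
proof -
  interpret simplicial_cohomology "integer_mod_group p" "nerve \<U>"
    by (intro simplicial_cohomology.intro simplicial_cohomology_axioms.intro abstract_complex_nerve) simp
  have zc: "z \<in> (\<Pi>\<^sub>E \<sigma>\<in>ordered_simplices (nerve \<U>) (Suc 0). carrier (integer_mod_group p))"
    and cobd: "\<And>\<sigma>. \<sigma> \<in> ordered_simplices (nerve \<U>) (Suc (Suc 0)) \<Longrightarrow> cobd (integer_mod_group p) z \<sigma> = 0"
    using z by (simp_all add: mem_cocycles_iff carrier_cochain_group)
  show c: "z [a, b] \<in> carrier (integer_mod_group p)" if "a \<in> \<U>" "b \<in> \<U>" "x \<in> a" "x \<in> b" for a b x
  proof (rule PiE_mem[OF zc])
    show "[a, b] \<in> ordered_simplices (nerve \<U>) (Suc 0)"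
      using that by (auto simp: ordered_simplices_def mem_nerve_iff)
  qed
  have rel: "[z [b, d] - (z [a, d] - z [a, b]) = 0] (mod int p)"
    if "a \<in> \<U>" "b \<in> \<U>" "d \<in> \<U>" "x \<in> a" "x \<in> b" "x \<in> d" for a b d x
  proof -
    have "[a, b, d] \<in> ordered_simplices (nerve \<U>) (Suc (Suc 0))"
      using that by (auto simp: ordered_simplices_def mem_nerve_iff)
    from cobd[OF this] cobd_integer_mod_group_triple[of z a b p d] c that
    show ?thesis by (simp add: cong_def)
  qed
  show zero: "[z [a, a] = 0] (mod int p)" if "a \<in> \<U>" "x \<in> a" for a x
    using rel[of a a a x] that by simp
  show "[z [b, a] = - z [a, b]] (mod int p)" if ab: "a \<in> \<U>" "b \<in> \<U>" "x \<in> a" "x \<in> b" for a b x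
  proof -
    have "[z [b, a] - (z [a, a] - z [a, b]) + z [a, a] = 0 + 0] (mod int p)"
      using ab by (intro cong_add rel zero)
    then have "[z [b, a] + z [a, b] = 0] (mod int p)" by simp
    then have "[z [b, a] + z [a, b] - z [a, b] = 0 - z [a, b]] (mod int p)"
      by (intro cong_diff cong_refl)
    then show ?thesis by simp
  qed
qed

context zigzag
begin

text \<open>
  Neighbouring sets of a cover by stars intersect, so they all lie on the same side of a partition.
\<close>

lemma connected_limit: "connected_space (top_of_set limit)"
  unfolding connected_space_def
proof (rule notI, elim exE conjE)
  fix E1 E2
  assume E: "openin (top_of_set limit) E1" "openin (top_of_set limit) E2"
    "topspace (top_of_set limit) \<subseteq> E1 \<union> E2" "E1 \<inter> E2 = {}" "E1 \<noteq> {}" "E2 \<noteq> {}"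
  have sub: "E1 \<subseteq> limit" "E2 \<subseteq> limit"
    using E(1,2) openin_subset by force+
  have "{E1, E2} \<in> open_covers (top_of_set limit)"
    using E(1-3) sub unfolding open_covers_def by auto
  then obtain n N where N: "N > 0"
    and ref: "\<And>s i. s < m \<Longrightarrow> i \<le> N \<Longrightarrow> \<exists>A\<in>{E1, E2}. cell n N s i \<subseteq> A"
    by (rule star_covers_cofinal) blast
  obtain E where EE: "E \<in> {E1, E2}" "cell n N 0 0 \<subseteq> E"
    using ref[of 0 0] m by auto
  have "cell n N s i \<subseteq> E" if s: "s < m" and "i \<le> N" for s i
    using that(2)
  proof (induction i)
    case 0
    then show ?case using EE(2) cell_pole[of 0 N n s 0] by simp
  next
    case (Suc i)
    define t where "t = (real i + 1 / 2) / real N"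
    have t: "t * real N = real i + 1 / 2" "0 \<le> t" "t \<le> 1"
      using N Suc.prems by (simp_all add: t_def divide_simps)
    obtain x where x: "x \<in> limit" "x n = arc_point s t"
      using limit_point_exists[OF graphI[OF s t(2,3)]] by blast
    have "arc_point s t \<in> star N s i" "arc_point s t \<in> star N s (Suc i)"
      using s t by (auto intro!: starI)
    then have "x \<in> cell n N s i" "x \<in> cell n N s (Suc i)"
      using x by (simp_all add: cell_def)
    moreover obtain A where "A \<in> {E1, E2}" "cell n N s (Suc i) \<subseteq> A"
      using ref[OF s Suc.prems] by blast
    moreover have "cell n N s i \<subseteq> E"
      using Suc by simp
    ultimately have "A = E" using EE(1) E(4) by blast
    then show ?case using \<open>cell n N s (Suc i) \<subseteq> A\<close> by simp
  qed
  then have "\<Union>(star_cover n N) \<subseteq> E"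
    unfolding star_cover_def by blast
  then have "limit \<subseteq> E"
    using star_cover_open_cover[of n N] by (simp add: open_covers_def)
  then show False
    using EE(1) E(4-6) sub by blast
qed

lemma covering_dim_limit: "covering_dim_le (top_of_set limit) 1"
  unfolding covering_dim_le_def
proof
  fix \<U> assume "\<U> \<in> open_covers (top_of_set limit)"
  then obtain n N where "\<And>s i. s < m \<Longrightarrow> i \<le> N \<Longrightarrow> \<exists>A\<in>\<U>. cell n N s i \<subseteq> A"
    by (rule star_covers_cofinal) blast
  then have "\<forall>V\<in>star_cover n N. \<exists>A\<in>\<U>. V \<subseteq> A"
    unfolding star_cover_def by blast
  moreover have "\<forall>S\<in>nerve (star_cover n N). card S \<le> Suc 1"
    using star_cover_nerve by (simp add: numeral_2_eq_2)
  ultimately show "\<exists>\<V>\<in>open_covers (top_of_set limit). (\<forall>V\<in>\<V>. \<exists>U\<in>\<U>. V \<subseteq> U) \<and> (\<forall>S\<in>nerve \<V>. card S \<le> Suc 1)"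
    using star_cover_open_cover by blast
qed

lemma higher_cocycles_vanish:
  assumes A: "comm_group A" and U: "\<U> \<in> open_covers (top_of_set limit)"
    and z: "z \<in> cocycles (nerve \<U>) A (Suc (Suc k))"
  shows "\<exists>\<V> \<pi>. \<V> \<in> open_covers (top_of_set limit) \<and> refinement_projection \<V> \<U> \<pi> \<and>
        pullback_cochain (nerve \<V>) (Suc (Suc k)) \<pi> z \<in> coboundaries (nerve \<V>) A (Suc (Suc k))"
proof -
  obtain n N where ref: "\<And>s i. s < m \<Longrightarrow> i \<le> N \<Longrightarrow> \<exists>A\<in>\<U>. cell n N s i \<subseteq> A"
    using U by (rule star_covers_cofinal) blast
  let ?V = "star_cover n N"
  define \<pi> where "\<pi> = (\<lambda>V. SOME A. A \<in> \<U> \<and> V \<subseteq> A)"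
  have \<pi>: "refinement_projection ?V \<U> \<pi>"
    unfolding refinement_projection_def
  proof
    fix V assume "V \<in> ?V"
    then have "\<exists>A. A \<in> \<U> \<and> V \<subseteq> A"
      using ref unfolding star_cover_def by blast
    from someI_ex[OF this] show "\<pi> V \<in> \<U> \<and> V \<subseteq> \<pi> V" by (simp add: \<pi>_def)
  qed
  have sc: "simplicial_cohomology A (nerve \<W>)" for \<W> :: "(nat \<Rightarrow> real \<times> real) set set"
    by (intro simplicial_cohomology.intro simplicial_cohomology_axioms.intro abstract_complex_nerve A)
  have "simplicial_map_cohomology A (nerve ?V) (nerve \<U>) \<pi>"
    by (intro simplicial_map_cohomology.intro simplicial_map_cohomology_axioms.intro sc refinement_simplicial \<pi>)
  then have "pullback_cochain (nerve ?V) (Suc (Suc k)) \<pi> z \<in> cocycles (nerve ?V) A (Suc (Suc k))"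
    using z by (rule simplicial_map_cohomology.pullback_cocycle)
  then have "pullback_cochain (nerve ?V) (Suc (Suc k)) \<pi> z \<in> coboundaries (nerve ?V) A (Suc (Suc k))"
    by (rule simplicial_cohomology.graph_cocycle_is_coboundary[OF sc star_cover_nerve, rotated])
  with \<pi> star_cover_open_cover show ?thesis by (intro exI conjI)
qed

text \<open>
  The heart of the construction. Refine the cover by stars at stage \<open>n\<close>, and let \<open>h s\<close> be the sum of the
  cocycle along the arc \<open>s\<close>. One stage later, the sum along the arc \<open>s\<close> is the sum along its zigzag
  path: the upward laps contribute \<open>2\<close> times the sum of all values of \<open>h\<close>, and the downward laps
  contribute \<open>- (2 m - 1) h s\<close>, which vanishes modulo \<open>p\<close>. So all arcs have the same sum \<open>H\<close>, and the
  partial sums from the lower pole define a potential \<open>g\<close> that is consistent at the upper pole.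
\<close>

lemma first_cocycles_vanish:
  assumes p: "int p dvd 2 * int m - 1" and U: "\<U> \<in> open_covers (top_of_set limit)"
    and z: "z \<in> cocycles (nerve \<U>) (integer_mod_group p) (Suc 0)"
  shows "\<exists>\<V> \<pi>. \<V> \<in> open_covers (top_of_set limit) \<and> refinement_projection \<V> \<U> \<pi> \<and>
        pullback_cochain (nerve \<V>) (Suc 0) \<pi> z \<in> coboundaries (nerve \<V>) (integer_mod_group p) (Suc 0)"
proof -
  obtain n N where N: "N > 0" and ref: "\<And>s i. s < m \<Longrightarrow> i \<le> N \<Longrightarrow> \<exists>A\<in>\<U>. cell n N s i \<subseteq> A"
    using U by (rule star_covers_cofinal) blast
  note z_rel = cocycle_1_relations[OF z]
  define up where "up = (\<lambda>V. SOME A. A \<in> \<U> \<and> V \<subseteq> A)"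
  define A where "A = (\<lambda>s i. up (cell n N s i))"
  have A: "A s i \<in> \<U>" "cell n N s i \<subseteq> A s i" if "s < m" "i \<le> N" for s i
  proof -
    have "\<exists>A. A \<in> \<U> \<and> cell n N s i \<subseteq> A" using ref[OF that] by blast
    from someI_ex[OF this] show "A s i \<in> \<U>" "cell n N s i \<subseteq> A s i" by (simp_all add: A_def up_def)
  qed
  have A_pole: "A s i = A s' i" if "i = 0 \<or> i = N" for s s' i
    unfolding A_def by (rule arg_cong[OF cell_pole[OF that]])
  define e where "e = (\<lambda>s i. z [A s i, A s (Suc i)])"
  have e_rev: "[z [A s (Suc i), A s i] = - e s i] (mod int p)" if s: "s < m" and i: "i < N" for s i
  proof -
    define t where "t = (real i + 1 / 2) / real N"
    have t: "t * real N = real i + 1 / 2" "0 \<le> t" "t \<le> 1"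
      using N i by (simp_all add: t_def divide_simps)
    obtain x where x: "x \<in> limit" "x n = arc_point s t"
      using limit_point_exists[OF graphI[OF s t(2,3)]] by blast
    have "arc_point s t \<in> star N s i" "arc_point s t \<in> star N s (Suc i)"
      using s t by (auto intro!: starI)
    then have "x \<in> cell n N s i" "x \<in> cell n N s (Suc i)"
      using x by (simp_all add: cell_def)
    moreover have "cell n N s i \<subseteq> A s i" "cell n N s (Suc i) \<subseteq> A s (Suc i)"
      using i by (intro A(2)[OF s]; simp)+
    ultimately have "x \<in> A s i" "x \<in> A s (Suc i)"
      by blast+
    then show ?thesis
      unfolding e_def using z_rel(3) A(1)[OF s] i by simp
  qed
  define h where "h = (\<lambda>s. \<Sum>i<N. e s i)"
  define H where "H = 2 * (\<Sum>s<m. h s)"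
  \<comment> \<open>The grid point \<open>j\<close> of the finer grid lies on lap \<open>lap j\<close>, and \<open>B s j\<close> is the member of the cover chosen for its image.\<close>
  define lap where "lap = (\<lambda>j. min (j div N) (laps - 1))"
  define B where "B = (\<lambda>s j. A (lap_arc s (lap j)) (lap_grid N (lap j) (j - lap j * N)))"
  have lap_eq: "lap (l * N + i) = (if i < N then l else min (Suc l) (laps - 1))" if "l < laps" "i \<le> N" for l i
    using that N by (auto simp: lap_def)
  have B_lap: "B s (l * N + i) = A (lap_arc s l) (lap_grid N l i)" if "l < laps" "i \<le> N" for s l i
  proof (cases "i < N \<or> l = laps - 1")
    case True
    then have "lap (l * N + i) = l" using lap_eq[OF that] that by auto
    then show ?thesis by (simp add: B_def)
  next
    case False
    then have i: "i = N" and l: "Suc l < laps" using that by auto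
    then have lp: "lap (l * N + i) = Suc l" using lap_eq[OF that] by simp
    \<comment> \<open>At the end of a lap the path is at a pole, where the choice of the arc does not matter.\<close>
    have "B s (l * N + i) = A (lap_arc s (Suc l)) (lap_grid N (Suc l) 0)"
      unfolding B_def lp by (simp add: i)
    also have "lap_grid N (Suc l) 0 = lap_grid N l N" by (simp add: lap_grid_def)
    also have "A (lap_arc s (Suc l)) (lap_grid N l N) = A (lap_arc s l) (lap_grid N l N)"
      by (rule A_pole) (simp add: lap_grid_def)
    finally show ?thesis using i by simp
  qed
  define e' where "e' = (\<lambda>s j. z [B s j, B s (Suc j)])"
  have e'_lap: "[(\<Sum>i<N. e' s (l * N + i)) = (if even l then h (lap_arc s l) else - h (lap_arc s l))] (mod int p)"
    if s: "s < m" and l: "l < laps" for s l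
  proof (cases "even l")
    case True
    have "e' s (l * N + i) = e (lap_arc s l) i" if "i < N" for i
      using B_lap[OF l, of i s] B_lap[OF l, of "Suc i" s] that True by (simp add: e'_def e_def lap_grid_def)
    then show ?thesis using True by (simp add: h_def)
  next
    case False
    have "[e' s (l * N + i) = - e (lap_arc s l) (N - Suc i)] (mod int p)" if i: "i < N" for i
    proof -
      have "e' s (l * N + i) = z [A (lap_arc s l) (Suc (N - Suc i)), A (lap_arc s l) (N - Suc i)]"
        using B_lap[OF l, of i s] B_lap[OF l, of "Suc i" s] i False by (simp add: e'_def lap_grid_def Suc_diff_Suc)
      then show ?thesis
        using e_rev[OF lap_arc_less[OF s], of "N - Suc i" l] i by simp
    qed
    then have "[(\<Sum>i<N. e' s (l * N + i)) = (\<Sum>i<N. - e (lap_arc s l) (N - Suc i))] (mod int p)"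
      by (intro cong_sum) simp
    also have "(\<Sum>i<N. - e (lap_arc s l) (N - Suc i)) = - h (lap_arc s l)"
      unfolding h_def sum_negf using sum.nat_diff_reindex[of "e (lap_arc s l)" N] by simp
    finally show ?thesis using False by simp
  qed
  define g where "g = (\<lambda>s j. \<Sum>i<j. e' s i)"
  have g_top: "[g s (laps * N) = H] (mod int p)" if s: "s < m" for s
  proof -
    let ?c = "\<lambda>l. if even l then h (lap_arc s l) else - h (lap_arc s l)"
    have "[g s (laps * N) = (\<Sum>l<laps. ?c l)] (mod int p)"
      unfolding g_def sum_blocks by (intro cong_sum e'_lap[OF s]) simp
    also have "(\<Sum>l<laps. ?c l) = (\<Sum>j<2 * m. h (r (j mod m) s)) - (2 * int m - 1) * h s"
    proof -
      define k where "k = 2 * m - 1"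
      have k: "k + 1 = 2 * m" "int k = 2 * int m - 1" and laps: "laps = 2 * k + 1"
        using m by (simp_all add: k_def laps_def of_nat_diff)
      show ?thesis
        unfolding laps sum_odd_split k(1) k(2)[symmetric] by (simp add: lap_arc_def)
    qed
    also have "(\<Sum>j<2 * m. h (r (j mod m) s)) = H"
    proof -
      have "(\<Sum>j<m. h (r j s)) = (\<Sum>s<m. h s)"
        using sum.reindex_bij_betw[OF r_bij[OF s], of h] by simp
      then show ?thesis
        unfolding H_def using sum_double_mod[of "\<lambda>j. h (r j s)" m] by simp
    qed
    also have "[H - (2 * int m - 1) * h s = H - 0] (mod int p)"
      using p by (intro cong_diff cong_refl) (simp add: cong_0_iff)
    finally show ?thesis by simp
  qed
  let ?V = "star_cover (Suc n) (laps * N)"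
  have "\<exists>sj. V = cell (Suc n) (laps * N) (fst sj) (snd sj) \<and> fst sj < m \<and> snd sj \<le> laps * N" if "V \<in> ?V" for V
    using that unfolding star_cover_def by auto
  \<comment> \<open>Different labels may describe the same set; the cochain and the projection use one chosen label.\<close>
  then obtain c where c: "\<And>V. V \<in> ?V \<Longrightarrow> V = cell (Suc n) (laps * N) (fst (c V)) (snd (c V))"
    "\<And>V. V \<in> ?V \<Longrightarrow> fst (c V) < m" "\<And>V. V \<in> ?V \<Longrightarrow> snd (c V) \<le> laps * N"
    by metis
  have cell_B: "cell (Suc n) (laps * N) s j \<subseteq> B s j \<and> B s j \<in> \<U>" if s: "s < m" and j: "j \<le> laps * N" for s j
  proof -
    obtain l i where *: "j = l * N + i" "l < laps" "i \<le> N" "i < N \<or> l = laps - 1"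
      by (rule grid_decompose[OF j N])
    have "cell (Suc n) (laps * N) s (l * N + i) \<subseteq> A (lap_arc s l) (lap_grid N l i)"
      by (rule subset_trans[OF cell_refine[OF s *(2-4) N] A(2)[OF lap_arc_less[OF s] lap_grid_le[OF *(3)]]])
    then show ?thesis
      using A(1)[OF lap_arc_less[OF s] lap_grid_le[OF *(3)]] unfolding *(1) B_lap[OF *(2,3)] by (intro conjI)
  qed
  \<comment> \<open>At the poles neither the chosen member of the cover nor the potential depends on the arc; at the upper pole this is where \<open>p\<close> enters.\<close>
  have pole: "B s j = B s' j \<and> [g s j = g s' j] (mod int p)"
    if "s < m" "s' < m" "j = 0 \<or> j = laps * N" for s s' j
  proof (cases "j = 0")
    case True
    have "B s j = B s' j"
      using B_lap[OF laps_pos, of 0 s] B_lap[OF laps_pos, of 0 s'] A_pole[of 0 "lap_arc s 0" "lap_arc s' 0"]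
      by (simp add: True lap_grid_def)
    then show ?thesis by (simp add: g_def True)
  next
    case False
    then have j: "j = laps * N" using that by simp
    have j': "j = (laps - 1) * N + N" using laps_pos by (simp add: j algebra_simps)
    have "lap_grid N (laps - 1) N = N" using laps_odd by (simp add: lap_grid_def)
    then have "B s j = B s' j"
      using B_lap[of "laps - 1" N s] B_lap[of "laps - 1" N s'] laps_pos A_pole[of N "lap_arc s (laps - 1)" "lap_arc s' (laps - 1)"]
      by (simp add: j')
    moreover have "[g s j = g s' j] (mod int p)"
      using g_top[OF that(1)] g_top[OF that(2)] unfolding j by (metis cong_sym cong_trans)
    ultimately show ?thesis by simp
  qed
  define \<pi> where "\<pi> = (\<lambda>V. B (fst (c V)) (snd (c V)))"
  define G where "G = (\<lambda>V. g (fst (c V)) (snd (c V)) mod int p)"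
  have \<pi>: "refinement_projection ?V \<U> \<pi>"
    unfolding refinement_projection_def
  proof
    fix V assume V: "V \<in> ?V"
    show "\<pi> V \<in> \<U> \<and> V \<subseteq> \<pi> V"
      using cell_B[OF c(2,3)[OF V]] c(1)[OF V] unfolding \<pi>_def by auto
  qed
  have key: "[z [\<pi> V, \<pi> W] = G W - G V] (mod int p)" if V: "V \<in> ?V" and W: "W \<in> ?V" and x: "x \<in> V" "x \<in> W" for V W x
  proof -
    have "x \<in> limit"
      using x(1) c(1)[OF V] cell_subset by blast
    then obtain s t where st: "s < m" "0 \<le> t" "t \<le> 1" "x (Suc n) = arc_point s t"
      using graphE[OF limit_graph[of x "Suc n"]] by metis
    have loc: "\<pi> V' = B s (snd (c V')) \<and> [G V' = g s (snd (c V'))] (mod int p) \<and>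
        \<bar>t * real (laps * N) - real (snd (c V'))\<bar> < 1" if V': "V' \<in> ?V" "x \<in> V'" for V'
    proof -
      have xc: "x \<in> cell (Suc n) (laps * N) (fst (c V')) (snd (c V'))"
        using V'(2) c(1)[OF V'(1)] by (rule subst[rotated])
      note cp = cell_common_point[OF xc c(3)[OF V'(1)] st(4)]
      from cp(3) have "B (fst (c V')) (snd (c V')) = B s (snd (c V')) \<and>
          [g (fst (c V')) (snd (c V')) = g s (snd (c V'))] (mod int p)"
        using pole[OF c(2)[OF V'(1)] st(1)] by auto
      with cp(2) show ?thesis
        by (simp add: \<pi>_def G_def cong_def)
    qed
    let ?j = "snd (c V)" and ?k = "snd (c W)"
    note lV = loc[OF V x(1)] and lW = loc[OF W x(2)]
    have B: "B s ?j \<in> \<U>" "B s ?k \<in> \<U>" "x \<in> B s ?j" "x \<in> B s ?k"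
      using \<pi> V W x lV lW unfolding refinement_projection_def by auto
    have "[z [B s ?j, B s ?k] = g s ?k - g s ?j] (mod int p)"
    proof -
      consider "?k = ?j" | "?k = Suc ?j" | "?j = Suc ?k"
        using lV lW by linarith
      then show ?thesis
      proof cases
        case 1
        then show ?thesis using z_rel(2)[OF B(1,3)] by simp
      next
        case 2
        have "z [B s ?j, B s (Suc ?j)] = g s (Suc ?j) - g s ?j"
          by (simp add: g_def e'_def)
        then show ?thesis unfolding 2 by simp
      next
        case 3
        have "z [B s ?k, B s (Suc ?k)] = g s (Suc ?k) - g s ?k"
          by (simp add: g_def e'_def)
        moreover have "[z [B s ?j, B s ?k] = - z [B s ?k, B s ?j]] (mod int p)"
          by (rule z_rel(3)[OF B(2,1,4,3)])
        ultimately show ?thesis unfolding 3 by simp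
      qed
    qed
    moreover have "[G W - G V = g s ?k - g s ?j] (mod int p)"
      using lV lW by (intro cong_diff) auto
    ultimately show ?thesis
      using lV lW by (metis cong_sym cong_trans)
  qed
  interpret sc: simplicial_cohomology "integer_mod_group p" "nerve ?V"
    by (intro simplicial_cohomology.intro simplicial_cohomology_axioms.intro abstract_complex_nerve) simp
  have p0: "p > 0"
    using p m by (cases "p = 0") auto
  have G: "G V \<in> carrier (integer_mod_group p)" for V
    using p0 by (simp add: G_def carrier_integer_mod_group)
  have "pullback_cochain (nerve ?V) (Suc 0) \<pi> z \<in> coboundaries (nerve ?V) (integer_mod_group p) (Suc 0)"
  proof (rule sc.coboundaryI[of "\<lambda>\<tau>. G (hd \<tau>)"])
    show "G (hd \<tau>) \<in> carrier (integer_mod_group p)" for \<tau> by (rule G)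
    show "pullback_cochain (nerve ?V) (Suc 0) \<pi> z \<in> extensional (ordered_simplices (nerve ?V) (Suc 0))"
      by (simp add: pullback_cochain_def)
    fix \<sigma> assume \<sigma>: "\<sigma> \<in> ordered_simplices (nerve ?V) (Suc 0)"
    then obtain V W where VW: "\<sigma> = [V, W]"
      by (auto simp: ordered_simplices_def length_Suc_conv)
    then obtain x where mem: "V \<in> ?V" "W \<in> ?V" "x \<in> V" "x \<in> W"
      using \<sigma> by (auto simp: ordered_simplices_def mem_nerve_iff)
    have "\<pi> V \<in> \<U>" "\<pi> W \<in> \<U>" "x \<in> \<pi> V" "x \<in> \<pi> W"
      using \<pi> mem unfolding refinement_projection_def by auto
    then have "z [\<pi> V, \<pi> W] \<in> carrier (integer_mod_group p)"
      by (rule z_rel(1))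
    then have "z [\<pi> V, \<pi> W] = z [\<pi> V, \<pi> W] mod int p"
      using p0 by (simp add: carrier_integer_mod_group)
    also have "\<dots> = (G W - G V) mod int p"
      using key[OF mem] by (simp add: cong_def)
    also have "\<dots> = cobd (integer_mod_group p) (\<lambda>\<tau>. G (hd \<tau>)) \<sigma>"
      unfolding VW using cobd_integer_mod_group_pair[of "\<lambda>\<tau>. G (hd \<tau>)" V p W] G by simp
    finally show "pullback_cochain (nerve ?V) (Suc 0) \<pi> z \<sigma> = cobd (integer_mod_group p) (\<lambda>\<tau>. G (hd \<tau>)) \<sigma>"
      using \<sigma> by (simp add: pullback_cochain_def VW)
  qed
  with \<pi> star_cover_open_cover show ?thesis by (intro exI conjI)
qed

lemma mod_acyclic_limit:
  assumes p: "int p dvd 2 * int m - 1"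
  shows "mod_acyclic p (top_of_set limit)"
proof -
  obtain x where "x \<in> limit"
    using limit_point_exists[of "arc_point 0 0" 0] graphI[of 0 0] m by auto
  then have x: "x \<in> topspace (top_of_set limit)" by simp
  show ?thesis
  proof (rule mod_acyclicI[OF connected_limit x])
    fix n \<U> z
    assume U: "\<U> \<in> open_covers (top_of_set limit)"
      and z: "z \<in> cocycles (nerve \<U>) (integer_mod_group p) (Suc n)"
    show "\<exists>\<V> \<pi>. \<V> \<in> open_covers (top_of_set limit) \<and> refinement_projection \<V> \<U> \<pi> \<and>
        pullback_cochain (nerve \<V>) (Suc n) \<pi> z \<in> coboundaries (nerve \<V>) (integer_mod_group p) (Suc n)"
    proof (cases n)
      case 0
      show ?thesis
        using first_cocycles_vanish[OF p U z[unfolded 0]] unfolding 0 .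
    next
      case (Suc k)
      show ?thesis
        using higher_cocycles_vanish[OF abelian_integer_mod_group U z[unfolded Suc]] unfolding Suc .
    qed
  qed
qed

lemma acyclic_limit:
  assumes "prime p" "int p dvd 2 * int m - 1"
  shows "top_of_set limit \<in> acyclic_spaces"
proof -
  have "Hausdorff_space (top_of_set limit)"
    by (intro Hausdorff_space_subtopology Hausdorff_space_euclidean)
  then show ?thesis
    using mod_acyclic_limit[OF assms(2)] assms(1) covering_dim_limit
    unfolding acyclic_spaces_def by blast
qed

subsection \<open>The action\<close>

text \<open>
  The permutation \<open>a\<close> of the arcs, applied to a point of the graph. At a pole the arc is not determined,
  but the result does not depend on it.
\<close>

definition move :: "(nat \<Rightarrow> nat) \<Rightarrow> real \<times> real \<Rightarrow> real \<times> real" where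
  "move a p = arc_point (a (SOME s. s < m \<and> p = arc_point s (fst p))) (fst p)"

lemma move_arc_point:
  assumes "s < m"
  shows "move a (arc_point s t) = arc_point (a s) t"
proof -
  let ?s = "SOME s'. s' < m \<and> arc_point s t = arc_point s' (fst (arc_point s t))"
  have "?s < m \<and> arc_point s t = arc_point ?s (fst (arc_point s t))"
    by (rule someI[of _ s]) (use assms in auto)
  then show ?thesis
    unfolding move_def by (auto simp: arc_point_eq_iff)
qed

lemma continuous_on_move: "continuous_on graph (move a)"
  unfolding graph_eq
proof (rule continuous_on_closed_Union)
  fix s assume s: "s \<in> {..<m}"
  show "closed (arc_point s ` {0..1})"
    by (rule compact_imp_closed[OF compact_arc])
  have "continuous_on (arc_point s ` {0..1}) (\<lambda>p. arc_point (a s) (fst p))"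
    by (intro continuous_on_arc_point continuous_intros)
  then show "continuous_on (arc_point s ` {0..1}) (move a)"
    by (rule continuous_on_eq) (use s in \<open>auto simp: move_arc_point\<close>)
qed simp

text \<open>
  A fixed point has its coordinate \<open>x 0\<close> at a pole, because every arc is moved by some element of
  \<open>Q\<close>. Both poles give fixed points, so the height of \<open>x 0\<close> maps the fixed set continuously onto
  \<open>{0, 1}\<close>.
\<close>

lemma limit_action:
  assumes Q: "group Q"
    and closed: "\<And>q i. q \<in> carrier Q \<Longrightarrow> i < m \<Longrightarrow> \<alpha> q i < m"
    and mult: "\<And>q q' i. q \<in> carrier Q \<Longrightarrow> q' \<in> carrier Q \<Longrightarrow> i < m \<Longrightarrow> \<alpha> (q \<otimes>\<^bsub>Q\<^esub> q') i = \<alpha> q (\<alpha> q' i)"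
    and one: "\<And>i. i < m \<Longrightarrow> \<alpha> \<one>\<^bsub>Q\<^esub> i = i"
    and no_fix: "\<And>i. i < m \<Longrightarrow> \<exists>q\<in>carrier Q. \<alpha> q i \<noteq> i"
    and comm: "\<And>q i j. q \<in> carrier Q \<Longrightarrow> i < m \<Longrightarrow> j < m \<Longrightarrow> r j (\<alpha> q i) = \<alpha> q (r j i)"
  defines "\<phi> \<equiv> \<lambda>q. \<lambda>x\<in>limit. \<lambda>n. move (\<alpha> q) (x n)"
  shows "topological_action Q (top_of_set limit) \<phi>"
    and "\<not> connected_space (subtopology (top_of_set limit) (fixed_points Q (top_of_set limit) \<phi>))"
proof -
  have lap_arc: "lap_arc (\<alpha> q s) l = \<alpha> q (lap_arc s l)" if "q \<in> carrier Q" "s < m" for q s l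
    using comm[OF that, of "l div 2 mod m"] m by (simp add: lap_arc_def)
  have limit: "(\<lambda>n. move (\<alpha> q) (x n)) \<in> limit" if q: "q \<in> carrier Q" and x: "x \<in> limit" for q x
    unfolding limit_def
  proof (intro CollectI allI)
    fix n
    have "(x n, x (Suc n)) \<in> zigzag_rel"
      using x by (simp add: limit_def)
    then obtain s l u where *: "s < m" "l < laps" "0 \<le> u" "u \<le> 1" "x n = arc_point (lap_arc s l) (lap_height l u)"
      "x (Suc n) = arc_point s ((real l + u) / real laps)"
      by (rule zigzag_relE)
    have "move (\<alpha> q) (x n) = arc_point (lap_arc (\<alpha> q s) l) (lap_height l u)"
      unfolding *(5) using move_arc_point[OF lap_arc_less[OF *(1)]] lap_arc[OF q *(1)] by simp
    moreover have "move (\<alpha> q) (x (Suc n)) = arc_point (\<alpha> q s) ((real l + u) / real laps)"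
      unfolding *(6) using move_arc_point[OF *(1)] by simp
    ultimately show "(move (\<alpha> q) (x n), move (\<alpha> q) (x (Suc n))) \<in> zigzag_rel"
      using zigzag_relI[OF closed[OF q *(1)] *(2-4)] by simp
  qed
  show "topological_action Q (top_of_set limit) \<phi>"
  proof (rule topological_actionI[OF Q])
    fix q assume q: "q \<in> carrier Q"
    show "\<phi> q \<in> extensional (topspace (top_of_set limit))"
      by (simp add: \<phi>_def)
    have "continuous_on limit (\<lambda>x. move (\<alpha> q) (x n))" for n
    proof (rule continuous_on_compose2[OF continuous_on_move])
      show "continuous_on limit (\<lambda>x. x n)"
        by (rule continuous_on_subset[OF continuous_on_product_coordinates]) simp
    qed (use limit_graph in auto)
    then have "continuous_on limit (\<lambda>x n. move (\<alpha> q) (x n))"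
      by (rule continuous_on_coordinatewise_then_product)
    then have "continuous_on limit (\<phi> q)"
      by (rule continuous_on_eq) (simp add: \<phi>_def)
    then show "continuous_map (top_of_set limit) (top_of_set limit) (\<phi> q)"
      using limit[OF q] by (auto simp: continuous_map_in_subtopology \<phi>_def)
  next
    fix q q' x assume q: "q \<in> carrier Q" "q' \<in> carrier Q" and "x \<in> topspace (top_of_set limit)"
    then have x: "x \<in> limit" by simp
    have "move (\<alpha> (q \<otimes>\<^bsub>Q\<^esub> q')) (x n) = move (\<alpha> q) (move (\<alpha> q') (x n))" for n
    proof -
      obtain s t where "s < m" "x n = arc_point s t"
        using limit_graph[OF x] by (rule graphE)
      then show ?thesis using q closed mult by (simp add: move_arc_point)
    qed
    then show "\<phi> (q \<otimes>\<^bsub>Q\<^esub> q') x = \<phi> q (\<phi> q' x)"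
      using x limit[OF q(2) x] by (simp add: \<phi>_def)
  next
    fix x assume "x \<in> topspace (top_of_set limit)"
    then have x: "x \<in> limit" by simp
    have "move (\<alpha> \<one>\<^bsub>Q\<^esub>) (x n) = x n" for n
    proof -
      obtain s t where "s < m" "x n = arc_point s t"
        using limit_graph[OF x] by (rule graphE)
      then show ?thesis using one by (simp add: move_arc_point)
    qed
    then show "\<phi> \<one>\<^bsub>Q\<^esub> x = x"
      using x by (simp add: \<phi>_def)
  qed
  let ?F = "fixed_points Q (top_of_set limit) \<phi>"
  have F_sub: "?F \<subseteq> limit"
    by (auto simp: fixed_points_def)
  have ends: "fst (x 0) = 0 \<or> fst (x 0) = 1" if x: "x \<in> ?F" for x
  proof -
    have xl: "x \<in> limit" and fx: "\<And>q. q \<in> carrier Q \<Longrightarrow> \<phi> q x = x"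
      using x by (auto simp: fixed_points_def)
    obtain s t where st: "s < m" "x 0 = arc_point s t"
      using limit_graph[OF xl] by (rule graphE)
    obtain q where q: "q \<in> carrier Q" "\<alpha> q s \<noteq> s"
      using no_fix[OF st(1)] by blast
    have "arc_point (\<alpha> q s) t = arc_point s t"
      using fun_cong[OF fx[OF q(1)], of 0] xl st by (simp add: \<phi>_def move_arc_point)
    with q(2) show ?thesis
      by (auto simp: arc_point_eq_iff st(2))
  qed
  have pole: "(\<lambda>n. arc_point 0 c) \<in> ?F" if c: "c = 0 \<or> c = 1" for c
  proof -
    have pc: "arc_point s c = arc_point 0 c" for s
      using c by (auto simp: arc_point_eq_iff)
    have "(arc_point 0 c, arc_point 0 c) \<in> zigzag_rel"
    proof (cases "c = 0")
      case True
      then show ?thesis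
        using zigzag_relI[of 0 0 0] m laps_pos pc[of "lap_arc 0 0"] by (simp add: lap_height_def)
    next
      case False
      then have c1: "c = 1" using c by simp
      have "(real (laps - 1) + 1) / real laps = 1"
        using laps_pos by (simp add: of_nat_diff)
      moreover have "even (laps - 1)" using laps_odd by simp
      ultimately show ?thesis
        using zigzag_relI[of 0 "laps - 1" 1] m laps_pos pc[of "lap_arc 0 (laps - 1)"] by (simp add: lap_height_def c1)
    qed
    then have l: "(\<lambda>n. arc_point 0 c) \<in> limit"
      by (simp add: limit_def)
    have "\<phi> q (\<lambda>n. arc_point 0 c) = (\<lambda>n. arc_point 0 c)" if "q \<in> carrier Q" for q
    proof -
      have "move (\<alpha> q) (arc_point 0 c) = arc_point 0 c"
        using move_arc_point[of 0 "\<alpha> q" c] pc[of "\<alpha> q 0"] m by simp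
      then show ?thesis
        using l by (simp add: \<phi>_def)
    qed
    with l show ?thesis
      by (simp add: fixed_points_def)
  qed
  show "\<not> connected_space (subtopology (top_of_set limit) ?F)"
  proof
    assume "connected_space (subtopology (top_of_set limit) ?F)"
    then have "connected ?F"
      using F_sub unfolding connectedin_iff_connected[symmetric] connectedin_def
      by (simp add: subtopology_subtopology Int_absorb1)
    moreover have "continuous_on ?F (\<lambda>x. fst (x 0))"
      by (intro continuous_on_fst continuous_on_subset[OF continuous_on_product_coordinates]) simp
    ultimately have "connected ((\<lambda>x. fst (x 0)) ` ?F)"
      by (intro connected_continuous_image)
    moreover have "(\<lambda>x. fst (x 0)) ` ?F = {0, 1}"
    proof (intro equalityI subsetI)
      fix c :: real assume "c \<in> {0, 1}"
      then show "c \<in> (\<lambda>x. fst (x 0)) ` ?F"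
        using pole[of c] by (intro image_eqI[of _ _ "\<lambda>n. arc_point 0 c"]) auto
    qed (use ends in auto)
    ultimately have "connected {0, 1 :: real}" by simp
    then have "(1 / 2 :: real) \<in> {0, 1}"
      by (rule connectedD_interval[of _ 0 1]) simp_all
    then show False by simp
  qed
qed

end

section \<open>Actions on locally finite acyclic complexes\<close>

theorem corollary1p2:
  fixes Q :: "('g, 'm) monoid_scheme"
  assumes "group Q" and "infinite (carrier Q)" and "finitely_generated_group Q"
    and universe: "\<exists>f :: real \<Rightarrow> 'u. inj f"
    and a: "\<forall>(X :: 'u topology) \<phi>. X \<in> acyclic_spaces \<and> topological_action Q X \<phi> \<longrightarrow>
              (\<exists>x \<in> topspace X. \<forall>g \<in> carrier Q. \<phi> g x = x)"
    and b: "\<forall>p (X :: 'u topology) \<phi>.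
              prime p \<and> X \<in> acyclic_spaces \<and> mod_acyclic p X \<and> topological_action Q X \<phi> \<longrightarrow>
              mod_acyclic p (subtopology X (fixed_points Q X \<phi>))"
  shows "\<not> (\<exists>(K :: 'v set set) \<phi>.
              abstract_complex K \<and> locally_finite_complex K \<and>
              realization K \<in> acyclic_spaces \<and>
              simplicial_action Q K \<phi> \<and> nontrivial_action Q (realization K) \<phi>)"
proof (rule notI, elim exE conjE)
  fix K :: "'v set set" and \<phi>
  assume K: "abstract_complex K" "locally_finite_complex K" and ac: "realization K \<in> acyclic_spaces"
    and act: "simplicial_action Q K \<phi>" and nontriv: "nontrivial_action Q (realization K) \<phi>"
  obtain emb :: "real \<Rightarrow> 'u" where emb: "inj emb"
    using universe by blast
  have conn: "connected_space (realization K)"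
    using ac mod_acyclic_imp_connected_space by (auto simp: acyclic_spaces_def)
  obtain h :: "('v \<Rightarrow> real) \<Rightarrow> real" where "inj_on h (realization_points K)"
    by (rule realization_inj_real[OF K conn])
  then have "inj_on (emb \<circ> h) (topspace (realization K))"
    using emb by (auto simp: topspace_realization intro!: comp_inj_on inj_on_subset[OF emb])
  then have fixed: "fixed_points Q (realization K) \<phi> \<noteq> {}"
    using act by (intro transport_fixed_point[OF a _ ac]) (simp_all add: simplicial_action_def)
  show False
  proof (rule simplicial_action_finite_orbit[OF K conn act fixed nontriv])
    fix B f
    assume B: "finite B" "\<And>q v. q \<in> carrier Q \<Longrightarrow> v \<in> B \<Longrightarrow> f q v \<in> B"
      "\<And>q r v. q \<in> carrier Q \<Longrightarrow> r \<in> carrier Q \<Longrightarrow> v \<in> B \<Longrightarrow> f (q \<otimes>\<^bsub>Q\<^esub> r) v = f q (f r v)"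
      "\<And>v. v \<in> B \<Longrightarrow> f \<one>\<^bsub>Q\<^esub> v = v" "\<exists>q\<in>carrier Q. \<exists>v\<in>B. f q v \<noteq> v"
    show False
    proof (rule finite_action_regular[OF assms(1) B])
      fix m \<alpha> r
      assume m: "m \<ge> (2 :: nat)"
        and \<alpha>: "\<And>q i. q \<in> carrier Q \<Longrightarrow> i < m \<Longrightarrow> \<alpha> q i < m"
        "\<And>q q' i. q \<in> carrier Q \<Longrightarrow> q' \<in> carrier Q \<Longrightarrow> i < m \<Longrightarrow> \<alpha> (q \<otimes>\<^bsub>Q\<^esub> q') i = \<alpha> q (\<alpha> q' i)"
        "\<And>i. i < m \<Longrightarrow> \<alpha> \<one>\<^bsub>Q\<^esub> i = i"
        "\<And>i. i < m \<Longrightarrow> \<exists>q\<in>carrier Q. \<alpha> q i \<noteq> i"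
        and r: "\<And>i. i < m \<Longrightarrow> bij_betw (\<lambda>j. r j i) {..<m} {..<m}"
        and comm: "\<And>q i j. q \<in> carrier Q \<Longrightarrow> i < m \<Longrightarrow> j < m \<Longrightarrow> r j (\<alpha> q i) = \<alpha> q (r j i)"
      interpret zigzag m r
        by unfold_locales (use m r in auto)
      obtain p where p: "prime p" "p dvd 2 * m - 1"
      proof -
        have "2 * m - 1 \<noteq> 1" using m by simp
        from prime_factor_nat[OF this] that show thesis by blast
      qed
      have "int p dvd int (2 * m - 1)"
        using p(2) by simp
      then have p': "int p dvd 2 * int m - 1"
        using m by (simp add: of_nat_diff)
      let ?X = "top_of_set limit" and ?\<psi> = "\<lambda>q. \<lambda>x\<in>limit. \<lambda>n. move (\<alpha> q) (x n)"
      note L_act = limit_action[OF assms(1) \<alpha> comm]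
      obtain k :: "(nat \<Rightarrow> real \<times> real) \<Rightarrow> real" where "inj k"
        using second_countable_inj_real[where 'a = "nat \<Rightarrow> real \<times> real"] by (elim exE)
      then have k: "inj_on (emb \<circ> k) (topspace ?X)"
        using inj_compose[OF emb] inj_on_subset by blast
      have "mod_acyclic p (subtopology ?X (fixed_points Q ?X ?\<psi>))"
        by (rule transport_acyclic_fixed_points[OF b k acyclic_limit[OF p(1) p'] L_act(1) p(1) mod_acyclic_limit[OF p']])
      then show False
        using mod_acyclic_imp_connected_space[OF p(1)] L_act(2) by blast
    qed
  qed
qed

end
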